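(* Let $r_k:C_{k+1}\to C_k$ ($k\ge0$) be an inverse system of compact spaces in which each $r_k$ is a surjective local homeomorphism. Let $w_0=1$ and suppose $w_k\in C(C_k)$ satisfy $\sum_{r_k(d)=c}|w_{k+1}(d)|^2=|w_k(c)|^2$ for every $k\ge0$ and every $c\in C_k$. Let $(X_k,r_k^* )$ be the associated direct system of Hilbert $C(C_0)$-modules, let $C_\infty=\varprojlim(C_k,r_k)$ with canonical maps $\pi_k:C_\infty\to C_k$, and for $c\in C_0$ let $\mu^c$ be the associated probability measure on $\pi_0^{-1}(c)$ (all as defined in the context). Then with $$(x\cdot f)(d)=x(d)f(\pi_0(d))\quad\text{and}\quad \langle x,y\rangle(c):=\int_{\pi_0^{-1}(c)}\overline{x(d)}y(d)\,d\mu^c(d)$$ for $x,y\in C(C_\infty)$ and $f\in C(C_0)$, $C(C_\infty)$ is an inner-product module over $C(C_0)$. Denote the completion by $X_\infty$. Then the maps $\pi_k^*:C(C_k)\to C(C_\infty)$, $\pi_k^*x=x\circ\pi_k$, extend to inner-product preserving homomorphisms of $X_k$ into $X_\infty$, and $(X_\infty,\pi_k^* )$ is a direct limit for $(X_k,r_k^* )$.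
   Context: For $k\ge1$ put $r^{(k)}:=r_0\circ r_1\circ\cdots\circ r_{k-1}:C_k\to C_0$, and $r^{(0)}=\mathrm{id}$. $X_k$ is the Hilbert $C(C_0)$-module obtained from $C(C_k)$, with the right action $(x\cdot f)(c)=x(c)f(r^{(k)}(c))$ and the inner product $$\langle x,y\rangle_k(c)=\sum_{r^{(k)}(d)=c}\overline{x(d)}y(d)|w_k(d)|^2,$$ by completing (if necessary). The maps $r_k^*:C(C_k)\to C(C_{k+1})$, $r_k^*x=x\circ r_k$, satisfy $\langle r_k^*x,r_k^*y\rangle_{k+1}=\langle x,y\rangle_k$, and hence give inner-product preserving maps $X_k\to X_{k+1}$. For $c\in C_0$, $\mu^c$ is the unique probability measure on the fibre $\pi_0^{-1}(c)=\varprojlim((r^{(k)})^{-1}(c),r_k)$ such that $$\int (x\circ\pi_k)\,d\mu^c=\sum_{r^{(k)}(d)=c}x(d)|w_k(d)|^2\quad\text{for all }k\ge0\text{ and }x\in C(C_k)$$ (its existence and uniqueness are standard). A direct limit of a system $(X_k,T_k)$ of Hilbert $A$-modules with inner-product preserving $T_k:X_k\to X_{k+1}$ is a pair $(X_\infty,\iota^k)$ consisting of a Hilbert $A$-module and inner-product preserving maps $\iota^k:X_k\to X_\infty$ with $\iota^{k+1}\circ T_k=\iota^k$ such that, whenever $R_k:X_k\to Z$ are bounded $A$-module homomorphisms into a Hilbert $A$-module $Z$ with $R_{k+1}\circ T_k=R_k$ and $\|R_k\|\le K$ for all $k\ge 0$, there is a unique bounded $A$-module homomorphism $R_\infty:X_\infty\to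 Z$ with $\|R_\infty\|\le K$ and $R_\infty\circ\iota^k=R_k$ for all $k\ge 0$.
   Formalization: C(C_∞) is proved to be a pre-inner-product module in general; definiteness (⟨x,x⟩=0 implies x=0) is claimed only when every {w_k≠0} is dense in C_k, as it fails otherwise, and the completion divides out null vectors. *)

theory Defs
  imports "HOL-Probability.Probability" "HOL-Algebra.Module"
begin

text \<open>
  Topological spaces are values of type \<^typ>\<open>'a topology\<close>, so that a sequence of different spaces
  can be quantified over.  A continuous function on a space \<open>B\<close> is represented by its
  extensional representative (\<^term>\<open>undefined\<close> off \<^term>\<open>topspace B\<close>), which makes equality of
  functions on \<open>B\<close> the equality of HOL.
\<close>

definition cont_fun_ring :: "'a topology \<Rightarrow> ('a \<Rightarrow> complex) ring" where
  "cont_fun_ring B =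
     \<lparr> carrier = {f \<in> extensional (topspace B). continuous_map B euclidean f},
       mult = (\<lambda>f g. \<lambda>c\<in>topspace B. f c * g c),
       one = (\<lambda>c\<in>topspace B. 1),
       zero = (\<lambda>c\<in>topspace B. 0),
       add = (\<lambda>f g. \<lambda>c\<in>topspace B. f c + g c) \<rparr>"

text \<open>The \<open>0\<close> is inserted only so that the norm is \<open>0\<close> when the space is empty.\<close>

definition sup_norm :: "'a topology \<Rightarrow> ('a \<Rightarrow> complex) \<Rightarrow> real" where
  "sup_norm B f = Sup (insert 0 ((\<lambda>c. cmod (f c)) ` topspace B))"


section \<open>Hilbert modules over the algebra of continuous functions on a compact space\<close>

text \<open>
  The right action \<open>x \<cdot> f\<close> is written \<open>f \<odot> x\<close>, as in the module locale of HOL-Algebra; since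
  the coefficient algebra is commutative, left and right modules are the same thing.  The algebra is
  unital, so multiplication by a complex scalar is the action of the corresponding constant
  function.  The ring fields \<open>mult\<close> and \<open>one\<close> of a module record carry no meaning.
\<close>

record ('r, 'm) ip_module = "('r, 'm) module" +
  ip :: "'m \<Rightarrow> 'm \<Rightarrow> 'r"

definition pre_inner_product_module ::
    "'a topology \<Rightarrow> ('a \<Rightarrow> complex, 'm) ip_module \<Rightarrow> bool" where
  "pre_inner_product_module B M \<longleftrightarrow>
     Module.module (cont_fun_ring B) M \<and>
     (\<forall>x\<in>carrier M. \<forall>y\<in>carrier M. ip M x y \<in> carrier (cont_fun_ring B)) \<and>
     (\<forall>x\<in>carrier M. \<forall>y\<in>carrier M. \<forall>z\<in>carrier M.
        ip M x (y \<oplus>\<^bsub>M\<^esub> z) = ip M x y \<oplus>\<^bsub>cont_fun_ring B\<^esub> ip M x z) \<and>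
     (\<forall>x\<in>carrier M. \<forall>y\<in>carrier M. \<forall>f\<in>carrier (cont_fun_ring B).
        ip M x (f \<odot>\<^bsub>M\<^esub> y) = ip M x y \<otimes>\<^bsub>cont_fun_ring B\<^esub> f) \<and>
     (\<forall>x\<in>carrier M. \<forall>y\<in>carrier M. \<forall>c\<in>topspace B. ip M y x c = cnj (ip M x y c)) \<and>
     (\<forall>x\<in>carrier M. \<forall>c\<in>topspace B. ip M x x c \<in> \<real>\<^sub>\<ge>\<^sub>0)"

definition inner_product_module ::
    "'a topology \<Rightarrow> ('a \<Rightarrow> complex, 'm) ip_module \<Rightarrow> bool" where
  "inner_product_module B M \<longleftrightarrow>
     pre_inner_product_module B M \<and>
     (\<forall>x\<in>carrier M. ip M x x = \<zero>\<^bsub>cont_fun_ring B\<^esub> \<longrightarrow> x = \<zero>\<^bsub>M\<^esub>)"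

definition mod_norm :: "'a topology \<Rightarrow> ('a \<Rightarrow> complex, 'm) ip_module \<Rightarrow> 'm \<Rightarrow> real" where
  "mod_norm B M x = sqrt (sup_norm B (ip M x x))"

definition cauchy_seqs :: "'a topology \<Rightarrow> ('a \<Rightarrow> complex, 'm) ip_module \<Rightarrow> (nat \<Rightarrow> 'm) set" where
  "cauchy_seqs B M =
     {s. (\<forall>n. s n \<in> carrier M) \<and>
         (\<forall>e>0. \<exists>N. \<forall>m\<ge>N. \<forall>n\<ge>N. mod_norm B M (s m \<ominus>\<^bsub>M\<^esub> s n) < e)}"

definition hilbert_module ::
    "'a topology \<Rightarrow> ('a \<Rightarrow> complex, 'm) ip_module \<Rightarrow> bool" where
  "hilbert_module B M \<longleftrightarrow>
     inner_product_module B M \<and>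
     (\<forall>s\<in>cauchy_seqs B M. \<exists>x\<in>carrier M. (\<lambda>n. mod_norm B M (s n \<ominus>\<^bsub>M\<^esub> x)) \<longlonglongrightarrow> 0)"

definition module_homs ::
    "'a topology \<Rightarrow> ('a \<Rightarrow> complex, 'm) ip_module \<Rightarrow> ('a \<Rightarrow> complex, 'n) ip_module \<Rightarrow> ('m \<Rightarrow> 'n) set"
  where
  "module_homs B M N =
     {T \<in> carrier M \<rightarrow> carrier N.
        (\<forall>x\<in>carrier M. \<forall>y\<in>carrier M. T (x \<oplus>\<^bsub>M\<^esub> y) = T x \<oplus>\<^bsub>N\<^esub> T y) \<and>
        (\<forall>x\<in>carrier M. \<forall>f\<in>carrier (cont_fun_ring B). T (f \<odot>\<^bsub>M\<^esub> x) = f \<odot>\<^bsub>N\<^esub> T x)}"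

definition bounded_module_homs ::
    "'a topology \<Rightarrow> ('a \<Rightarrow> complex, 'm) ip_module \<Rightarrow> ('a \<Rightarrow> complex, 'n) ip_module \<Rightarrow> ('m \<Rightarrow> 'n) set"
  where
  "bounded_module_homs B M N =
     {T \<in> module_homs B M N. \<exists>K. \<forall>x\<in>carrier M. mod_norm B N (T x) \<le> K * mod_norm B M x}"

definition op_norm ::
    "'a topology \<Rightarrow> ('a \<Rightarrow> complex, 'm) ip_module \<Rightarrow> ('a \<Rightarrow> complex, 'n) ip_module \<Rightarrow> ('m \<Rightarrow> 'n) \<Rightarrow> real"
  where
  "op_norm B M N T = Sup {mod_norm B N (T x) |x. x \<in> carrier M \<and> mod_norm B M x \<le> 1}"

definition ip_preserving ::
    "('r, 'm) ip_module \<Rightarrow> ('r, 'n) ip_module \<Rightarrow> ('m \<Rightarrow> 'n) \<Rightarrow> bool" where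
  "ip_preserving M N T \<longleftrightarrow>
     T \<in> carrier M \<rightarrow> carrier N \<and>
     (\<forall>x\<in>carrier M. \<forall>y\<in>carrier M. ip N (T x) (T y) = ip M x y)"


subsection \<open>Completion of a pre-inner-product module\<close>

text \<open>
  Elements are classes of Cauchy sequences modulo sequences of distance tending to \<open>0\<close>.  In
  particular vectors of length zero are divided out, so the construction also applies when the inner
  product is degenerate.  The operations are given on chosen representatives; the pointwise limit
  in the inner product is in fact a uniform one.
\<close>

definition compl_class ::
    "'a topology \<Rightarrow> ('a \<Rightarrow> complex, 'm) ip_module \<Rightarrow> (nat \<Rightarrow> 'm) \<Rightarrow> (nat \<Rightarrow> 'm) set" where
  "compl_class B M s =
     {t \<in> cauchy_seqs B M. (\<lambda>n. mod_norm B M (s n \<ominus>\<^bsub>M\<^esub> t n)) \<longlonglongrightarrow> 0}"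

definition compl_rep :: "(nat \<Rightarrow> 'm) set \<Rightarrow> nat \<Rightarrow> 'm" where
  "compl_rep S = (SOME s. s \<in> S)"

definition mod_completion ::
    "'a topology \<Rightarrow> ('a \<Rightarrow> complex, 'm) ip_module \<Rightarrow> ('a \<Rightarrow> complex, (nat \<Rightarrow> 'm) set) ip_module" where
  "mod_completion B M =
     \<lparr> carrier = compl_class B M ` cauchy_seqs B M,
       mult = undefined,
       one = undefined,
       zero = compl_class B M (\<lambda>n. \<zero>\<^bsub>M\<^esub>),
       add = (\<lambda>S T. compl_class B M (\<lambda>n. compl_rep S n \<oplus>\<^bsub>M\<^esub> compl_rep T n)),
       smult = (\<lambda>f S. compl_class B M (\<lambda>n. f \<odot>\<^bsub>M\<^esub> compl_rep S n)),
       ip = (\<lambda>S T. \<lambda>c\<in>topspace B. lim (\<lambda>n. ip M (compl_rep S n) (compl_rep T n) c)) \<rparr>"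

definition compl_embed ::
    "'a topology \<Rightarrow> ('a \<Rightarrow> complex, 'm) ip_module \<Rightarrow> 'm \<Rightarrow> (nat \<Rightarrow> 'm) set" where
  "compl_embed B M x = compl_class B M (\<lambda>n. x)"

text \<open>
  The extension by continuity of a map \<open>T\<close> from a module into a module \<open>N\<close> to a map between the
  completions; it is used only for inner-product preserving \<open>T\<close>.
\<close>

definition compl_map ::
    "'a topology \<Rightarrow> ('a \<Rightarrow> complex, 'n) ip_module \<Rightarrow> ('m \<Rightarrow> 'n) \<Rightarrow> (nat \<Rightarrow> 'm) set \<Rightarrow> (nat \<Rightarrow> 'n) set"
  where
  "compl_map B N T S = compl_class B N (\<lambda>n. T (compl_rep S n))"


subsection \<open>Direct limits of Hilbert modules\<close>

definition direct_system ::
    "'a topology \<Rightarrow> (nat \<Rightarrow> ('a \<Rightarrow> complex, 'm) ip_module) \<Rightarrow> (nat \<Rightarrow> 'm \<Rightarrow> 'm) \<Rightarrow> bool" where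
  "direct_system B X T \<longleftrightarrow>
     (\<forall>k. hilbert_module B (X k)) \<and> (\<forall>k. ip_preserving (X k) (X (Suc k)) (T k))"

text \<open>
  HOL cannot quantify over types inside a definition, so the element type \<open>'z\<close> of the test
  modules \<open>Z\<close> is a parameter; a theorem in which \<open>'z\<close> is a free type variable asserts the
  universal property for all types.  Requiring \<open>R\<close> to be extensional turns uniqueness on the
  carrier into uniqueness of HOL functions.
\<close>

definition is_direct_limit ::
    "'z itself \<Rightarrow> 'a topology \<Rightarrow> (nat \<Rightarrow> ('a \<Rightarrow> complex, 'm) ip_module) \<Rightarrow> (nat \<Rightarrow> 'm \<Rightarrow> 'm) \<Rightarrow>
     ('a \<Rightarrow> complex, 'l) ip_module \<Rightarrow> (nat \<Rightarrow> 'm \<Rightarrow> 'l) \<Rightarrow> bool" where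
  "is_direct_limit (_ :: 'z itself) B X T L \<iota> \<longleftrightarrow>
     direct_system B X T \<and>
     hilbert_module B L \<and>
     (\<forall>k. ip_preserving (X k) L (\<iota> k)) \<and>
     (\<forall>k. \<forall>x\<in>carrier (X k). \<iota> (Suc k) (T k x) = \<iota> k x) \<and>
     (\<forall>(Z :: ('a \<Rightarrow> complex, 'z) ip_module) R K.
        hilbert_module B Z \<and>
        (\<forall>k. R k \<in> bounded_module_homs B (X k) Z) \<and>
        (\<forall>k. \<forall>x\<in>carrier (X k). R (Suc k) (T k x) = R k x) \<and>
        (\<forall>k. op_norm B (X k) Z (R k) \<le> K)
        \<longrightarrow>
        (\<exists>!S. S \<in> extensional (carrier L) \<and>
              S \<in> bounded_module_homs B L Z \<and>
              op_norm B L Z S \<le> K \<and>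
              (\<forall>k. \<forall>x\<in>carrier (X k). S (\<iota> k x) = R k x)))"


section \<open>The inverse system and its modules\<close>

definition local_homeomorphism_map :: "'a topology \<Rightarrow> 'b topology \<Rightarrow> ('a \<Rightarrow> 'b) \<Rightarrow> bool" where
  "local_homeomorphism_map X Y f \<longleftrightarrow>
     f \<in> topspace X \<rightarrow> topspace Y \<and>
     (\<forall>x\<in>topspace X. \<exists>U. openin X U \<and> x \<in> U \<and> openin Y (f ` U) \<and>
        homeomorphic_map (subtopology X U) (subtopology Y (f ` U)) f)"

text \<open>\<open>down r k\<close> is the composition \<open>r 0 \<circ> \<dots> \<circ> r (k - 1)\<close>.\<close>

fun down :: "(nat \<Rightarrow> 'a \<Rightarrow> 'a) \<Rightarrow> nat \<Rightarrow> 'a \<Rightarrow> 'a" where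
  "down r 0 = id"
| "down r (Suc k) = down r k \<circ> r k"

definition fibre :: "(nat \<Rightarrow> 'a topology) \<Rightarrow> (nat \<Rightarrow> 'a \<Rightarrow> 'a) \<Rightarrow> nat \<Rightarrow> 'a \<Rightarrow> 'a set" where
  "fibre C r k c = {d \<in> topspace (C k). down r k d = c}"

text \<open>
  Before completion.  The sum in the inner product is over a finite set, because \<open>C k\<close> is compact
  and \<open>down r k\<close> is a local homeomorphism.
\<close>

definition level_module ::
    "(nat \<Rightarrow> 'a topology) \<Rightarrow> (nat \<Rightarrow> 'a \<Rightarrow> 'a) \<Rightarrow> (nat \<Rightarrow> 'a \<Rightarrow> complex) \<Rightarrow> nat \<Rightarrow>
     ('a \<Rightarrow> complex, 'a \<Rightarrow> complex) ip_module" where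
  "level_module C r w k =
     \<lparr> carrier = carrier (cont_fun_ring (C k)),
       mult = undefined,
       one = undefined,
       zero = zero (cont_fun_ring (C k)),
       add = add (cont_fun_ring (C k)),
       smult = (\<lambda>f x. \<lambda>d\<in>topspace (C k). x d * f (down r k d)),
       ip = (\<lambda>x y. \<lambda>c\<in>topspace (C 0).
               \<Sum>d\<in>fibre C r k c. cnj (x d) * y d * complex_of_real ((cmod (w k d))\<^sup>2)) \<rparr>"

definition pullback :: "'b topology \<Rightarrow> ('b \<Rightarrow> 'a) \<Rightarrow> ('a \<Rightarrow> complex) \<Rightarrow> 'b \<Rightarrow> complex" where
  "pullback Y p x = (\<lambda>d\<in>topspace Y. x (p d))"

text \<open>The canonical map from the inverse limit to \<open>C k\<close> is \<open>\<lambda>d. d k\<close>.\<close>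

definition inverse_limit :: "(nat \<Rightarrow> 'a topology) \<Rightarrow> (nat \<Rightarrow> 'a \<Rightarrow> 'a) \<Rightarrow> (nat \<Rightarrow> 'a) topology" where
  "inverse_limit C r = subtopology (product_topology C UNIV) {d. \<forall>k. r k (d (Suc k)) = d k}"

definition limit_fibre ::
    "(nat \<Rightarrow> 'a topology) \<Rightarrow> (nat \<Rightarrow> 'a \<Rightarrow> 'a) \<Rightarrow> 'a \<Rightarrow> (nat \<Rightarrow> 'a) topology" where
  "limit_fibre C r c = subtopology (inverse_limit C r) {d. d 0 = c}"

text \<open>
  The properties characterizing \<open>\<mu>\<^sup>c\<close>.  The limit fibre is a sequential inverse limit of finite
  discrete spaces, hence compact and metrizable, so every probability measure on its Borel
  sigma-algebra is regular and the measure is unique without a regularity condition.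
\<close>

definition is_fibre_measure ::
    "(nat \<Rightarrow> 'a topology) \<Rightarrow> (nat \<Rightarrow> 'a \<Rightarrow> 'a) \<Rightarrow> (nat \<Rightarrow> 'a \<Rightarrow> complex) \<Rightarrow> 'a \<Rightarrow>
     (nat \<Rightarrow> 'a) measure \<Rightarrow> bool" where
  "is_fibre_measure C r w c M \<longleftrightarrow>
     prob_space M \<and>
     sets M = sets (sigma (topspace (limit_fibre C r c)) {U. openin (limit_fibre C r c) U}) \<and>
     (\<forall>k. \<forall>x\<in>carrier (cont_fun_ring (C k)).
        integral\<^sup>L M (\<lambda>d. x (d k)) =
          (\<Sum>d\<in>fibre C r k c. x d * complex_of_real ((cmod (w k d))\<^sup>2)))"

definition limit_module ::
    "(nat \<Rightarrow> 'a topology) \<Rightarrow> (nat \<Rightarrow> 'a \<Rightarrow> 'a) \<Rightarrow> ('a \<Rightarrow> (nat \<Rightarrow> 'a) measure) \<Rightarrow>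
     ('a \<Rightarrow> complex, (nat \<Rightarrow> 'a) \<Rightarrow> complex) ip_module" where
  "limit_module C r \<mu> =
     \<lparr> carrier = carrier (cont_fun_ring (inverse_limit C r)),
       mult = undefined,
       one = undefined,
       zero = zero (cont_fun_ring (inverse_limit C r)),
       add = add (cont_fun_ring (inverse_limit C r)),
       smult = (\<lambda>f x. \<lambda>d\<in>topspace (inverse_limit C r). x d * f (d 0)),
       ip = (\<lambda>x y. \<lambda>c\<in>topspace (C 0). integral\<^sup>L (\<mu> c) (\<lambda>d. cnj (x d) * y d)) \<rparr>"

end

(*
  Vectors in every module carry the seminorms |x|_c = <x,x>(c)^(1/2), so the module norm is a supremum of
  Hilbert-space seminorms and the completion can be handled with Cauchy-Schwarz at each point c.
  The inner product on C(C_infinity) takes continuous values because the functions x o pi_k are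
  uniformly dense in C(C_infinity) and the sums over the fibres of a local homeomorphism of compact
  spaces depend continuously on the base point.  The same density makes the union of the images of
  the X_k dense in X_infinity; a compatible family R_k defines a K-bounded homomorphism on this
  union, and it extends uniquely by continuity.  An inner-product preserving map into a module with
  definite inner product is automatically a module homomorphism.
*)

theory Submission
  imports Defs
begin

section \<open>Inner-product modules\<close>

text \<open>The inner products are in general only semidefinite: on a two-sheeted cover with weight
  1 on one sheet and 0 on the other, functions carried by the second sheet have length zero. Level
  and limit modules are therefore handled as pre-inner-product modules, and definiteness of
  C(C_infinity) is deduced from density of the sets where w_k is nonzero. Degeneracy also shapes the
  treatment of maps: before completion vectors are compared through the length of their difference,
  never through equality. Two obstacles remain. A vector in the union of the images may come from
  several levels and several representatives; a compatible family takes one value on all of them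
  because pi_k^* preserves length and R_k is dominated by it. And functions on C_0 produced by
  limits must be continuous, so every estimate has to be uniform in c: for Cauchy sequences this
  comes from bounds in the module norm, for integrals from approximation in the supremum norm
  together with the total mass 1 of mu^c.\<close>

lemma continuous_map_complex_mult:
  fixes f g :: "'a \<Rightarrow> complex"
  assumes "continuous_map X euclidean f" "continuous_map X euclidean g"
  shows "continuous_map X euclidean (\<lambda>x. f x * g x)"
  using assms by (simp add: continuous_map_atin tendsto_mult)

lemma continuous_map_cnj:
  assumes "continuous_map X euclidean f"
  shows "continuous_map X euclidean (\<lambda>x. cnj (f x))"
  using assms by (simp add: continuous_map_atin tendsto_cnj)

lemma continuous_map_complex_of_real:
  assumes "continuous_map X euclidean f"
  shows "continuous_map X euclidean (\<lambda>x. complex_of_real (f x))"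
  using assms by (simp add: continuous_map_atin tendsto_of_real)

lemma continuous_map_restrict_iff [simp]:
  "continuous_map X Y (\<lambda>x\<in>topspace X. f x) \<longleftrightarrow> continuous_map X Y f"
  by (auto simp: continuous_map_def Pi_iff cong: conj_cong)

section \<open>The ring of continuous functions and its supremum norm\<close>

lemma mem_cont_fun_ring:
  "f \<in> carrier (cont_fun_ring X) \<longleftrightarrow> f \<in> extensional (topspace X) \<and> continuous_map X euclidean f"
  by (simp add: cont_fun_ring_def)

lemma cont_fun_ring_simps:
  "f \<otimes>\<^bsub>cont_fun_ring X\<^esub> g = (\<lambda>c\<in>topspace X. f c * g c)"
  "f \<oplus>\<^bsub>cont_fun_ring X\<^esub> g = (\<lambda>c\<in>topspace X. f c + g c)"
  "\<zero>\<^bsub>cont_fun_ring X\<^esub> = (\<lambda>c\<in>topspace X. 0)"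
  "\<one>\<^bsub>cont_fun_ring X\<^esub> = (\<lambda>c\<in>topspace X. 1)"
  by (simp_all add: cont_fun_ring_def)

lemma cring_cont_fun_ring: "cring (cont_fun_ring X)"
proof (rule cringI)
  show "abelian_group (cont_fun_ring X)"
  proof (rule abelian_groupI)
    fix f assume "f \<in> carrier (cont_fun_ring X)"
    then show "\<exists>g\<in>carrier (cont_fun_ring X). g \<oplus>\<^bsub>cont_fun_ring X\<^esub> f = \<zero>\<^bsub>cont_fun_ring X\<^esub>"
      by (intro bexI [where x = "\<lambda>c\<in>topspace X. - f c"])
        (auto simp: cont_fun_ring_simps mem_cont_fun_ring continuous_map_minus cong: restrict_cong)
  qed (auto simp: cont_fun_ring_simps mem_cont_fun_ring continuous_map_add extensional_def cong: restrict_cong)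
  show "Group.comm_monoid (cont_fun_ring X)"
    by (rule comm_monoidI)
      (auto simp: cont_fun_ring_simps mem_cont_fun_ring continuous_map_complex_mult extensional_def cong: restrict_cong)
qed (auto simp: cont_fun_ring_simps mem_cont_fun_ring distrib_right cong: restrict_cong)

lemma compact_space_norm_bounded:
  fixes f :: "'a \<Rightarrow> complex"
  assumes "compact_space X" "continuous_map X euclidean f"
  shows "\<exists>K\<ge>0. \<forall>c\<in>topspace X. cmod (f c) \<le> K"
proof -
  have "compactin euclidean (f ` topspace X)"
    using assms compact_space_def image_compactin by blast
  then have "bounded (f ` topspace X)"
    by (simp add: compact_imp_bounded)
  then obtain K where "\<forall>c\<in>topspace X. cmod (f c) \<le> K"
    by (auto simp: bounded_iff)
  then show ?thesis
    by (intro exI [of _ "max K 0"]) force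
qed

lemma sup_norm_upper:
  assumes "compact_space X" "continuous_map X euclidean f" "c \<in> topspace X"
  shows "cmod (f c) \<le> sup_norm X f"
proof -
  obtain K where "K \<ge> 0" "\<forall>c\<in>topspace X. cmod (f c) \<le> K"
    using compact_space_norm_bounded assms by blast
  then have "bdd_above (insert 0 ((\<lambda>c. cmod (f c)) ` topspace X))"
    by (auto intro!: bdd_aboveI [of _ K])
  then show ?thesis
    unfolding sup_norm_def using assms(3) by (intro cSup_upper) auto
qed

lemma sup_norm_nonneg:
  assumes "compact_space X" "continuous_map X euclidean f"
  shows "0 \<le> sup_norm X f"
proof -
  obtain K where "K \<ge> 0" "\<forall>c\<in>topspace X. cmod (f c) \<le> K"
    using compact_space_norm_bounded assms by blast
  then have "bdd_above (insert 0 ((\<lambda>c. cmod (f c)) ` topspace X))"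
    by (auto intro!: bdd_aboveI [of _ K])
  then show ?thesis
    unfolding sup_norm_def by (intro cSup_upper) auto
qed

text \<open>The bound has to be nonnegative because of the inserted \<open>0\<close>: over an empty
  space the pointwise estimate is vacuous while the norm is \<open>0\<close>.\<close>

lemma sup_norm_least:
  assumes "0 \<le> K" "\<And>c. c \<in> topspace X \<Longrightarrow> cmod (f c) \<le> K"
  shows "sup_norm X f \<le> K"
  unfolding sup_norm_def using assms by (intro cSup_least) auto

text \<open>The discriminant argument behind the Cauchy-Schwarz inequality.\<close>

lemma quadratic_nonneg_imp_le:
  fixes a b m :: real
  assumes "\<And>s. 0 \<le> a - 2 * s * m + s\<^sup>2 * m * b" "0 \<le> a" "0 \<le> b" "0 \<le> m"
  shows "m \<le> a * b"
proof (cases "b = 0")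
  case True
  show ?thesis
  proof (rule ccontr)
    assume "\<not> m \<le> a * b"
    then have "m > 0" using True by simp
    \<comment> \<open>With \<open>b = 0\<close> the quadratic is linear in s, and this s gives it
      the value -1.\<close>
    then show False
      using assms(1)[of "(a + 1) / (2 * m)"] True assms(2) by simp
  qed
next
  case False
  then have "b > 0" using assms(3) by simp
  \<comment> \<open>For positive b the quadratic attains its minimum at s = 1/b.\<close>
  have "0 \<le> a - 2 * (1/b) * m + (1/b)\<^sup>2 * m * b" by (rule assms(1))
  also have "\<dots> = a - m / b" using \<open>b > 0\<close> by (simp add: power2_eq_square)
  finally show ?thesis using \<open>b > 0\<close> by (simp add: field_simps)
qed

section \<open>Seminorms at a point and the Cauchy-Schwarz inequality\<close>

locale pre_ip =
  fixes B :: "'a topology" and M :: "('a \<Rightarrow> complex, 'm) ip_module" (structure)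
  assumes cpt: "compact_space B" and pre: "pre_inner_product_module B M"
begin

sublocale Module.module "cont_fun_ring B" M
  using pre by (simp add: pre_inner_product_module_def)

abbreviation nrm :: "'m \<Rightarrow> real" where "nrm \<equiv> mod_norm B M"

abbreviation Fun :: "('a \<Rightarrow> complex) set" where "Fun \<equiv> carrier (cont_fun_ring B)"

definition pnorm :: "'a \<Rightarrow> 'm \<Rightarrow> real" where
  "pnorm c x = sqrt (cmod (ip M x x c))"

lemma ip_in: "\<lbrakk>x \<in> carrier M; y \<in> carrier M\<rbrakk> \<Longrightarrow> ip M x y \<in> Fun"
  using pre unfolding pre_inner_product_module_def by blast

lemma ip_cont: "\<lbrakk>x \<in> carrier M; y \<in> carrier M\<rbrakk> \<Longrightarrow> continuous_map B euclidean (ip M x y)"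
  using ip_in mem_cont_fun_ring by blast

context
  fixes c assumes c: "c \<in> topspace B"
begin

lemma ip_add_right:
  assumes "x \<in> carrier M" "y \<in> carrier M" "z \<in> carrier M"
  shows "ip M x (y \<oplus> z) c = ip M x y c + ip M x z c"
proof -
  have "ip M x (y \<oplus> z) = ip M x y \<oplus>\<^bsub>cont_fun_ring B\<^esub> ip M x z"
    using pre assms unfolding pre_inner_product_module_def by blast
  then show ?thesis by (simp only: cont_fun_ring_simps restrict_apply' c)
qed

lemma ip_smult_right:
  assumes "x \<in> carrier M" "y \<in> carrier M" "f \<in> Fun"
  shows "ip M x (f \<odot> y) c = ip M x y c * f c"
proof -
  have "ip M x (f \<odot> y) = ip M x y \<otimes>\<^bsub>cont_fun_ring B\<^esub> f"
    using pre assms unfolding pre_inner_product_module_def by blast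
  then show ?thesis by (simp only: cont_fun_ring_simps restrict_apply' c)
qed

lemma ip_commute: "\<lbrakk>x \<in> carrier M; y \<in> carrier M\<rbrakk> \<Longrightarrow> ip M y x c = cnj (ip M x y c)"
  using pre c unfolding pre_inner_product_module_def by blast

lemma ip_self: "x \<in> carrier M \<Longrightarrow> ip M x x c = complex_of_real ((pnorm c x)\<^sup>2)"
proof -
  assume "x \<in> carrier M"
  then have "ip M x x c \<in> \<real>\<^sub>\<ge>\<^sub>0"
    using pre c unfolding pre_inner_product_module_def by blast
  then show ?thesis
    unfolding pnorm_def by (auto elim!: nonneg_Reals_cases)
qed

lemma ip_add_left:
  assumes "x \<in> carrier M" "y \<in> carrier M" "z \<in> carrier M"
  shows "ip M (x \<oplus> y) z c = ip M x z c + ip M y z c"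
  using ip_commute[of z "x \<oplus> y"] ip_commute[of z x] ip_commute[of z y]
  by (simp add: ip_add_right assms)

lemma ip_smult_left:
  "\<lbrakk>x \<in> carrier M; y \<in> carrier M; f \<in> Fun\<rbrakk> \<Longrightarrow> ip M (f \<odot> x) y c = cnj (f c) * ip M x y c"
  using ip_commute[of y "f \<odot> x"] ip_commute[of y x] smult_closed[of f x]
  by (simp add: ip_smult_right)

lemma ip_zero_right: "x \<in> carrier M \<Longrightarrow> ip M x \<zero> c = 0"
  using ip_add_right[of x \<zero> \<zero>] by simp

lemma ip_zero_left: "x \<in> carrier M \<Longrightarrow> ip M \<zero> x c = 0"
  using ip_add_left[of \<zero> \<zero> x] by simp

lemma ip_inv_right: "\<lbrakk>x \<in> carrier M; y \<in> carrier M\<rbrakk> \<Longrightarrow> ip M x (\<ominus> y) c = - ip M x y c"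
  using ip_add_right[of x y "\<ominus> y"] ip_zero_right[of x] by (simp add: r_neg add_eq_0_iff)

lemma ip_inv_left: "\<lbrakk>x \<in> carrier M; y \<in> carrier M\<rbrakk> \<Longrightarrow> ip M (\<ominus> x) y c = - ip M x y c"
  using ip_add_left[of x "\<ominus> x" y] ip_zero_left[of y] by (simp add: r_neg add_eq_0_iff)

lemma ip_minus_right:
  "\<lbrakk>x \<in> carrier M; y \<in> carrier M; z \<in> carrier M\<rbrakk> \<Longrightarrow> ip M x (y \<ominus> z) c = ip M x y c - ip M x z c"
  by (simp add: a_minus_def ip_add_right ip_inv_right)

lemma ip_minus_left:
  "\<lbrakk>x \<in> carrier M; y \<in> carrier M; z \<in> carrier M\<rbrakk> \<Longrightarrow> ip M (x \<ominus> y) z c = ip M x z c - ip M y z c"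
  by (simp add: a_minus_def ip_add_left ip_inv_left)

lemma pnorm_nonneg: "0 \<le> pnorm c x"
  by (simp add: pnorm_def)

lemma cauchy_schwarz:
  assumes x: "x \<in> carrier M" and y: "y \<in> carrier M"
  shows "cmod (ip M x y c) \<le> pnorm c x * pnorm c y"
proof -
  let ?z = "ip M x y c"
  have "(cmod ?z)\<^sup>2 \<le> (pnorm c x)\<^sup>2 * (pnorm c y)\<^sup>2"
  proof (rule quadratic_nonneg_imp_le)
    fix s :: real
    \<comment> \<open>With z the inner product of x and y at c, the factor conj z makes both cross
      terms equal to -s |z|^2, so a real parameter s suffices. Complex scalars act as constant
      functions, hence \<open>f\<close>.\<close>
    define t where "t = - complex_of_real s * cnj ?z"
    define f where "f = (\<lambda>c\<in>topspace B. t)"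
    have f: "f \<in> Fun" by (simp add: f_def mem_cont_fun_ring)
    have fy: "f \<odot> y \<in> carrier M" using f y by blast
    have fc: "f c = t" using c by (simp add: f_def)
    define u where "u = x \<oplus> f \<odot> y"
    have u: "u \<in> carrier M" using x fy by (simp add: u_def)
    have "ip M u u c = ip M x x c + ?z * t + cnj t * cnj ?z + cnj t * t * ip M y y c"
      using x y f fy fc ip_commute[OF x y]
      by (simp add: u_def ip_add_left ip_add_right ip_smult_left ip_smult_right algebra_simps)
    also have "\<dots> = complex_of_real ((pnorm c x)\<^sup>2 - 2 * s * (cmod ?z)\<^sup>2 + s\<^sup>2 * (cmod ?z)\<^sup>2 * (pnorm c y)\<^sup>2)"
    proof -
      have zz: "?z * cnj ?z = complex_of_real ((cmod ?z)\<^sup>2)"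
        by (rule complex_norm_square[symmetric])
      have "?z * t + cnj t * cnj ?z = - 2 * complex_of_real s * (?z * cnj ?z)"
        by (simp add: t_def algebra_simps)
      then have "?z * t + cnj t * cnj ?z = complex_of_real (- 2 * s * (cmod ?z)\<^sup>2)"
        unfolding zz by simp
      moreover have "cnj t * t = (complex_of_real s)\<^sup>2 * (?z * cnj ?z)"
        by (simp add: t_def power2_eq_square algebra_simps)
      then have "cnj t * t = complex_of_real (s\<^sup>2 * (cmod ?z)\<^sup>2)"
        unfolding zz by simp
      ultimately show ?thesis
        by (simp add: ip_self x y add.assoc)
    qed
    finally have "(pnorm c u)\<^sup>2 = (pnorm c x)\<^sup>2 - 2 * s * (cmod ?z)\<^sup>2 + s\<^sup>2 * (cmod ?z)\<^sup>2 * (pnorm c y)\<^sup>2"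
      unfolding ip_self[OF u] of_real_eq_iff .
    then show "0 \<le> (pnorm c x)\<^sup>2 - 2 * s * (cmod ?z)\<^sup>2 + s\<^sup>2 * (cmod ?z)\<^sup>2 * (pnorm c y)\<^sup>2"
      by (metis zero_le_power2)
  qed auto
  then have "(cmod ?z)\<^sup>2 \<le> (pnorm c x * pnorm c y)\<^sup>2"
    by (simp add: power_mult_distrib)
  then show ?thesis
    by (rule power2_le_imp_le) (intro mult_nonneg_nonneg pnorm_nonneg)
qed

lemma pnorm_add_le:
  assumes x: "x \<in> carrier M" and y: "y \<in> carrier M"
  shows "pnorm c (x \<oplus> y) \<le> pnorm c x + pnorm c y"
proof -
  have "complex_of_real ((pnorm c (x \<oplus> y))\<^sup>2) = ip M x x c + ip M x y c + ip M y x c + ip M y y c"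
    using x y ip_self[of "x \<oplus> y"] by (simp add: ip_add_left ip_add_right add_ac)
  then have "(pnorm c (x \<oplus> y))\<^sup>2 = cmod (ip M x x c + ip M x y c + ip M y x c + ip M y y c)"
    by (metis abs_of_nonneg norm_of_real zero_le_power2)
  also have "\<dots> \<le> cmod (ip M x x c) + cmod (ip M x y c) + cmod (ip M y x c) + cmod (ip M y y c)"
    by (meson add_mono norm_triangle_ineq order_refl order_trans)
  also have "\<dots> \<le> (pnorm c x)\<^sup>2 + pnorm c x * pnorm c y + pnorm c y * pnorm c x + (pnorm c y)\<^sup>2"
    using cauchy_schwarz x y by (intro add_mono) (auto simp: power2_eq_square)
  also have "\<dots> = (pnorm c x + pnorm c y)\<^sup>2"
    by (simp add: power2_eq_square algebra_simps)
  finally show ?thesis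
    by (rule power2_le_imp_le) (simp add: pnorm_nonneg)
qed

lemma pnorm_smult: "\<lbrakk>x \<in> carrier M; f \<in> Fun\<rbrakk> \<Longrightarrow> pnorm c (f \<odot> x) = cmod (f c) * pnorm c x"
  by (simp add: pnorm_def ip_smult_left ip_smult_right norm_mult real_sqrt_mult)

lemma pnorm_inv: "x \<in> carrier M \<Longrightarrow> pnorm c (\<ominus> x) = pnorm c x"
  by (simp add: pnorm_def ip_inv_left ip_inv_right)

lemma pnorm_zero: "pnorm c \<zero> = 0"
  by (simp add: pnorm_def ip_zero_left)

end

section \<open>The module norm as supremum of the seminorms\<close>

lemma nrm_nonneg: "x \<in> carrier M \<Longrightarrow> 0 \<le> nrm x"
  by (simp add: mod_norm_def sup_norm_nonneg cpt ip_cont)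

lemma pnorm_le_nrm: "\<lbrakk>x \<in> carrier M; c \<in> topspace B\<rbrakk> \<Longrightarrow> pnorm c x \<le> nrm x"
  by (simp add: mod_norm_def pnorm_def sup_norm_upper cpt ip_cont)

lemma nrm_least: "\<lbrakk>0 \<le> K; \<And>c. c \<in> topspace B \<Longrightarrow> pnorm c x \<le> K\<rbrakk> \<Longrightarrow> nrm x \<le> K"
  unfolding mod_norm_def
  by (rule real_le_lsqrt, simp)
    (auto simp: pnorm_def real_sqrt_le_iff sqrt_le_D intro!: sup_norm_least)

lemma nrm_mono:
  assumes "y \<in> carrier M" "\<And>c. c \<in> topspace B \<Longrightarrow> pnorm c x \<le> pnorm c y"
  shows "nrm x \<le> nrm y"
  using assms by (meson nrm_least nrm_nonneg order_trans pnorm_le_nrm)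

lemma nrm_zero [simp]: "nrm \<zero> = 0"
  using nrm_least[of 0 \<zero>] nrm_nonneg[of \<zero>] by (simp add: pnorm_zero)

lemma nrm_inv: "x \<in> carrier M \<Longrightarrow> nrm (\<ominus> x) = nrm x"
  by (intro antisym nrm_mono) (auto simp: pnorm_inv)

lemma nrm_add_le:
  assumes "x \<in> carrier M" "y \<in> carrier M"
  shows "nrm (x \<oplus> y) \<le> nrm x + nrm y"
  using assms
  by (intro nrm_least) (auto intro: add_nonneg_nonneg nrm_nonneg order_trans[OF pnorm_add_le] add_mono pnorm_le_nrm)

lemma nrm_smult_le:
  assumes "x \<in> carrier M" "f \<in> Fun" "0 \<le> K" "\<And>c. c \<in> topspace B \<Longrightarrow> cmod (f c) \<le> K"
  shows "nrm (f \<odot> x) \<le> K * nrm x"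
  using assms
  by (intro nrm_least) (auto simp: pnorm_smult intro!: nrm_nonneg mult_mono pnorm_le_nrm pnorm_nonneg mult_nonneg_nonneg)

lemma minus_add_minus:
  "\<lbrakk>x \<in> carrier M; y \<in> carrier M; z \<in> carrier M\<rbrakk> \<Longrightarrow> (x \<ominus> y) \<oplus> (y \<ominus> z) = x \<ominus> z"
  by (simp add: a_minus_def a_assoc r_neg1)

lemma nrm_triangle:
  "\<lbrakk>x \<in> carrier M; y \<in> carrier M; z \<in> carrier M\<rbrakk> \<Longrightarrow> nrm (x \<ominus> z) \<le> nrm (x \<ominus> y) + nrm (y \<ominus> z)"
  using nrm_add_le[of "x \<ominus> y" "y \<ominus> z"] by (simp add: minus_add_minus)

lemma minus_swap: "\<lbrakk>x \<in> carrier M; y \<in> carrier M\<rbrakk> \<Longrightarrow> \<ominus> (x \<ominus> y) = y \<ominus> x"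
  by (simp add: a_minus_def minus_add a_comm)

lemma nrm_minus_commute: "\<lbrakk>x \<in> carrier M; y \<in> carrier M\<rbrakk> \<Longrightarrow> nrm (x \<ominus> y) = nrm (y \<ominus> x)"
  using nrm_inv[of "x \<ominus> y"] by (simp add: minus_swap)

lemma minus_self [simp]: "x \<in> carrier M \<Longrightarrow> x \<ominus> x = \<zero>"
  by (simp add: a_minus_def r_neg)

lemma minus_zero_right [simp]: "x \<in> carrier M \<Longrightarrow> x \<ominus> \<zero> = x"
  by (simp add: a_minus_def)

lemma add_minus_add:
  "\<lbrakk>x \<in> carrier M; y \<in> carrier M; x' \<in> carrier M; y' \<in> carrier M\<rbrakk>
    \<Longrightarrow> (x \<oplus> y) \<ominus> (x' \<oplus> y') = (x \<ominus> x') \<oplus> (y \<ominus> y')"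
  by (simp add: a_minus_def minus_add a_ac)

lemma smult_minus:
  "\<lbrakk>f \<in> Fun; x \<in> carrier M; y \<in> carrier M\<rbrakk> \<Longrightarrow> f \<odot> (x \<ominus> y) = f \<odot> x \<ominus> f \<odot> y"
  by (simp add: a_minus_def smult_r_distr smult_r_minus)

lemma nrm_le_minus:
  "\<lbrakk>x \<in> carrier M; y \<in> carrier M\<rbrakk> \<Longrightarrow> nrm x \<le> nrm y + nrm (x \<ominus> y)"
  using nrm_triangle[of x y \<zero>] by simp

end

section \<open>Completions\<close>

text \<open>The usual three-term estimate. An approximant for each e, rather than a sequence, fits
  both uses: inner products of two members of Cauchy sequences, and fibre sums on a level that
  depends on e.\<close>

lemma continuous_map_uniform_approx:
  fixes f :: "'a \<Rightarrow> complex"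
  assumes "\<And>e. e > 0 \<Longrightarrow> \<exists>g. continuous_map X euclidean g \<and> (\<forall>c\<in>topspace X. cmod (f c - g c) \<le> e)"
  shows "continuous_map X euclidean f"
proof -
  have "(f \<longlongrightarrow> f x) (atin X x)" if x: "x \<in> topspace X" for x
  proof (rule tendstoI)
    fix e :: real assume "e > 0"
    then obtain g where g: "continuous_map X euclidean g" "\<And>c. c \<in> topspace X \<Longrightarrow> cmod (f c - g c) \<le> e/4"
      using assms[of "e/4"] by auto
    have "(g \<longlongrightarrow> g x) (atin X x)"
      using g(1) x by (simp add: continuous_map_atin)
    then have "eventually (\<lambda>y. dist (g y) (g x) < e/4) (atin X x)"
      by (rule tendstoD) (use \<open>e > 0\<close> in simp)
    moreover have "eventually (\<lambda>y. y \<in> topspace X) (atin X x)"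
      by (auto simp: eventually_atin)
    ultimately show "eventually (\<lambda>y. dist (f y) (f x) < e) (atin X x)"
    proof eventually_elim
      case (elim y)
      have "dist (f y) (f x) \<le> dist (f y) (g y) + dist (g y) (g x) + dist (g x) (f x)"
        by (meson add_right_mono dist_triangle order_trans)
      moreover have "dist (f y) (g y) \<le> e/4" "dist (g x) (f x) \<le> e/4"
        using g(2)[OF elim(2)] g(2)[OF x] by (simp_all add: dist_norm norm_minus_commute)
      ultimately show ?case using elim(1) \<open>e > 0\<close> by linarith
    qed
  qed
  then show ?thesis by (simp add: continuous_map_atin)
qed

lemma tendsto_zero_le:
  fixes f g :: "nat \<Rightarrow> real"
  assumes "g \<longlonglongrightarrow> 0" "\<And>n. 0 \<le> f n" "\<And>n. f n \<le> g n"
  shows "f \<longlonglongrightarrow> 0"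
  by (rule tendsto_sandwich[OF _ _ tendsto_const assms(1)]) (use assms in auto)

section \<open>Cauchy sequences modulo null sequences\<close>

context pre_ip
begin

abbreviation CS :: "(nat \<Rightarrow> 'm) set" where "CS \<equiv> cauchy_seqs B M"

abbreviation cls :: "(nat \<Rightarrow> 'm) \<Rightarrow> (nat \<Rightarrow> 'm) set" where "cls \<equiv> compl_class B M"

definition eqv :: "(nat \<Rightarrow> 'm) \<Rightarrow> (nat \<Rightarrow> 'm) \<Rightarrow> bool" where
  "eqv s t \<longleftrightarrow> (\<lambda>n. nrm (s n \<ominus> t n)) \<longlonglongrightarrow> 0"

text \<open>The inner product of the completion, but on sequences instead of classes, so that
  independence of the representatives becomes a statement about \<open>eqv\<close>.\<close>

definition ip_lim :: "(nat \<Rightarrow> 'm) \<Rightarrow> (nat \<Rightarrow> 'm) \<Rightarrow> 'a \<Rightarrow> complex" where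
  "ip_lim s t c = lim (\<lambda>n. ip M (s n) (t n) c)"

lemma CS_closed: "s \<in> CS \<Longrightarrow> s n \<in> carrier M"
  by (simp add: cauchy_seqs_def)

lemma CS_D: "\<lbrakk>s \<in> CS; e > 0\<rbrakk> \<Longrightarrow> \<exists>N. \<forall>m\<ge>N. \<forall>n\<ge>N. nrm (s m \<ominus> s n) < e"
  by (simp add: cauchy_seqs_def)

lemma CS_I:
  "\<lbrakk>\<And>n. s n \<in> carrier M; \<And>e. e > 0 \<Longrightarrow> \<exists>N. \<forall>m\<ge>N. \<forall>n\<ge>N. nrm (s m \<ominus> s n) < e\<rbrakk> \<Longrightarrow> s \<in> CS"
  by (simp add: cauchy_seqs_def)

lemma eqv_refl: "(\<And>n. s n \<in> carrier M) \<Longrightarrow> eqv s s"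
  by (simp add: eqv_def)

lemma eqv_sym: "\<lbrakk>\<And>n. s n \<in> carrier M; \<And>n. t n \<in> carrier M; eqv s t\<rbrakk> \<Longrightarrow> eqv t s"
  by (simp add: eqv_def nrm_minus_commute)

lemma eqv_trans:
  assumes "\<And>n. s n \<in> carrier M" "\<And>n. t n \<in> carrier M" "\<And>n. u n \<in> carrier M" "eqv s t" "eqv t u"
  shows "eqv s u"
proof -
  have "(\<lambda>n. nrm (s n \<ominus> t n) + nrm (t n \<ominus> u n)) \<longlonglongrightarrow> 0 + 0"
    using assms unfolding eqv_def by (intro tendsto_add)
  then show ?thesis
    unfolding eqv_def using assms
    by (auto intro!: tendsto_zero_le[where f = "\<lambda>n. nrm (s n \<ominus> u n)"] nrm_nonneg nrm_triangle)
qed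

lemma mem_cls: "t \<in> cls s \<longleftrightarrow> t \<in> CS \<and> eqv s t"
  by (simp add: compl_class_def eqv_def)

lemma cls_eq_iff:
  assumes "s \<in> CS" "t \<in> CS"
  shows "cls s = cls t \<longleftrightarrow> eqv s t"
proof
  assume "cls s = cls t"
  then show "eqv s t"
    using assms eqv_refl[of t] CS_closed mem_cls by blast
next
  assume st: "eqv s t"
  have "eqv s u \<longleftrightarrow> eqv t u" if "u \<in> CS" for u
    using st assms that by (meson CS_closed eqv_sym eqv_trans)
  then show "cls s = cls t"
    by (auto simp: mem_cls)
qed

text \<open>All that is ever known about the chosen representative: it is some Cauchy sequence
  equivalent to the given one. Every operation of the completion is evaluated through these
  facts.\<close>

lemma rep_cls:
  assumes "s \<in> CS"
  shows "compl_rep (cls s) \<in> CS" "eqv (compl_rep (cls s)) s" "cls (compl_rep (cls s)) = cls s"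
proof -
  have "s \<in> cls s"
    using assms by (simp add: mem_cls eqv_refl CS_closed)
  then have *: "compl_rep (cls s) \<in> cls s"
    unfolding compl_rep_def by (rule someI[of "\<lambda>t. t \<in> cls s"])
  then show 1: "compl_rep (cls s) \<in> CS" "eqv (compl_rep (cls s)) s"
    using assms by (auto simp: mem_cls intro: eqv_sym CS_closed)
  with assms show "cls (compl_rep (cls s)) = cls s"
    by (simp add: cls_eq_iff)
qed

text \<open>By the triangle inequality in both directions the norms form a real Cauchy sequence. The
  bound is what makes the inner product, a product of two varying factors, uniformly continuous
  along Cauchy sequences.\<close>

lemma CS_bounded:
  assumes "s \<in> CS"
  obtains K where "0 \<le> K" "\<And>n. nrm (s n) \<le> K"
proof -
  have "Cauchy (\<lambda>n. nrm (s n))"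
  proof (rule CauchyI)
    fix e :: real assume "0 < e"
    then obtain N where N: "\<And>m n. \<lbrakk>m \<ge> N; n \<ge> N\<rbrakk> \<Longrightarrow> nrm (s m \<ominus> s n) < e"
      using CS_D[OF assms] by blast
    have "\<bar>nrm (s m) - nrm (s n)\<bar> < e" if "m \<ge> N" "n \<ge> N" for m n
      using nrm_le_minus[of "s m" "s n"] nrm_le_minus[of "s n" "s m"] N that CS_closed[OF assms]
      by (smt (verit))
    then show "\<exists>M. \<forall>m\<ge>M. \<forall>n\<ge>M. norm (nrm (s m) - nrm (s n)) < e"
      by auto
  qed
  then have "Bseq (\<lambda>n. nrm (s n))" by (rule Cauchy_Bseq)
  then obtain K where "0 < K" "\<forall>n. norm (nrm (s n)) \<le> K" by (rule BseqE)
  then show thesis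
    by (intro that[of K]) (auto simp: abs_le_iff)
qed

lemma CS_const: "x \<in> carrier M \<Longrightarrow> (\<lambda>n. x) \<in> CS"
  by (rule CS_I) auto

lemma CS_add:
  assumes s: "s \<in> CS" and t: "t \<in> CS"
  shows "(\<lambda>n. s n \<oplus> t n) \<in> CS"
proof (rule CS_I)
  note cl = CS_closed[OF s] CS_closed[OF t]
  show "s n \<oplus> t n \<in> carrier M" for n using cl by simp
  fix e :: real assume "e > 0"
  then have e: "e/2 > 0" by simp
  obtain N1 where N1: "\<And>m n. \<lbrakk>m \<ge> N1; n \<ge> N1\<rbrakk> \<Longrightarrow> nrm (s m \<ominus> s n) < e/2"
    using CS_D[OF s e] by blast
  obtain N2 where N2: "\<And>m n. \<lbrakk>m \<ge> N2; n \<ge> N2\<rbrakk> \<Longrightarrow> nrm (t m \<ominus> t n) < e/2"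
    using CS_D[OF t e] by blast
  have "nrm ((s m \<oplus> t m) \<ominus> (s n \<oplus> t n)) < e" if "m \<ge> max N1 N2" "n \<ge> max N1 N2" for m n
    using nrm_add_le[of "s m \<ominus> s n" "t m \<ominus> t n"] N1[of m n] N2[of m n] that cl
    by (simp add: add_minus_add)
  then show "\<exists>N. \<forall>m\<ge>N. \<forall>n\<ge>N. nrm ((s m \<oplus> t m) \<ominus> (s n \<oplus> t n)) < e"
    by blast
qed

text \<open>The bound is strictly positive so that tolerances of the form \<open>e/K\<close> can be
  formed.\<close>

lemma Fun_bounded: "f \<in> Fun \<Longrightarrow> \<exists>K>0. \<forall>c\<in>topspace B. cmod (f c) \<le> K"
  using compact_space_norm_bounded[OF cpt, of f]
  by (metis mem_cont_fun_ring add_pos_nonneg zero_less_one le_add_same_cancel2 order_trans zero_le_one)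

lemma CS_smult:
  assumes s: "s \<in> CS" and f: "f \<in> Fun"
  shows "(\<lambda>n. f \<odot> s n) \<in> CS"
proof (rule CS_I)
  note cl = CS_closed[OF s]
  show "f \<odot> s n \<in> carrier M" for n using cl f by simp
  obtain K where K: "K > 0" "\<And>c. c \<in> topspace B \<Longrightarrow> cmod (f c) \<le> K"
    using Fun_bounded[OF f] by blast
  fix e :: real assume "e > 0"
  then have "e/K > 0" using K by simp
  then obtain N where N: "\<And>m n. \<lbrakk>m \<ge> N; n \<ge> N\<rbrakk> \<Longrightarrow> nrm (s m \<ominus> s n) < e/K"
    using CS_D[OF s] by blast
  have "nrm (f \<odot> s m \<ominus> f \<odot> s n) < e" if "m \<ge> N" "n \<ge> N" for m n
  proof -
    have "nrm (f \<odot> (s m \<ominus> s n)) \<le> K * nrm (s m \<ominus> s n)"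
      using K f cl by (intro nrm_smult_le) auto
    also have "\<dots> < e"
      using N[OF that] K by (simp add: field_simps)
    finally show ?thesis
      using f cl by (simp add: smult_minus)
  qed
  then show "\<exists>N. \<forall>m\<ge>N. \<forall>n\<ge>N. nrm (f \<odot> s m \<ominus> f \<odot> s n) < e"
    by blast
qed

lemma eqv_add:
  assumes "s \<in> CS" "t \<in> CS" "s' \<in> CS" "t' \<in> CS" "eqv s s'" "eqv t t'"
  shows "eqv (\<lambda>n. s n \<oplus> t n) (\<lambda>n. s' n \<oplus> t' n)"
proof -
  have "(\<lambda>n. nrm (s n \<ominus> s' n) + nrm (t n \<ominus> t' n)) \<longlonglongrightarrow> 0 + 0"
    using assms unfolding eqv_def by (intro tendsto_add)
  then have lim: "(\<lambda>n. nrm (s n \<ominus> s' n) + nrm (t n \<ominus> t' n)) \<longlonglongrightarrow> 0"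
    by simp
  have "nrm ((s n \<oplus> t n) \<ominus> (s' n \<oplus> t' n)) \<le> nrm (s n \<ominus> s' n) + nrm (t n \<ominus> t' n)" for n
    using assms CS_closed by (simp add: add_minus_add nrm_add_le)
  then show ?thesis
    unfolding eqv_def using assms CS_closed
    by (intro tendsto_zero_le[OF lim]) (auto intro: nrm_nonneg)
qed

lemma eqv_smult:
  assumes "s \<in> CS" "s' \<in> CS" "eqv s s'" and f: "f \<in> Fun"
  shows "eqv (\<lambda>n. f \<odot> s n) (\<lambda>n. f \<odot> s' n)"
proof -
  obtain K where K: "K > 0" "\<And>c. c \<in> topspace B \<Longrightarrow> cmod (f c) \<le> K"
    using Fun_bounded[OF f] by blast
  have "(\<lambda>n. K * nrm (s n \<ominus> s' n)) \<longlonglongrightarrow> K * 0"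
    using assms unfolding eqv_def by (intro tendsto_mult tendsto_const)
  moreover have "nrm (f \<odot> s n \<ominus> f \<odot> s' n) \<le> K * nrm (s n \<ominus> s' n)" for n
    using nrm_smult_le[of "s n \<ominus> s' n" f K] K f assms CS_closed by (simp add: smult_minus)
  ultimately show ?thesis
    unfolding eqv_def using assms CS_closed f
    by (auto intro!: tendsto_zero_le[where f = "\<lambda>n. nrm (f \<odot> s n \<ominus> f \<odot> s' n)"] nrm_nonneg)
qed

text \<open>Change one argument at a time and apply Cauchy-Schwarz. The right-hand side is free of
  c, which is the source of all uniformity in the completion.\<close>

lemma ip_diff_le:
  assumes "x \<in> carrier M" "y \<in> carrier M" "x' \<in> carrier M" "y' \<in> carrier M" and c: "c \<in> topspace B"
  shows "cmod (ip M x y c - ip M x' y' c) \<le> nrm (x \<ominus> x') * nrm y + nrm x' * nrm (y \<ominus> y')"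
proof -
  have "ip M x y c - ip M x' y' c = ip M (x \<ominus> x') y c + ip M x' (y \<ominus> y') c"
    using assms by (simp add: ip_minus_left ip_minus_right)
  also have "cmod \<dots> \<le> cmod (ip M (x \<ominus> x') y c) + cmod (ip M x' (y \<ominus> y') c)"
    by (rule norm_triangle_ineq)
  also have "\<dots> \<le> pnorm c (x \<ominus> x') * pnorm c y + pnorm c x' * pnorm c (y \<ominus> y')"
    using assms by (intro add_mono cauchy_schwarz) auto
  also have "\<dots> \<le> nrm (x \<ominus> x') * nrm y + nrm x' * nrm (y \<ominus> y')"
    using assms by (intro add_mono mult_mono pnorm_le_nrm) (auto intro: pnorm_nonneg nrm_nonneg)
  finally show ?thesis .
qed

lemma ip_uniformly_Cauchy:
  assumes s: "s \<in> CS" and t: "t \<in> CS" and "e > 0"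
  obtains N where "\<And>m n c. \<lbrakk>m \<ge> N; n \<ge> N; c \<in> topspace B\<rbrakk> \<Longrightarrow> cmod (ip M (s m) (t m) c - ip M (s n) (t n) c) < e"
proof -
  note cl = CS_closed[OF s] CS_closed[OF t]
  obtain K1 where K1: "0 \<le> K1" "\<And>n. nrm (s n) \<le> K1" using CS_bounded[OF s] by blast
  obtain K2 where K2: "0 \<le> K2" "\<And>n. nrm (t n) \<le> K2" using CS_bounded[OF t] by blast
  \<comment> \<open>The error will be at most d * (K1 + K2); the extra 1 keeps the denominator
    positive and the final inequality strict.\<close>
  define d where "d = e / (K1 + K2 + 1)"
  have d: "d > 0" "d * (K1 + K2 + 1) = e" using K1 K2 \<open>e > 0\<close> by (auto simp: d_def)
  obtain N1 where N1: "\<And>m n. \<lbrakk>m \<ge> N1; n \<ge> N1\<rbrakk> \<Longrightarrow> nrm (s m \<ominus> s n) < d"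
    using CS_D[OF s d(1)] by blast
  obtain N2 where N2: "\<And>m n. \<lbrakk>m \<ge> N2; n \<ge> N2\<rbrakk> \<Longrightarrow> nrm (t m \<ominus> t n) < d"
    using CS_D[OF t d(1)] by blast
  show thesis
  proof (rule that[of "max N1 N2"])
    fix m n c assume mn: "m \<ge> max N1 N2" "n \<ge> max N1 N2" and c: "c \<in> topspace B"
    have "cmod (ip M (s m) (t m) c - ip M (s n) (t n) c)
        \<le> nrm (s m \<ominus> s n) * nrm (t m) + nrm (s n) * nrm (t m \<ominus> t n)"
      using cl c by (intro ip_diff_le) auto
    also have "\<dots> \<le> d * K2 + K1 * d"
      using N1[of m n] N2[of m n] mn K1 K2 d cl
      by (intro add_mono mult_mono) (auto intro: nrm_nonneg less_imp_le)
    also have "\<dots> < e" using d by (simp add: algebra_simps)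
    finally show "cmod (ip M (s m) (t m) c - ip M (s n) (t n) c) < e" .
  qed
qed

lemma ip_tendsto:
  assumes "s \<in> CS" "t \<in> CS" "c \<in> topspace B"
  shows "(\<lambda>n. ip M (s n) (t n) c) \<longlonglongrightarrow> ip_lim s t c"
proof -
  have "Cauchy (\<lambda>n. ip M (s n) (t n) c)"
    by (rule CauchyI) (metis assms ip_uniformly_Cauchy)
  then show ?thesis
    unfolding ip_lim_def by (simp add: Cauchy_convergent_iff convergent_LIMSEQ_iff)
qed

lemma ip_lim_eqI:
  "\<lbrakk>s \<in> CS; t \<in> CS; c \<in> topspace B; (\<lambda>n. ip M (s n) (t n) c) \<longlonglongrightarrow> l\<rbrakk> \<Longrightarrow> ip_lim s t c = l"
  using ip_tendsto LIMSEQ_unique by blast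

lemma ip_lim_cont:
  assumes "s \<in> CS" "t \<in> CS"
  shows "continuous_map B euclidean (ip_lim s t)"
proof (rule continuous_map_uniform_approx)
  fix e :: real assume "e > 0"
  then obtain N where N: "\<And>m n c. \<lbrakk>m \<ge> N; n \<ge> N; c \<in> topspace B\<rbrakk> \<Longrightarrow>
      cmod (ip M (s m) (t m) c - ip M (s n) (t n) c) < e"
    using ip_uniformly_Cauchy assms by blast
  \<comment> \<open>One index is frozen at \<open>N\<close> while the other tends to infinity, which
    turns the strict uniform estimate into a nonstrict one.\<close>
  have "cmod (ip_lim s t c - ip M (s N) (t N) c) \<le> e" if "c \<in> topspace B" for c
  proof (rule tendsto_upperbound)
    show "(\<lambda>n. cmod (ip M (s n) (t n) c - ip M (s N) (t N) c)) \<longlonglongrightarrow> cmod (ip_lim s t c - ip M (s N) (t N) c)"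
      using assms that by (intro tendsto_intros ip_tendsto)
    show "eventually (\<lambda>n. cmod (ip M (s n) (t n) c - ip M (s N) (t N) c) \<le> e) sequentially"
      using N that by (auto simp: eventually_sequentially intro!: exI[of _ N] less_imp_le)
  qed auto
  then show "\<exists>g. continuous_map B euclidean g \<and> (\<forall>c\<in>topspace B. cmod (ip_lim s t c - g c) \<le> e)"
    using ip_cont[OF CS_closed[OF assms(1)] CS_closed[OF assms(2)]] by blast
qed

lemma ip_lim_eqv:
  assumes "s \<in> CS" "t \<in> CS" "s' \<in> CS" "t' \<in> CS" "eqv s s'" "eqv t t'" and c: "c \<in> topspace B"
  shows "ip_lim s t c = ip_lim s' t' c"
proof -
  obtain K1 where K1: "0 \<le> K1" "\<And>n. nrm (s' n) \<le> K1" using CS_bounded assms by blast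
  obtain K2 where K2: "0 \<le> K2" "\<And>n. nrm (t n) \<le> K2" using CS_bounded assms by blast
  have "(\<lambda>n. nrm (s n \<ominus> s' n) * K2 + K1 * nrm (t n \<ominus> t' n)) \<longlonglongrightarrow> 0 * K2 + K1 * 0"
    using assms unfolding eqv_def by (intro tendsto_intros)
  then have lim: "(\<lambda>n. nrm (s n \<ominus> s' n) * K2 + K1 * nrm (t n \<ominus> t' n)) \<longlonglongrightarrow> 0"
    by simp
  have "(\<lambda>n. cmod (ip M (s n) (t n) c - ip M (s' n) (t' n) c)) \<longlonglongrightarrow> 0"
  proof (rule tendsto_zero_le[OF lim])
    fix n
    have "cmod (ip M (s n) (t n) c - ip M (s' n) (t' n) c)
        \<le> nrm (s n \<ominus> s' n) * nrm (t n) + nrm (s' n) * nrm (t n \<ominus> t' n)"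
      using assms CS_closed by (intro ip_diff_le) auto
    also have "\<dots> \<le> nrm (s n \<ominus> s' n) * K2 + K1 * nrm (t n \<ominus> t' n)"
      using K1 K2 assms CS_closed by (intro add_mono mult_mono) (auto intro: nrm_nonneg)
    finally show "cmod (ip M (s n) (t n) c - ip M (s' n) (t' n) c)
        \<le> nrm (s n \<ominus> s' n) * K2 + K1 * nrm (t n \<ominus> t' n)" .
  qed simp_all
  then have "(\<lambda>n. ip M (s n) (t n) c - ip M (s' n) (t' n) c) \<longlonglongrightarrow> 0"
    by (simp add: tendsto_norm_zero_iff)
  moreover have "(\<lambda>n. ip M (s n) (t n) c - ip M (s' n) (t' n) c) \<longlonglongrightarrow> ip_lim s t c - ip_lim s' t' c"
    using assms by (intro tendsto_diff ip_tendsto)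
  ultimately show ?thesis
    using LIMSEQ_unique by fastforce
qed

section \<open>The completion is a Hilbert module\<close>

abbreviation Mh :: "('a \<Rightarrow> complex, (nat \<Rightarrow> 'm) set) ip_module" where
  "Mh \<equiv> mod_completion B M"

lemma compl_carrier: "carrier Mh = cls ` CS"
  by (simp add: mod_completion_def)

lemma compl_zero: "\<zero>\<^bsub>Mh\<^esub> = cls (\<lambda>n. \<zero>)"
  by (simp add: mod_completion_def)

text \<open>Together with the rules for the action and the inner product this permits computing with
  any convenient representatives; \<open>compl_rep\<close> disappears from the arguments.\<close>

lemma compl_add:
  assumes "s \<in> CS" "t \<in> CS"
  shows "cls s \<oplus>\<^bsub>Mh\<^esub> cls t = cls (\<lambda>n. s n \<oplus> t n)"
  using assms by (simp add: mod_completion_def cls_eq_iff rep_cls CS_add eqv_add)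

lemma compl_smult:
  assumes "s \<in> CS" "f \<in> Fun"
  shows "f \<odot>\<^bsub>Mh\<^esub> cls s = cls (\<lambda>n. f \<odot> s n)"
  using assms by (simp add: mod_completion_def cls_eq_iff rep_cls CS_smult eqv_smult)

lemma compl_ip:
  assumes "s \<in> CS" "t \<in> CS"
  shows "ip Mh (cls s) (cls t) = (\<lambda>c\<in>topspace B. ip_lim s t c)"
proof -
  have "ip_lim (compl_rep (cls s)) (compl_rep (cls t)) c = ip_lim s t c" if "c \<in> topspace B" for c
    using assms that by (simp add: ip_lim_eqv rep_cls)
  then show ?thesis
    by (simp add: mod_completion_def ip_lim_def cong: restrict_cong)
qed

lemma CS_zero: "(\<lambda>n. \<zero>) \<in> CS"
  by (simp add: CS_const)

lemma CS_inv:
  assumes "s \<in> CS" shows "(\<lambda>n. \<ominus> s n) \<in> CS"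
proof (rule CS_I)
  note cl = CS_closed[OF assms]
  show "\<ominus> s n \<in> carrier M" for n using cl by simp
  have "nrm (\<ominus> s m \<ominus> \<ominus> s n) = nrm (s m \<ominus> s n)" for m n
    using nrm_inv[of "s m \<ominus> s n"] cl by (simp add: a_minus_def minus_add)
  then show "\<exists>N. \<forall>m\<ge>N. \<forall>n\<ge>N. nrm (\<ominus> s m \<ominus> \<ominus> s n) < e" if "e > 0" for e
    using CS_D[OF assms that] by simp
qed

lemma module_completion: "Module.module (cont_fun_ring B) Mh"
proof (rule moduleI)
  show "cring (cont_fun_ring B)" by (rule cring_cont_fun_ring)
  show "abelian_group Mh"
  proof (rule abelian_groupI)
    fix x assume "x \<in> carrier Mh"
    then obtain s where s: "s \<in> CS" "x = cls s" by (auto simp: compl_carrier)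
    then show "\<exists>y\<in>carrier Mh. y \<oplus>\<^bsub>Mh\<^esub> x = \<zero>\<^bsub>Mh\<^esub>"
      by (intro bexI[of _ "cls (\<lambda>n. \<ominus> s n)"])
        (auto simp: compl_add CS_inv compl_zero compl_carrier CS_closed l_neg)
  qed (auto simp: compl_carrier compl_zero compl_add CS_add CS_zero CS_closed a_ac)
qed (auto simp: compl_carrier compl_smult compl_add CS_add CS_smult CS_closed
      smult_l_distr smult_r_distr smult_assoc1)

lemma pre_inner_product_module_completion: "pre_inner_product_module B Mh"
  unfolding pre_inner_product_module_def
proof (intro conjI ballI)
  show "Module.module (cont_fun_ring B) Mh" by (rule module_completion)
  fix x assume "x \<in> carrier Mh"
  then obtain s where s: "s \<in> CS" "x = cls s" by (auto simp: compl_carrier)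
  show "ip Mh x x c \<in> \<real>\<^sub>\<ge>\<^sub>0" if c: "c \<in> topspace B" for c
  proof -
    have "(\<lambda>n. ip M (s n) (s n) c) \<longlonglongrightarrow> ip_lim s s c"
      using s c by (simp add: ip_tendsto)
    moreover have "ip M (s n) (s n) c \<in> \<real>\<^sub>\<ge>\<^sub>0" for n
      using s c by (simp add: ip_self CS_closed del: of_real_power)
    ultimately have "ip_lim s s c \<in> \<real>\<^sub>\<ge>\<^sub>0"
      by (meson closed_nonneg_Reals_complex closed_sequentially)
    then show ?thesis using s c by (simp add: compl_ip)
  qed
  fix y assume "y \<in> carrier Mh"
  then obtain t where t: "t \<in> CS" "y = cls t" by (auto simp: compl_carrier)
  show "ip Mh x y \<in> Fun"
    using s t by (simp add: compl_ip mem_cont_fun_ring ip_lim_cont)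
  show "ip Mh y x c = cnj (ip Mh x y c)" if c: "c \<in> topspace B" for c
  proof -
    have "(\<lambda>n. cnj (ip M (s n) (t n) c)) \<longlonglongrightarrow> cnj (ip_lim s t c)"
      using s t c by (intro tendsto_cnj ip_tendsto)
    then have "ip_lim t s c = cnj (ip_lim s t c)"
      using s t c by (intro ip_lim_eqI) (simp_all add: ip_commute[of c "s _" "t _"] CS_closed)
    then show ?thesis using s t c by (simp add: compl_ip)
  qed
  show "ip Mh x (f \<odot>\<^bsub>Mh\<^esub> y) = ip Mh x y \<otimes>\<^bsub>cont_fun_ring B\<^esub> f" if f: "f \<in> Fun" for f
  proof -
    have "ip_lim s (\<lambda>n. f \<odot> t n) c = ip_lim s t c * f c" if c: "c \<in> topspace B" for c
      using s t c f
      by (intro ip_lim_eqI) (simp_all add: CS_smult ip_smult_right CS_closed tendsto_mult ip_tendsto)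
    then show ?thesis
      using s t f by (simp add: compl_smult compl_ip CS_smult cont_fun_ring_simps cong: restrict_cong)
  qed
  fix z assume "z \<in> carrier Mh"
  then obtain u where u: "u \<in> CS" "z = cls u" by (auto simp: compl_carrier)
  have "ip_lim s (\<lambda>n. t n \<oplus> u n) c = ip_lim s t c + ip_lim s u c" if c: "c \<in> topspace B" for c
    using s t u c
    by (intro ip_lim_eqI) (simp_all add: CS_add ip_add_right CS_closed tendsto_add ip_tendsto)
  then show "ip Mh x (y \<oplus>\<^bsub>Mh\<^esub> z) = ip Mh x y \<oplus>\<^bsub>cont_fun_ring B\<^esub> ip Mh x z"
    using s t u by (simp add: compl_add compl_ip CS_add cont_fun_ring_simps cong: restrict_cong)
qed

lemma pre_ip_completion: "pre_ip B Mh"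
  by (simp add: pre_ip_def cpt pre_inner_product_module_completion)

lemma embed_in: "x \<in> carrier M \<Longrightarrow> compl_embed B M x \<in> carrier Mh"
  by (simp add: compl_embed_def compl_carrier CS_const)

lemma nrm_embed: "x \<in> carrier M \<Longrightarrow> mod_norm B Mh (compl_embed B M x) = nrm x"
proof -
  assume x: "x \<in> carrier M"
  have "ip Mh (compl_embed B M x) (compl_embed B M x) c = ip M x x c" if "c \<in> topspace B" for c
    using x that by (simp add: compl_embed_def compl_ip CS_const ip_lim_def)
  then show ?thesis
    by (simp add: mod_norm_def sup_norm_def)
qed

lemma compl_inv:
  assumes "s \<in> CS"
  shows "\<ominus>\<^bsub>Mh\<^esub> cls s = cls (\<lambda>n. \<ominus> s n)"
proof -
  interpret h: pre_ip B Mh by (rule pre_ip_completion)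
  show ?thesis
    using assms
    by (intro h.minus_equality) (auto simp: compl_add CS_inv compl_zero compl_carrier CS_closed l_neg)
qed

lemma compl_minus:
  assumes "s \<in> CS" "t \<in> CS"
  shows "cls s \<ominus>\<^bsub>Mh\<^esub> cls t = cls (\<lambda>n. s n \<ominus> t n)"
  using assms by (simp add: a_minus_def compl_inv compl_add CS_inv)

lemma CS_minus: "\<lbrakk>s \<in> CS; t \<in> CS\<rbrakk> \<Longrightarrow> (\<lambda>n. s n \<ominus> t n) \<in> CS"
  using CS_add[OF _ CS_inv] by (simp add: a_minus_def)

lemma embed_minus:
  "\<lbrakk>x \<in> carrier M; y \<in> carrier M\<rbrakk> \<Longrightarrow>
    compl_embed B M x \<ominus>\<^bsub>Mh\<^esub> compl_embed B M y = compl_embed B M (x \<ominus> y)"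
  by (simp add: compl_embed_def compl_minus CS_const)

text \<open>At each c the seminorm of a class is the limit of the seminorms of the terms, so a bound
  on a tail is enough.\<close>

lemma nrm_cls_le:
  assumes s: "s \<in> CS" and "0 \<le> K" and K: "\<And>n. n \<ge> N \<Longrightarrow> nrm (s n) \<le> K"
  shows "mod_norm B Mh (cls s) \<le> K"
proof -
  interpret h: pre_ip B Mh by (rule pre_ip_completion)
  show ?thesis
  proof (rule h.nrm_least[OF \<open>0 \<le> K\<close>])
    fix c assume c: "c \<in> topspace B"
    have "(\<lambda>n. pnorm c (s n)) \<longlonglongrightarrow> h.pnorm c (cls s)"
      unfolding pnorm_def h.pnorm_def using s c
      by (simp add: compl_ip) (intro tendsto_intros ip_tendsto)
    then show "h.pnorm c (cls s) \<le> K"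
    proof (rule tendsto_upperbound)
      show "eventually (\<lambda>n. pnorm c (s n) \<le> K) sequentially"
        unfolding eventually_sequentially
        by (intro exI[of _ N] allI impI order_trans[OF pnorm_le_nrm[OF CS_closed[OF s] c] K])
    qed auto
  qed
qed

text \<open>The difference is the class of the sequence with terms \<open>s m \<ominus> s n\<close>,
  n fixed; its tail is small by the Cauchy property.\<close>

lemma cls_approx:
  assumes s: "s \<in> CS" and "e > 0"
  shows "\<exists>N. \<forall>n\<ge>N. mod_norm B Mh (cls s \<ominus>\<^bsub>Mh\<^esub> compl_embed B M (s n)) \<le> e"
proof -
  obtain N where N: "\<And>m n. \<lbrakk>m \<ge> N; n \<ge> N\<rbrakk> \<Longrightarrow> nrm (s m \<ominus> s n) < e"
    using CS_D[OF assms] by blast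
  have "mod_norm B Mh (cls s \<ominus>\<^bsub>Mh\<^esub> compl_embed B M (s n)) \<le> e" if "n \<ge> N" for n
  proof -
    have c: "(\<lambda>m. s n) \<in> CS" by (rule CS_const[OF CS_closed[OF s]])
    have "mod_norm B Mh (cls (\<lambda>m. s m \<ominus> s n)) \<le> e"
      using \<open>e > 0\<close> N that by (intro nrm_cls_le[where N = N] CS_minus s c less_imp_le)
    then show ?thesis
      unfolding compl_embed_def using s c by (simp add: compl_minus)
  qed
  then show ?thesis by blast
qed

lemma embed_dense:
  assumes "\<xi> \<in> carrier Mh" "e > 0"
  obtains x where "x \<in> carrier M" "mod_norm B Mh (\<xi> \<ominus>\<^bsub>Mh\<^esub> compl_embed B M x) \<le> e"
proof -
  obtain s where "s \<in> CS" "\<xi> = cls s" using assms by (auto simp: compl_carrier)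
  then show thesis
    using cls_approx[OF _ assms(2), of s] that CS_closed by blast
qed

lemma inner_product_module_completion: "inner_product_module B Mh"
  unfolding inner_product_module_def
proof (intro conjI ballI impI)
  show "pre_inner_product_module B Mh" by (rule pre_inner_product_module_completion)
  interpret h: pre_ip B Mh by (rule pre_ip_completion)
  fix \<xi> assume \<xi>: "\<xi> \<in> carrier Mh" and 0: "ip Mh \<xi> \<xi> = \<zero>\<^bsub>cont_fun_ring B\<^esub>"
  obtain s where s: "s \<in> CS" "\<xi> = cls s" using \<xi> by (auto simp: compl_carrier)
  have n0: "h.nrm \<xi> = 0"
    using h.nrm_nonneg[OF \<xi>] h.nrm_least[of 0 \<xi>]
    by (simp add: h.pnorm_def 0 cont_fun_ring_simps)
  \<comment> \<open>The embedded terms of s converge to a class of norm zero and the embedding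
    preserves norms, so the terms themselves tend to zero and s represents the zero class.\<close>
  have "eqv s (\<lambda>n. \<zero>)"
    unfolding eqv_def
  proof (rule LIMSEQ_I)
    fix e :: real assume "0 < e"
    then obtain N where N: "\<And>n. n \<ge> N \<Longrightarrow> h.nrm (\<xi> \<ominus>\<^bsub>Mh\<^esub> compl_embed B M (s n)) \<le> e/2"
      using cls_approx[OF s(1), of "e/2"] s(2) by auto
    have "nrm (s n) < e" if "n \<ge> N" for n
    proof -
      have en: "compl_embed B M (s n) \<in> carrier Mh" using s by (simp add: embed_in CS_closed)
      have "nrm (s n) = h.nrm (compl_embed B M (s n))"
        using s by (simp add: nrm_embed CS_closed)
      also have "\<dots> \<le> h.nrm \<xi> + h.nrm (compl_embed B M (s n) \<ominus>\<^bsub>Mh\<^esub> \<xi>)"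
        using en \<xi> by (rule h.nrm_le_minus)
      also have "\<dots> \<le> e/2"
        using n0 N[OF that] by (simp add: h.nrm_minus_commute[OF en \<xi>])
      finally show ?thesis using \<open>0 < e\<close> by simp
    qed
    then show "\<exists>no. \<forall>n\<ge>no. norm (nrm (s n \<ominus> \<zero>) - 0) < e"
      using s nrm_nonneg by (auto simp: CS_closed)
  qed
  then show "\<xi> = \<zero>\<^bsub>Mh\<^esub>"
    using s by (simp add: compl_zero cls_eq_iff CS_zero)
qed

text \<open>A Cauchy sequence of classes is traced by embedded vectors at distance at most 1/(n+1).
  These vectors are again Cauchy in the original module, and the class they form is the
  limit.\<close>

lemma hilbert_module_completion: "hilbert_module B Mh"
  unfolding hilbert_module_def
proof (intro conjI ballI)
  show "inner_product_module B Mh" by (rule inner_product_module_completion)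
  interpret h: pre_ip B Mh by (rule pre_ip_completion)
  fix \<sigma> assume \<sigma>: "\<sigma> \<in> h.CS"
  note cl = h.CS_closed[OF \<sigma>]
  have "\<exists>x. x \<in> carrier M \<and> h.nrm (\<sigma> n \<ominus>\<^bsub>Mh\<^esub> compl_embed B M x) \<le> inverse (real (Suc n))" for n
    using embed_dense[OF cl, of "inverse (real (Suc n))"] by auto
  then obtain x where x: "\<And>n. x n \<in> carrier M"
    and xs: "\<And>n. h.nrm (\<sigma> n \<ominus>\<^bsub>Mh\<^esub> compl_embed B M (x n)) \<le> inverse (real (Suc n))"
    by metis
  define E where "E n = compl_embed B M (x n)" for n
  have E: "E n \<in> carrier Mh" for n using x by (simp add: E_def embed_in)
  have xCS: "x \<in> CS"
  proof (rule CS_I)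
    fix e :: real assume "e > 0"
    then have e: "e/3 > 0" by simp
    obtain N1 where N1: "\<And>m n. \<lbrakk>m \<ge> N1; n \<ge> N1\<rbrakk> \<Longrightarrow> h.nrm (\<sigma> m \<ominus>\<^bsub>Mh\<^esub> \<sigma> n) < e/3"
      using h.CS_D[OF \<sigma> e] by blast
    obtain N2 where N2: "inverse (real (Suc N2)) < e/3"
      using reals_Archimedean[OF e] by blast
    have "nrm (x m \<ominus> x n) < e" if m: "m \<ge> max N1 N2" and n: "n \<ge> max N1 N2" for m n
    proof -
      have small: "h.nrm (\<sigma> k \<ominus>\<^bsub>Mh\<^esub> E k) < e/3" if "k \<ge> max N1 N2" for k
      proof -
        have "inverse (real (Suc k)) \<le> inverse (real (Suc N2))" using that by simp
        then show ?thesis unfolding E_def using xs[of k] N2 by linarith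
      qed
      have "nrm (x m \<ominus> x n) = h.nrm (E m \<ominus>\<^bsub>Mh\<^esub> E n)"
        using x by (simp add: E_def embed_minus nrm_embed)
      also have "\<dots> \<le> h.nrm (E m \<ominus>\<^bsub>Mh\<^esub> \<sigma> m) + h.nrm (\<sigma> m \<ominus>\<^bsub>Mh\<^esub> E n)"
        using E cl by (intro h.nrm_triangle)
      also have "\<dots> \<le> h.nrm (E m \<ominus>\<^bsub>Mh\<^esub> \<sigma> m) + (h.nrm (\<sigma> m \<ominus>\<^bsub>Mh\<^esub> \<sigma> n) + h.nrm (\<sigma> n \<ominus>\<^bsub>Mh\<^esub> E n))"
        using E cl by (intro add_left_mono h.nrm_triangle)
      also have "\<dots> < e"
        using small[OF m] small[OF n] N1[of m n] m n h.nrm_minus_commute[OF E[of m] cl[of m]] by simp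
      finally show ?thesis .
    qed
    then show "\<exists>N. \<forall>m\<ge>N. \<forall>n\<ge>N. nrm (x m \<ominus> x n) < e" by blast
  qed (rule x)
  have \<xi>: "cls x \<in> carrier Mh" using xCS by (simp add: compl_carrier)
  have "(\<lambda>n. h.nrm (\<sigma> n \<ominus>\<^bsub>Mh\<^esub> cls x)) \<longlonglongrightarrow> 0"
  proof (rule LIMSEQ_I)
    fix e :: real assume "0 < e"
    then have e: "e/2 > 0" by simp
    obtain N1 where N1: "\<And>n. n \<ge> N1 \<Longrightarrow> h.nrm (cls x \<ominus>\<^bsub>Mh\<^esub> E n) \<le> e/2"
      using cls_approx[OF xCS e] by (auto simp: E_def)
    obtain N2 where N2: "inverse (real (Suc N2)) < e/2"
      using reals_Archimedean[OF e] by blast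
    have "h.nrm (\<sigma> n \<ominus>\<^bsub>Mh\<^esub> cls x) < e" if n: "n \<ge> max N1 N2" for n
    proof -
      have "inverse (real (Suc n)) \<le> inverse (real (Suc N2))" using n by simp
      then have "h.nrm (\<sigma> n \<ominus>\<^bsub>Mh\<^esub> E n) < e/2" unfolding E_def using xs[of n] N2 by linarith
      moreover have "h.nrm (E n \<ominus>\<^bsub>Mh\<^esub> cls x) \<le> e/2"
        using N1[of n] n h.nrm_minus_commute[OF E \<xi>] by simp
      ultimately show ?thesis
        using h.nrm_triangle[OF cl[of n] E[of n] \<xi>] by linarith
    qed
    then show "\<exists>no. \<forall>n\<ge>no. norm (h.nrm (\<sigma> n \<ominus>\<^bsub>Mh\<^esub> cls x) - 0) < e"
      using h.nrm_nonneg cl \<xi> by (intro exI[of _ "max N1 N2"]) simp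
  qed
  then show "\<exists>\<xi>\<in>carrier Mh. (\<lambda>n. h.nrm (\<sigma> n \<ominus>\<^bsub>Mh\<^esub> \<xi>)) \<longlonglongrightarrow> 0"
    using \<xi> by blast
qed

end

section \<open>Direct limits of Hilbert modules\<close>

text \<open>Lets an approximation error proportional to e disappear. The value e / (Q + 1) is
  inserted because Q may be 0.\<close>

lemma real_le_of_le_add_mult:
  fixes a b Q :: real
  assumes "\<And>e. e > 0 \<Longrightarrow> a \<le> b + Q * e" "0 \<le> Q"
  shows "a \<le> b"
proof (rule field_le_epsilon)
  fix e :: real assume "e > 0"
  have "a \<le> b + Q * (e / (Q + 1))"
    using \<open>e > 0\<close> assms(2) by (intro assms(1)) auto
  also have "Q * (e / (Q + 1)) \<le> e"
    using \<open>e > 0\<close> assms(2) by (simp add: field_simps)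
  finally show "a \<le> b + e" by simp
qed

lemma sup_norm_cong: "(\<And>c. c \<in> topspace B \<Longrightarrow> f c = g c) \<Longrightarrow> sup_norm B f = sup_norm B g"
  unfolding sup_norm_def by (metis (no_types, lifting) image_cong)

lemma (in pre_ip) eq_if_nrm_minus_le_0:
  assumes "inner_product_module B M" "x \<in> carrier M" "y \<in> carrier M" "nrm (x \<ominus> y) \<le> 0"
  shows "x = y"
proof -
  have d: "x \<ominus> y \<in> carrier M" using assms by simp
  have "ip M (x \<ominus> y) (x \<ominus> y) c = 0" if "c \<in> topspace B" for c
    using pnorm_le_nrm[OF d that] assms(4) pnorm_nonneg[OF that, of "x \<ominus> y"]
    by (simp add: ip_self[OF that d])
  \<comment> \<open>Vanishing at every point of the space yields equality with the zero of the ring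
    only because values of the inner product are extensional.\<close>
  moreover have "ip M (x \<ominus> y) (x \<ominus> y) \<in> extensional (topspace B)"
    using ip_in[OF d d] by (simp add: mem_cont_fun_ring)
  ultimately have "ip M (x \<ominus> y) (x \<ominus> y) = \<zero>\<^bsub>cont_fun_ring B\<^esub>"
    unfolding cont_fun_ring_simps by (intro extensionalityI[where A = "topspace B"]) auto
  then have "x \<ominus> y = \<zero>"
    using assms(1) d unfolding inner_product_module_def by blast
  then have "\<zero> \<oplus> y = (x \<ominus> y) \<oplus> y" by simp
  also have "\<dots> = x" using assms(2,3) by (simp add: a_minus_def a_assoc l_neg)
  finally show ?thesis using assms(3) by simp
qed

section \<open>Bounded module homomorphisms and their norms\<close>

locale pre_ip_pair = M: pre_ip B M + N: pre_ip B N
  for B :: "'a topology" and M :: "('a \<Rightarrow> complex, 'm) ip_module" and N :: "('a \<Rightarrow> complex, 'n) ip_module"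
begin

lemma module_homs_closed: "\<lbrakk>T \<in> module_homs B M N; x \<in> carrier M\<rbrakk> \<Longrightarrow> T x \<in> carrier N"
  by (auto simp: module_homs_def)

lemma module_homs_add:
  "\<lbrakk>T \<in> module_homs B M N; x \<in> carrier M; y \<in> carrier M\<rbrakk> \<Longrightarrow> T (x \<oplus>\<^bsub>M\<^esub> y) = T x \<oplus>\<^bsub>N\<^esub> T y"
  by (auto simp: module_homs_def)

lemma module_homs_smult:
  "\<lbrakk>T \<in> module_homs B M N; x \<in> carrier M; f \<in> M.Fun\<rbrakk> \<Longrightarrow> T (f \<odot>\<^bsub>M\<^esub> x) = f \<odot>\<^bsub>N\<^esub> T x"
  by (auto simp: module_homs_def)

lemma module_homs_minus:
  assumes "T \<in> module_homs B M N" "x \<in> carrier M" "y \<in> carrier M"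
  shows "T (x \<ominus>\<^bsub>M\<^esub> y) = T x \<ominus>\<^bsub>N\<^esub> T y"
proof -
  have "T (x \<ominus>\<^bsub>M\<^esub> y) \<oplus>\<^bsub>N\<^esub> T y = T ((x \<ominus>\<^bsub>M\<^esub> y) \<oplus>\<^bsub>M\<^esub> y)"
    using assms by (simp add: module_homs_add)
  also have "(x \<ominus>\<^bsub>M\<^esub> y) \<oplus>\<^bsub>M\<^esub> y = x"
    using assms by (simp add: a_minus_def M.a_assoc M.l_neg)
  finally have "T x = T (x \<ominus>\<^bsub>M\<^esub> y) \<oplus>\<^bsub>N\<^esub> T y" by simp
  then show ?thesis
    using assms by (simp add: a_minus_def N.a_assoc N.r_neg module_homs_closed)
qed

lemma module_homs_zero:
  assumes "T \<in> module_homs B M N"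
  shows "T \<zero>\<^bsub>M\<^esub> = \<zero>\<^bsub>N\<^esub>"
  using module_homs_minus[OF assms M.zero_closed M.zero_closed] assms
  by (simp add: module_homs_closed)

text \<open>A supremum of reals bounds the members only when the set is bounded above; membership in
  \<open>bounded_module_homs\<close> supplies that. Vectors of positive length are then rescaled to
  the unit ball, while nonzero vectors of length 0, possible in a degenerate module, are settled by
  the original bound.\<close>

lemma op_norm_le_imp:
  assumes T: "T \<in> bounded_module_homs B M N" and K: "op_norm B M N T \<le> K"
  shows "0 \<le> K" "\<And>x. x \<in> carrier M \<Longrightarrow> N.nrm (T x) \<le> K * M.nrm x"
proof -
  have hom: "T \<in> module_homs B M N" using T by (simp add: bounded_module_homs_def)
  obtain K0 where K0: "\<And>x. x \<in> carrier M \<Longrightarrow> N.nrm (T x) \<le> K0 * M.nrm x"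
    using T unfolding bounded_module_homs_def by blast
  define U where "U = {N.nrm (T x) |x. x \<in> carrier M \<and> M.nrm x \<le> 1}"
  have "bdd_above U"
  proof (rule bdd_aboveI)
    fix u assume "u \<in> U"
    then obtain x where x: "u = N.nrm (T x)" "x \<in> carrier M" "M.nrm x \<le> 1" by (auto simp: U_def)
    have "u \<le> K0 * M.nrm x" using x K0 by simp
    \<comment> \<open>The constant \<open>K0\<close> comes without a sign.\<close>
    also have "\<dots> \<le> \<bar>K0\<bar> * 1"
      using x M.nrm_nonneg[OF x(2)] by (intro mult_mono) auto
    finally show "u \<le> \<bar>K0\<bar>" by simp
  qed
  then have le: "N.nrm (T x) \<le> K" if "x \<in> carrier M" "M.nrm x \<le> 1" for x
    using cSup_upper[of "N.nrm (T x)" U] K that unfolding op_norm_def U_def[symmetric]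
    by (force simp: U_def)
  show K0': "0 \<le> K"
    using le[of "\<zero>\<^bsub>M\<^esub>"] by (simp add: module_homs_zero[OF hom])
  fix x assume x: "x \<in> carrier M"
  show "N.nrm (T x) \<le> K * M.nrm x"
  proof (cases "M.nrm x = 0")
    case True
    then show ?thesis using K0[OF x] by simp
  next
    case False
    define n where "n = M.nrm x"
    have n: "n > 0" using False M.nrm_nonneg[OF x] by (simp add: n_def)
    \<comment> \<open>Scalars are constant functions: \<open>f\<close> shrinks x into the unit ball
      and \<open>g\<close> is its inverse in the ring.\<close>
    define f where "f = (\<lambda>c\<in>topspace B. complex_of_real (1/n))"
    define g where "g = (\<lambda>c\<in>topspace B. complex_of_real n)"
    have f: "f \<in> M.Fun" and g: "g \<in> M.Fun" by (simp_all add: f_def g_def mem_cont_fun_ring)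
    have fx: "f \<odot>\<^bsub>M\<^esub> x \<in> carrier M" using f x by simp
    have "M.nrm (f \<odot>\<^bsub>M\<^esub> x) \<le> 1/n * M.nrm x"
      using f x n by (intro M.nrm_smult_le) (auto simp: f_def norm_divide)
    then have "M.nrm (f \<odot>\<^bsub>M\<^esub> x) \<le> 1" using n by (simp add: n_def)
    then have *: "N.nrm (T (f \<odot>\<^bsub>M\<^esub> x)) \<le> K" using fx by (rule le[rotated])
    have "g \<otimes>\<^bsub>cont_fun_ring B\<^esub> f = \<one>\<^bsub>cont_fun_ring B\<^esub>"
      using n by (auto simp: f_def g_def cont_fun_ring_simps cong: restrict_cong)
    then have "g \<odot>\<^bsub>M\<^esub> (f \<odot>\<^bsub>M\<^esub> x) = x"
      using M.smult_assoc1[OF g f x] x by simp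
    then have "T x = g \<odot>\<^bsub>N\<^esub> T (f \<odot>\<^bsub>M\<^esub> x)"
      using module_homs_smult[OF hom fx g] by simp
    also have "N.nrm \<dots> \<le> n * N.nrm (T (f \<odot>\<^bsub>M\<^esub> x))"
      using g n fx by (intro N.nrm_smult_le) (auto simp: g_def module_homs_closed[OF hom])
    also have "\<dots> \<le> n * K" using * n by simp
    finally show ?thesis by (simp add: n_def mult.commute)
  qed
qed

lemma op_norm_leI:
  assumes T: "T \<in> module_homs B M N" and K: "0 \<le> K"
    and le: "\<And>x. x \<in> carrier M \<Longrightarrow> N.nrm (T x) \<le> K * M.nrm x"
  shows "T \<in> bounded_module_homs B M N" "op_norm B M N T \<le> K"
proof -
  show "T \<in> bounded_module_homs B M N"
    using T le by (auto simp: bounded_module_homs_def)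
  show "op_norm B M N T \<le> K"
    unfolding op_norm_def
  proof (rule cSup_least)
    show "{N.nrm (T x) |x. x \<in> carrier M \<and> M.nrm x \<le> 1} \<noteq> {}"
      using M.zero_closed M.nrm_zero by force
    fix u assume "u \<in> {N.nrm (T x) |x. x \<in> carrier M \<and> M.nrm x \<le> 1}"
    then obtain x where x: "u = N.nrm (T x)" "x \<in> carrier M" "M.nrm x \<le> 1" by auto
    have "u \<le> K * M.nrm x" using x le by simp
    also have "\<dots> \<le> K * 1" using x K by (intro mult_left_mono)
    finally show "u \<le> K" by simp
  qed
qed

end

section \<open>Inner-product preserving maps and their extensions to completions\<close>

locale ip_preserving_map = pre_ip_pair B M N
  for B :: "'a topology" and M :: "('a \<Rightarrow> complex, 'm) ip_module" and N :: "('a \<Rightarrow> complex, 'n) ip_module" +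
  fixes T :: "'m \<Rightarrow> 'n"
  assumes ip_pres: "ip_preserving M N T"
begin

lemma T_closed: "x \<in> carrier M \<Longrightarrow> T x \<in> carrier N"
  using ip_pres by (auto simp: ip_preserving_def)

lemma ip_T: "\<lbrakk>x \<in> carrier M; y \<in> carrier M\<rbrakk> \<Longrightarrow> ip N (T x) (T y) = ip M x y"
  using ip_pres by (auto simp: ip_preserving_def)

lemma nrm_T: "x \<in> carrier M \<Longrightarrow> N.nrm (T x) = M.nrm x"
  by (simp add: mod_norm_def ip_T)

text \<open>T is not known to be additive here. The expanded length of T x - T y involves only inner
  products of the two images, so preservation of inner products suffices; T thus respects Cauchy
  sequences and equivalence.\<close>

lemma nrm_T_minus:
  assumes "x \<in> carrier M" "y \<in> carrier M"
  shows "N.nrm (T x \<ominus>\<^bsub>N\<^esub> T y) = M.nrm (x \<ominus>\<^bsub>M\<^esub> y)"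
proof -
  have "ip N (T x \<ominus>\<^bsub>N\<^esub> T y) (T x \<ominus>\<^bsub>N\<^esub> T y) c = ip M (x \<ominus>\<^bsub>M\<^esub> y) (x \<ominus>\<^bsub>M\<^esub> y) c" if "c \<in> topspace B" for c
    using assms that
    by (simp add: N.ip_minus_left N.ip_minus_right M.ip_minus_left M.ip_minus_right T_closed ip_T)
  then show ?thesis
    unfolding mod_norm_def by (simp cong: sup_norm_cong)
qed

lemma T_CS: "s \<in> M.CS \<Longrightarrow> (\<lambda>n. T (s n)) \<in> N.CS"
  by (simp add: cauchy_seqs_def T_closed nrm_T_minus)

lemma compl_map_cls:
  assumes s: "s \<in> M.CS"
  shows "compl_map B N T (M.cls s) = N.cls (\<lambda>n. T (s n))"
proof -
  have "M.eqv (compl_rep (M.cls s)) s" "compl_rep (M.cls s) \<in> M.CS"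
    using s by (simp_all add: M.rep_cls)
  then have "N.eqv (\<lambda>n. T (compl_rep (M.cls s) n)) (\<lambda>n. T (s n))"
    using s by (simp add: M.eqv_def N.eqv_def nrm_T_minus M.CS_closed)
  then show ?thesis
    unfolding compl_map_def using s by (simp add: N.cls_eq_iff T_CS M.rep_cls)
qed

lemma compl_map_embed:
  "x \<in> carrier M \<Longrightarrow> compl_map B N T (compl_embed B M x) = compl_embed B N (T x)"
  by (simp add: compl_embed_def compl_map_cls M.CS_const)

lemma ip_preserving_compl_map: "ip_preserving M.Mh N.Mh (compl_map B N T)"
  unfolding ip_preserving_def
proof (intro conjI funcsetI ballI)
  fix x assume "x \<in> carrier M.Mh"
  then obtain s where s: "s \<in> M.CS" "x = M.cls s" by (auto simp: M.compl_carrier)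
  show "compl_map B N T x \<in> carrier N.Mh"
    using s by (simp add: compl_map_cls T_CS N.compl_carrier)
  fix y assume "y \<in> carrier M.Mh"
  then obtain t where t: "t \<in> M.CS" "y = M.cls t" by (auto simp: M.compl_carrier)
  show "ip N.Mh (compl_map B N T x) (compl_map B N T y) = ip M.Mh x y"
    using s t
    by (simp add: compl_map_cls M.compl_ip N.compl_ip T_CS M.ip_lim_def N.ip_lim_def ip_T M.CS_closed)
qed

text \<open>The length of the defect T(x + y) - T x - T y expands into inner products of images,
  which equal those of x + y, x and y and cancel. Definiteness of the target makes the defect zero;
  the action is treated in the same way.\<close>

lemma module_hom:
  assumes N: "inner_product_module B N"
  shows "T \<in> module_homs B M N"
  unfolding module_homs_def
proof (intro CollectI conjI funcsetI ballI)
  fix x assume x: "x \<in> carrier M"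
  show "T x \<in> carrier N" using x by (rule T_closed)
  have eqI: "u = v" if u: "u \<in> carrier N" "v \<in> carrier N"
    and 0: "\<And>c. c \<in> topspace B \<Longrightarrow> ip N (u \<ominus>\<^bsub>N\<^esub> v) (u \<ominus>\<^bsub>N\<^esub> v) c = 0" for u v
    using u 0 by (intro N.eq_if_nrm_minus_le_0[OF N] N.nrm_least) (auto simp: N.pnorm_def)
  show "T (x \<oplus>\<^bsub>M\<^esub> y) = T x \<oplus>\<^bsub>N\<^esub> T y" if y: "y \<in> carrier M" for y
    using x y
    by (intro eqI)
      (simp_all add: T_closed N.ip_minus_left N.ip_minus_right N.ip_add_left N.ip_add_right ip_T
        M.ip_add_left M.ip_add_right algebra_simps)
  show "T (f \<odot>\<^bsub>M\<^esub> x) = f \<odot>\<^bsub>N\<^esub> T x" if f: "f \<in> M.Fun" for f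
    using x f
    by (intro eqI)
      (simp_all add: T_closed N.ip_minus_left N.ip_minus_right N.ip_smult_left N.ip_smult_right ip_T
        M.ip_smult_left M.ip_smult_right algebra_simps)
qed

end

section \<open>Extension of a bounded homomorphism from a dense subset by continuity\<close>

locale dense_hom = pre_ip_pair B L Z
  for B :: "'a topology" and L :: "('a \<Rightarrow> complex, 'l) ip_module" and Z :: "('a \<Rightarrow> complex, 'z) ip_module" +
  fixes D :: "'l set" and R :: "'l \<Rightarrow> 'z" and K :: real
  assumes hilbert: "hilbert_module B Z"
    and D_sub: "D \<subseteq> carrier L"
    and D_add: "\<And>x y. \<lbrakk>x \<in> D; y \<in> D\<rbrakk> \<Longrightarrow> x \<oplus>\<^bsub>L\<^esub> y \<in> D"
    and D_smult: "\<And>x f. \<lbrakk>x \<in> D; f \<in> M.Fun\<rbrakk> \<Longrightarrow> f \<odot>\<^bsub>L\<^esub> x \<in> D"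
    and R_closed: "\<And>x. x \<in> D \<Longrightarrow> R x \<in> carrier Z"
    and R_add: "\<And>x y. \<lbrakk>x \<in> D; y \<in> D\<rbrakk> \<Longrightarrow> R (x \<oplus>\<^bsub>L\<^esub> y) = R x \<oplus>\<^bsub>Z\<^esub> R y"
    and R_smult: "\<And>x f. \<lbrakk>x \<in> D; f \<in> M.Fun\<rbrakk> \<Longrightarrow> R (f \<odot>\<^bsub>L\<^esub> x) = f \<odot>\<^bsub>Z\<^esub> R x"
    and K: "0 \<le> K"
    and R_bound: "\<And>x. x \<in> D \<Longrightarrow> N.nrm (R x) \<le> K * M.nrm x"
    and dense: "\<And>x e. \<lbrakk>x \<in> carrier L; e > 0\<rbrakk> \<Longrightarrow> \<exists>d\<in>D. M.nrm (x \<ominus>\<^bsub>L\<^esub> d) \<le> e"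
begin

lemma ipm: "inner_product_module B Z"
  using hilbert by (simp add: hilbert_module_def)

lemma D_closed: "x \<in> D \<Longrightarrow> x \<in> carrier L"
  using D_sub by blast

lemma R_minus_bound:
  assumes x: "x \<in> D" and y: "y \<in> D"
  shows "N.nrm (R x \<ominus>\<^bsub>Z\<^esub> R y) \<le> K * M.nrm (x \<ominus>\<^bsub>L\<^esub> y)"
proof -
  \<comment> \<open>Closure of \<open>D\<close> under negatives is not among the assumptions; it is
    obtained from the action of the constant -1.\<close>
  let ?m = "\<ominus>\<^bsub>cont_fun_ring B\<^esub> \<one>\<^bsub>cont_fun_ring B\<^esub>"
  have m: "?m \<in> M.Fun" by (rule M.R.a_inv_closed[OF M.R.one_closed])
  have L: "\<ominus>\<^bsub>L\<^esub> y = ?m \<odot>\<^bsub>L\<^esub> y"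
    using y by (simp add: M.smult_l_minus[OF M.R.one_closed] D_closed)
  have Z: "\<ominus>\<^bsub>Z\<^esub> R y = ?m \<odot>\<^bsub>Z\<^esub> R y"
    using y by (simp add: N.smult_l_minus[OF M.R.one_closed] R_closed)
  have my: "?m \<odot>\<^bsub>L\<^esub> y \<in> D" using y m by (rule D_smult)
  have "R x \<ominus>\<^bsub>Z\<^esub> R y = R (x \<ominus>\<^bsub>L\<^esub> y)"
    unfolding a_minus_def L Z by (simp only: R_add[OF x my] R_smult[OF y m])
  moreover have "x \<ominus>\<^bsub>L\<^esub> y \<in> D"
    unfolding a_minus_def L by (rule D_add[OF x my])
  ultimately show ?thesis by (simp add: R_bound)
qed

text \<open>
  The graph of the extension is described by inequalities against \<open>D\<close> rather than by limits of
  sequences, so that no well-definedness has to be checked.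
\<close>

definition ext_graph :: "'l \<Rightarrow> 'z \<Rightarrow> bool" where
  "ext_graph x z \<longleftrightarrow> z \<in> carrier Z \<and> (\<forall>d\<in>D. N.nrm (z \<ominus>\<^bsub>Z\<^esub> R d) \<le> K * M.nrm (x \<ominus>\<^bsub>L\<^esub> d))"

text \<open>Comparing z with R d' through an approximating d costs at most (Q + K) e, which vanishes
  with e. Hence any rate Q is good enough to enter the graph, although the graph itself demands the
  constant K.\<close>

lemma ext_graphI:
  assumes x: "x \<in> carrier L" and z: "z \<in> carrier Z" and Q: "0 \<le> Q"
    and app: "\<And>e. e > 0 \<Longrightarrow> \<exists>d\<in>D. M.nrm (x \<ominus>\<^bsub>L\<^esub> d) \<le> e \<and> N.nrm (z \<ominus>\<^bsub>Z\<^esub> R d) \<le> Q * e"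
  shows "ext_graph x z"
  unfolding ext_graph_def
proof (intro conjI ballI)
  fix d' assume d': "d' \<in> D"
  show "N.nrm (z \<ominus>\<^bsub>Z\<^esub> R d') \<le> K * M.nrm (x \<ominus>\<^bsub>L\<^esub> d')"
  proof (rule real_le_of_le_add_mult)
    fix e :: real assume "e > 0"
    then obtain d where d: "d \<in> D" "M.nrm (x \<ominus>\<^bsub>L\<^esub> d) \<le> e" "N.nrm (z \<ominus>\<^bsub>Z\<^esub> R d) \<le> Q * e"
      using app by blast
    have "M.nrm (d \<ominus>\<^bsub>L\<^esub> d') \<le> M.nrm (d \<ominus>\<^bsub>L\<^esub> x) + M.nrm (x \<ominus>\<^bsub>L\<^esub> d')"
      using x d d' by (intro M.nrm_triangle) (auto intro: D_closed)
    also have "M.nrm (d \<ominus>\<^bsub>L\<^esub> x) = M.nrm (x \<ominus>\<^bsub>L\<^esub> d)"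
      using x d by (intro M.nrm_minus_commute) (auto intro: D_closed)
    finally have 1: "M.nrm (d \<ominus>\<^bsub>L\<^esub> d') \<le> e + M.nrm (x \<ominus>\<^bsub>L\<^esub> d')" using d by simp
    have "N.nrm (z \<ominus>\<^bsub>Z\<^esub> R d') \<le> N.nrm (z \<ominus>\<^bsub>Z\<^esub> R d) + N.nrm (R d \<ominus>\<^bsub>Z\<^esub> R d')"
      using z d d' by (intro N.nrm_triangle) (auto intro: R_closed)
    also have "\<dots> \<le> Q * e + K * M.nrm (d \<ominus>\<^bsub>L\<^esub> d')"
      using d d' by (intro add_mono R_minus_bound)
    also have "\<dots> \<le> Q * e + K * (e + M.nrm (x \<ominus>\<^bsub>L\<^esub> d'))"
      using 1 K by (intro add_left_mono mult_left_mono)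
    finally show "N.nrm (z \<ominus>\<^bsub>Z\<^esub> R d') \<le> K * M.nrm (x \<ominus>\<^bsub>L\<^esub> d') + (Q + K) * e"
      by (simp add: algebra_simps)
  qed (use Q K in simp)
qed (rule z)

lemma ext_graph_unique:
  assumes x: "x \<in> carrier L" and z: "ext_graph x z" "ext_graph x z'"
  shows "z = z'"
proof (rule N.eq_if_nrm_minus_le_0[OF ipm])
  show zc: "z \<in> carrier Z" "z' \<in> carrier Z" using z by (auto simp: ext_graph_def)
  show "N.nrm (z \<ominus>\<^bsub>Z\<^esub> z') \<le> 0"
  proof (rule real_le_of_le_add_mult)
    fix e :: real assume "e > 0"
    then obtain d where d: "d \<in> D" "M.nrm (x \<ominus>\<^bsub>L\<^esub> d) \<le> e" using dense x by blast
    have "N.nrm (z \<ominus>\<^bsub>Z\<^esub> z') \<le> N.nrm (z \<ominus>\<^bsub>Z\<^esub> R d) + N.nrm (R d \<ominus>\<^bsub>Z\<^esub> z')"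
      using zc d R_closed by (intro N.nrm_triangle) auto
    also have "N.nrm (R d \<ominus>\<^bsub>Z\<^esub> z') = N.nrm (z' \<ominus>\<^bsub>Z\<^esub> R d)"
      using zc d R_closed by (intro N.nrm_minus_commute) auto
    also have "N.nrm (z \<ominus>\<^bsub>Z\<^esub> R d) + N.nrm (z' \<ominus>\<^bsub>Z\<^esub> R d) \<le> K * M.nrm (x \<ominus>\<^bsub>L\<^esub> d) + K * M.nrm (x \<ominus>\<^bsub>L\<^esub> d)"
      using z d by (intro add_mono) (auto simp: ext_graph_def)
    also have "\<dots> \<le> K * e + K * e"
      using d K by (intro add_mono mult_left_mono)
    finally show "N.nrm (z \<ominus>\<^bsub>Z\<^esub> z') \<le> 0 + (2 * K) * e" by simp
  qed (use K in simp)
qed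

text \<open>R maps a sequence in \<open>D\<close> converging to x to a Cauchy sequence, since R is
  K-Lipschitz on \<open>D\<close>; completeness of Z supplies its limit.\<close>

lemma ext_graph_exists:
  assumes x: "x \<in> carrier L"
  shows "\<exists>z. ext_graph x z"
proof -
  have "\<exists>d. d \<in> D \<and> M.nrm (x \<ominus>\<^bsub>L\<^esub> d) \<le> inverse (real (Suc n))" for n
    using dense[OF x, of "inverse (real (Suc n))"] by auto
  then obtain d where d: "\<And>n. d n \<in> D" and dn: "\<And>n. M.nrm (x \<ominus>\<^bsub>L\<^esub> d n) \<le> inverse (real (Suc n))"
    by metis
  note dL = D_closed[OF d] and RZ = R_closed[OF d]
  have dN: "M.nrm (x \<ominus>\<^bsub>L\<^esub> d n) \<le> inverse (real (Suc N))" if "n \<ge> N" for n N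
    using that by (intro order_trans[OF dn]) simp
  have "(\<lambda>n. R (d n)) \<in> N.CS"
  proof (rule N.CS_I)
    fix e :: real assume "e > 0"
    \<comment> \<open>Two approximation errors, magnified by K, give the term 2 * K; the 1 prevents
      division by zero.\<close>
    then have "e / (2 * K + 1) > 0" using K by simp
    then obtain N where N: "inverse (real (Suc N)) < e / (2 * K + 1)"
      using reals_Archimedean by blast
    have "N.nrm (R (d m) \<ominus>\<^bsub>Z\<^esub> R (d n)) < e" if mn: "m \<ge> N" "n \<ge> N" for m n
    proof -
      have "M.nrm (d m \<ominus>\<^bsub>L\<^esub> d n) \<le> M.nrm (d m \<ominus>\<^bsub>L\<^esub> x) + M.nrm (x \<ominus>\<^bsub>L\<^esub> d n)"
        using dL x by (intro M.nrm_triangle)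
      also have "\<dots> \<le> 2 * inverse (real (Suc N))"
        using dN[OF mn(1)] dN[OF mn(2)] M.nrm_minus_commute[OF dL x] by (simp del: of_nat_Suc)
      finally have "K * M.nrm (d m \<ominus>\<^bsub>L\<^esub> d n) \<le> K * (2 * inverse (real (Suc N)))"
        using K by (rule mult_left_mono)
      moreover have "N.nrm (R (d m) \<ominus>\<^bsub>Z\<^esub> R (d n)) \<le> K * M.nrm (d m \<ominus>\<^bsub>L\<^esub> d n)"
        by (rule R_minus_bound[OF d d])
      moreover have "K * (2 * inverse (real (Suc N))) + inverse (real (Suc N)) < e"
        using N K by (simp add: pos_less_divide_eq algebra_simps del: of_nat_Suc)
      moreover have "0 < inverse (real (Suc N))" by simp
      ultimately show ?thesis by linarith
    qed
    then show "\<exists>N. \<forall>m\<ge>N. \<forall>n\<ge>N. N.nrm (R (d m) \<ominus>\<^bsub>Z\<^esub> R (d n)) < e" by blast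
  qed (rule RZ)
  then have "\<exists>z\<in>carrier Z. (\<lambda>n. N.nrm (R (d n) \<ominus>\<^bsub>Z\<^esub> z)) \<longlonglongrightarrow> 0"
    using hilbert[unfolded hilbert_module_def, THEN conjunct2] by (rule bspec[rotated])
  then obtain z where z: "z \<in> carrier Z" "(\<lambda>n. N.nrm (R (d n) \<ominus>\<^bsub>Z\<^esub> z)) \<longlonglongrightarrow> 0" ..
  have "ext_graph x z"
  proof (rule ext_graphI[OF x z(1), of 1])
    fix e :: real assume "e > 0"
    then obtain N1 where N1: "\<And>n. n \<ge> N1 \<Longrightarrow> norm (N.nrm (R (d n) \<ominus>\<^bsub>Z\<^esub> z) - 0) < e"
      using LIMSEQ_D[OF z(2)] by blast
    obtain N2 where N2: "inverse (real (Suc N2)) < e"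
      using reals_Archimedean[OF \<open>e > 0\<close>] by blast
    show "\<exists>d\<in>D. M.nrm (x \<ominus>\<^bsub>L\<^esub> d) \<le> e \<and> N.nrm (z \<ominus>\<^bsub>Z\<^esub> R d) \<le> 1 * e"
    proof (intro bexI conjI)
      let ?n = "max N1 N2"
      show "d ?n \<in> D" by (rule d)
      show "M.nrm (x \<ominus>\<^bsub>L\<^esub> d ?n) \<le> e" using dN[of N2 ?n] N2 by linarith
      show "N.nrm (z \<ominus>\<^bsub>Z\<^esub> R (d ?n)) \<le> 1 * e"
        using N1[of ?n] N.nrm_minus_commute[OF z(1) RZ[of ?n]] by simp
    qed
  qed simp
  then show ?thesis by blast
qed

lemma ext_graph_add:
  assumes x: "x \<in> carrier L" and y: "y \<in> carrier L" and z: "ext_graph x z" and v: "ext_graph y v"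
  shows "ext_graph (x \<oplus>\<^bsub>L\<^esub> y) (z \<oplus>\<^bsub>Z\<^esub> v)"
proof (rule ext_graphI[of _ _ K])
  have zc: "z \<in> carrier Z" "v \<in> carrier Z" using z v by (auto simp: ext_graph_def)
  then show "x \<oplus>\<^bsub>L\<^esub> y \<in> carrier L" "z \<oplus>\<^bsub>Z\<^esub> v \<in> carrier Z" using x y by auto
  fix e :: real assume "e > 0"
  then have e: "e/2 > 0" by simp
  obtain d where d: "d \<in> D" "M.nrm (x \<ominus>\<^bsub>L\<^esub> d) \<le> e/2" using dense x e by blast
  obtain g where g: "g \<in> D" "M.nrm (y \<ominus>\<^bsub>L\<^esub> g) \<le> e/2" using dense y e by blast
  have "M.nrm ((x \<oplus>\<^bsub>L\<^esub> y) \<ominus>\<^bsub>L\<^esub> (d \<oplus>\<^bsub>L\<^esub> g)) \<le> M.nrm (x \<ominus>\<^bsub>L\<^esub> d) + M.nrm (y \<ominus>\<^bsub>L\<^esub> g)"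
    using x y d g D_closed by (simp add: M.add_minus_add M.nrm_add_le)
  then have 1: "M.nrm ((x \<oplus>\<^bsub>L\<^esub> y) \<ominus>\<^bsub>L\<^esub> (d \<oplus>\<^bsub>L\<^esub> g)) \<le> e"
    using d g by simp
  have "N.nrm ((z \<oplus>\<^bsub>Z\<^esub> v) \<ominus>\<^bsub>Z\<^esub> R (d \<oplus>\<^bsub>L\<^esub> g)) \<le> N.nrm (z \<ominus>\<^bsub>Z\<^esub> R d) + N.nrm (v \<ominus>\<^bsub>Z\<^esub> R g)"
    using zc d g R_closed by (simp add: R_add N.add_minus_add N.nrm_add_le)
  also have "\<dots> \<le> K * M.nrm (x \<ominus>\<^bsub>L\<^esub> d) + K * M.nrm (y \<ominus>\<^bsub>L\<^esub> g)"
    using z v d g by (intro add_mono) (auto simp: ext_graph_def)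
  also have "\<dots> \<le> K * (e/2) + K * (e/2)"
    using d g K by (intro add_mono mult_left_mono)
  finally have "N.nrm ((z \<oplus>\<^bsub>Z\<^esub> v) \<ominus>\<^bsub>Z\<^esub> R (d \<oplus>\<^bsub>L\<^esub> g)) \<le> K * e" by simp
  with 1 D_add[OF d(1) g(1)]
  show "\<exists>d\<in>D. M.nrm ((x \<oplus>\<^bsub>L\<^esub> y) \<ominus>\<^bsub>L\<^esub> d) \<le> e \<and> N.nrm ((z \<oplus>\<^bsub>Z\<^esub> v) \<ominus>\<^bsub>Z\<^esub> R d) \<le> K * e"
    by blast
qed (rule K)

lemma ext_graph_smult:
  assumes x: "x \<in> carrier L" and z: "ext_graph x z" and f: "f \<in> M.Fun"
  shows "ext_graph (f \<odot>\<^bsub>L\<^esub> x) (f \<odot>\<^bsub>Z\<^esub> z)"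
proof (rule ext_graphI[of _ _ K])
  have zc: "z \<in> carrier Z" using z by (auto simp: ext_graph_def)
  then show "f \<odot>\<^bsub>L\<^esub> x \<in> carrier L" "f \<odot>\<^bsub>Z\<^esub> z \<in> carrier Z" using x f by auto
  obtain F where F: "F > 0" "\<And>c. c \<in> topspace B \<Longrightarrow> cmod (f c) \<le> F"
    using M.Fun_bounded[OF f] by blast
  fix e :: real assume "e > 0"
  then have e: "e/F > 0" using F by simp
  obtain d where d: "d \<in> D" "M.nrm (x \<ominus>\<^bsub>L\<^esub> d) \<le> e/F" using dense x e by blast
  have dl: "d \<in> carrier L" "R d \<in> carrier Z" using d D_closed R_closed by auto
  have "M.nrm (f \<odot>\<^bsub>L\<^esub> x \<ominus>\<^bsub>L\<^esub> f \<odot>\<^bsub>L\<^esub> d) \<le> F * M.nrm (x \<ominus>\<^bsub>L\<^esub> d)"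
    using x dl f F M.nrm_smult_le[of "x \<ominus>\<^bsub>L\<^esub> d" f F] by (simp add: M.smult_minus)
  also have "\<dots> \<le> F * (e/F)" using d F by (intro mult_left_mono) auto
  finally have 1: "M.nrm (f \<odot>\<^bsub>L\<^esub> x \<ominus>\<^bsub>L\<^esub> f \<odot>\<^bsub>L\<^esub> d) \<le> e" using F by simp
  have "N.nrm (f \<odot>\<^bsub>Z\<^esub> z \<ominus>\<^bsub>Z\<^esub> R (f \<odot>\<^bsub>L\<^esub> d)) \<le> F * N.nrm (z \<ominus>\<^bsub>Z\<^esub> R d)"
    using zc dl f F d N.nrm_smult_le[of "z \<ominus>\<^bsub>Z\<^esub> R d" f F] by (simp add: N.smult_minus R_smult)
  also have "\<dots> \<le> F * (K * M.nrm (x \<ominus>\<^bsub>L\<^esub> d))"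
    using z d F by (intro mult_left_mono) (auto simp: ext_graph_def)
  also have "\<dots> \<le> F * (K * (e/F))" using d F K by (intro mult_left_mono) auto
  finally have "N.nrm (f \<odot>\<^bsub>Z\<^esub> z \<ominus>\<^bsub>Z\<^esub> R (f \<odot>\<^bsub>L\<^esub> d)) \<le> K * e" using F by simp
  with 1 D_smult[OF d(1) f]
  show "\<exists>d\<in>D. M.nrm (f \<odot>\<^bsub>L\<^esub> x \<ominus>\<^bsub>L\<^esub> d) \<le> e \<and> N.nrm (f \<odot>\<^bsub>Z\<^esub> z \<ominus>\<^bsub>Z\<^esub> R d) \<le> K * e"
    by blast
qed (rule K)

text \<open>Existence selects the unique graph value at each point. The graph is closed under
  addition and the action, so uniqueness of values turns these closure properties into the
  homomorphism laws.\<close>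

lemma unique_extension:
  "\<exists>!S. S \<in> extensional (carrier L) \<and> S \<in> bounded_module_homs B L Z \<and> op_norm B L Z S \<le> K \<and>
        (\<forall>d\<in>D. S d = R d)"
proof (rule ex_ex1I)
  define S where "S = (\<lambda>x\<in>carrier L. SOME z. ext_graph x z)"
  have S_ext: "S \<in> extensional (carrier L)" by (simp add: S_def)
  have G: "ext_graph x (S x)" if "x \<in> carrier L" for x
    using someI_ex[OF ext_graph_exists[OF that]] that by (simp add: S_def)
  have SR: "S d = R d" if d: "d \<in> D" for d
  proof (rule N.eq_if_nrm_minus_le_0[OF ipm])
    show "S d \<in> carrier Z" "R d \<in> carrier Z"
      using G[OF D_closed[OF d]] R_closed[OF d] by (auto simp: ext_graph_def)
    have "N.nrm (S d \<ominus>\<^bsub>Z\<^esub> R d) \<le> K * M.nrm (d \<ominus>\<^bsub>L\<^esub> d)"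
      using G[OF D_closed[OF d]] d by (auto simp: ext_graph_def)
    then show "N.nrm (S d \<ominus>\<^bsub>Z\<^esub> R d) \<le> 0" using d by (simp add: D_closed)
  qed
  have hom: "S \<in> module_homs B L Z"
    unfolding module_homs_def
  proof (intro CollectI conjI funcsetI ballI)
    fix x assume x: "x \<in> carrier L"
    show "S x \<in> carrier Z" using G[OF x] by (simp add: ext_graph_def)
    show "S (x \<oplus>\<^bsub>L\<^esub> y) = S x \<oplus>\<^bsub>Z\<^esub> S y" if y: "y \<in> carrier L" for y
      using x y by (intro ext_graph_unique[of "x \<oplus>\<^bsub>L\<^esub> y"] G ext_graph_add) auto
    show "S (f \<odot>\<^bsub>L\<^esub> x) = f \<odot>\<^bsub>Z\<^esub> S x" if f: "f \<in> M.Fun" for f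
      using x f by (intro ext_graph_unique[of "f \<odot>\<^bsub>L\<^esub> x"] G ext_graph_smult) auto
  qed
  have le: "N.nrm (S x) \<le> K * M.nrm x" if x: "x \<in> carrier L" for x
  proof -
    \<comment> \<open>The bound is the graph inequality at d = 0. Zero belongs to \<open>D\<close>,
      and R sends it to zero, because it is the zero function acting on any member of
      \<open>D\<close>.\<close>
    have "\<exists>d. d \<in> D" using dense[OF x, of 1] by auto
    then obtain d where d: "d \<in> D" ..
    have z: "\<zero>\<^bsub>cont_fun_ring B\<^esub> \<odot>\<^bsub>L\<^esub> d = \<zero>\<^bsub>L\<^esub>"
      using d by (simp add: M.smult_l_null D_closed)
    have 0: "\<zero>\<^bsub>L\<^esub> \<in> D"
      using D_smult[OF d M.R.zero_closed] by (simp only: z)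
    have "R \<zero>\<^bsub>L\<^esub> = \<zero>\<^bsub>Z\<^esub>"
      using R_smult[OF d M.R.zero_closed] d by (simp add: z N.smult_l_null R_closed)
    moreover have "N.nrm (S x \<ominus>\<^bsub>Z\<^esub> R \<zero>\<^bsub>L\<^esub>) \<le> K * M.nrm (x \<ominus>\<^bsub>L\<^esub> \<zero>\<^bsub>L\<^esub>)" "S x \<in> carrier Z"
      using G[OF x] 0 unfolding ext_graph_def by blast+
    ultimately show ?thesis using x by simp
  qed
  show "\<exists>S. S \<in> extensional (carrier L) \<and> S \<in> bounded_module_homs B L Z \<and> op_norm B L Z S \<le> K \<and> (\<forall>d\<in>D. S d = R d)"
    using SR op_norm_leI[OF hom K le] S_ext by blast
next
  fix S S' assume S: "S \<in> extensional (carrier L) \<and> S \<in> bounded_module_homs B L Z \<and> op_norm B L Z S \<le> K \<and> (\<forall>d\<in>D. S d = R d)"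
    and S': "S' \<in> extensional (carrier L) \<and> S' \<in> bounded_module_homs B L Z \<and> op_norm B L Z S' \<le> K \<and> (\<forall>d\<in>D. S' d = R d)"
  \<comment> \<open>Any competitor lies in the graph: apply its bound K to x - d. Uniqueness of
    graph values then identifies two competitors.\<close>
  have G: "ext_graph x (V x)" if x: "x \<in> carrier L"
    and V: "V \<in> bounded_module_homs B L Z" "op_norm B L Z V \<le> K" "\<forall>d\<in>D. V d = R d" for V x
    unfolding ext_graph_def
  proof (intro conjI ballI)
    have hom: "V \<in> module_homs B L Z" using V by (simp add: bounded_module_homs_def)
    show "V x \<in> carrier Z" using hom x by (rule module_homs_closed)
    fix d assume d: "d \<in> D"
    have "V x \<ominus>\<^bsub>Z\<^esub> R d = V (x \<ominus>\<^bsub>L\<^esub> d)"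
      using module_homs_minus[OF hom x D_closed[OF d]] V(3) d by simp
    then show "N.nrm (V x \<ominus>\<^bsub>Z\<^esub> R d) \<le> K * M.nrm (x \<ominus>\<^bsub>L\<^esub> d)"
      using op_norm_le_imp(2)[OF V(1,2), of "x \<ominus>\<^bsub>L\<^esub> d"] x d D_closed by simp
  qed
  show "S = S'"
  proof (rule extensionalityI[where A = "carrier L"])
    fix x assume x: "x \<in> carrier L"
    show "S x = S' x"
      using S S' by (intro ext_graph_unique[OF x] G[OF x]) auto
  qed (use S S' in auto)
qed

end

section \<open>A criterion for direct limits\<close>

lemma hilbert_module_pre_ip: "\<lbrakk>compact_space B; hilbert_module B M\<rbrakk> \<Longrightarrow> pre_ip B M"
  by (simp add: pre_ip_def hilbert_module_def inner_product_module_def)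

text \<open>Density of the images reduces the universal property to gluing the maps R_k on the union
  of the images and extending the result by continuity.\<close>

lemma is_direct_limitI:
  fixes B :: "'a topology" and X :: "nat \<Rightarrow> ('a \<Rightarrow> complex, 'm) ip_module"
    and L :: "('a \<Rightarrow> complex, 'l) ip_module" and P :: "nat \<Rightarrow> 'm \<Rightarrow> 'l"
  assumes cpt: "compact_space B" and sys: "direct_system B X T" and L: "hilbert_module B L"
    and P: "\<And>k. ip_preserving (X k) L (P k)"
    and PT: "\<And>k x. x \<in> carrier (X k) \<Longrightarrow> P (Suc k) (T k x) = P k x"
    and dense: "\<And>\<xi> e. \<lbrakk>\<xi> \<in> carrier L; e > 0\<rbrakk> \<Longrightarrow>
      \<exists>k. \<exists>x\<in>carrier (X k). mod_norm B L (\<xi> \<ominus>\<^bsub>L\<^esub> P k x) \<le> e"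
  shows "is_direct_limit TYPE('z) B X T L P"
  unfolding is_direct_limit_def
proof (intro conjI allI impI ballI)
  fix Z :: "('a \<Rightarrow> complex, 'z) ip_module" and R :: "nat \<Rightarrow> 'm \<Rightarrow> 'z" and K :: real
  assume *: "hilbert_module B Z \<and>
        (\<forall>k. R k \<in> bounded_module_homs B (X k) Z) \<and>
        (\<forall>k. \<forall>x\<in>carrier (X k). R (Suc k) (T k x) = R k x) \<and>
        (\<forall>k. op_norm B (X k) Z (R k) \<le> K)"
  have hX: "hilbert_module B (X k)" and T: "ip_preserving (X k) (X (Suc k)) (T k)" for k
    using sys by (auto simp: direct_system_def)
  have Z: "hilbert_module B Z" and R: "R k \<in> bounded_module_homs B (X k) Z"
    and RT: "x \<in> carrier (X k) \<Longrightarrow> R (Suc k) (T k x) = R k x"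
    and RK: "op_norm B (X k) Z (R k) \<le> K" for k x
    using * by auto
  interpret L: pre_ip B L using cpt L by (rule hilbert_module_pre_ip)
  interpret Z: pre_ip B Z using cpt Z by (rule hilbert_module_pre_ip)
  interpret X: pre_ip B "X k" for k using cpt hX by (rule hilbert_module_pre_ip)
  interpret LZ: pre_ip_pair B L Z ..
  interpret XZ: pre_ip_pair B "X k" Z for k ..
  interpret P: ip_preserving_map B "X k" L "P k" for k
    by unfold_locales (rule P)
  have Phom: "P k \<in> module_homs B (X k) L" for k
    using L by (intro P.module_hom) (simp add: hilbert_module_def)
  have Rhom: "R k \<in> module_homs B (X k) Z" for k
    using R by (simp add: bounded_module_homs_def)
  note RK' = XZ.op_norm_le_imp[OF R RK]
  have Zip: "inner_product_module B Z" using Z by (simp add: hilbert_module_def)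
  \<comment> \<open>Two vectors from different levels are compared after both have been pushed up to
    a common level by the connecting maps.\<close>
  have lift: "\<exists>x'\<in>carrier (X m). P m x' = P k x \<and> R m x' = R k x"
    if "k \<le> m" "x \<in> carrier (X k)" for k m x
    using that
  proof (induction m rule: dec_induct)
    case base
    then show ?case by blast
  next
    case (step m)
    then obtain x' where x': "x' \<in> carrier (X m)" "P m x' = P k x" "R m x' = R k x" by blast
    moreover have "T m x' \<in> carrier (X (Suc m))" using T x' by (auto simp: ip_preserving_def)
    ultimately show ?case using PT RT by metis
  qed
  define D where "D = (\<Union>k. P k ` carrier (X k))"
  \<comment> \<open>The glued map, by an arbitrary choice of level and representative.\<close>
  define R0 where "R0 d = (SOME z. \<exists>k. \<exists>x\<in>carrier (X k). d = P k x \<and> z = R k x)" for d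
  have common: "\<exists>m. \<exists>x\<in>carrier (X m). \<exists>y\<in>carrier (X m). P m x = P j a \<and> R m x = R j a \<and> P m y = P k b \<and> R m y = R k b"
    if "a \<in> carrier (X j)" "b \<in> carrier (X k)" for j k a b
    using lift[of j "max j k" a] lift[of k "max j k" b] that by (metis max.cobounded1 max.cobounded2)
  have R0: "R0 (P k x) = R k x" if x: "x \<in> carrier (X k)" for k x
  proof -
    \<comment> \<open>Independence of the choice: at a common level the two representatives differ
      by a vector of length zero, since \<open>P m\<close> preserves lengths, and the bound on
      \<open>R m\<close> forces equal values.\<close>
    have "z = R k x" if z: "\<exists>j. \<exists>y\<in>carrier (X j). P k x = P j y \<and> z = R j y" for z
    proof -
      obtain j y where y: "y \<in> carrier (X j)" "P k x = P j y" "z = R j y" using z by blast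
      obtain m x' y' where m: "x' \<in> carrier (X m)" "y' \<in> carrier (X m)"
        "P m x' = P k x" "R m x' = R k x" "P m y' = P j y" "R m y' = R j y"
        using common[OF x y(1)] by blast
      have "X.nrm m (x' \<ominus>\<^bsub>X m\<^esub> y') = L.nrm (P m x' \<ominus>\<^bsub>L\<^esub> P m y')"
        using P.nrm_T_minus[OF m(1,2)] by simp
      also have "\<dots> = 0" using m y x P.T_closed by (simp add: L.minus_self)
      finally have 0: "X.nrm m (x' \<ominus>\<^bsub>X m\<^esub> y') = 0" .
      have "R m x' = R m y'"
      proof (rule Z.eq_if_nrm_minus_le_0[OF Zip])
        show "R m x' \<in> carrier Z" "R m y' \<in> carrier Z"
          by (rule XZ.module_homs_closed[OF Rhom m(1)], rule XZ.module_homs_closed[OF Rhom m(2)])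
        show "Z.nrm (R m x' \<ominus>\<^bsub>Z\<^esub> R m y') \<le> 0"
          using RK'(2)[of "x' \<ominus>\<^bsub>X m\<^esub> y'" m] m 0 by (simp add: XZ.module_homs_minus[OF Rhom])
      qed
      then show ?thesis using m y by simp
    qed
    then show ?thesis
      unfolding R0_def using x by (intro some_equality) blast+
  qed
  have DE: "\<exists>k. \<exists>x\<in>carrier (X k). d = P k x" if "d \<in> D" for d
    using that by (auto simp: D_def)
  have DE2: "\<exists>m. \<exists>x\<in>carrier (X m). \<exists>y\<in>carrier (X m). d = P m x \<and> e = P m y" if "d \<in> D" "e \<in> D" for d e
    using DE[OF that(1)] DE[OF that(2)] common by metis
  have PD: "P k x \<in> D" if "x \<in> carrier (X k)" for k x
    using that by (auto simp: D_def)
  interpret E: dense_hom B L Z D R0 K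
  proof
    show "hilbert_module B Z" by (rule Z)
    show "D \<subseteq> carrier L" using P.T_closed by (auto simp: D_def)
    show "0 \<le> K" by (rule RK'(1))
    show "\<exists>d\<in>D. L.nrm (\<xi> \<ominus>\<^bsub>L\<^esub> d) \<le> e" if "\<xi> \<in> carrier L" "e > 0" for \<xi> e
      using dense[OF that] PD by blast
  next
    fix d assume "d \<in> D"
    then obtain k x where x: "x \<in> carrier (X k)" "d = P k x" using DE by blast
    show "R0 d \<in> carrier Z" using x by (simp add: R0 XZ.module_homs_closed[OF Rhom])
    show "Z.nrm (R0 d) \<le> K * L.nrm d" using x by (simp add: R0 P.nrm_T RK'(2))
    fix f assume f: "f \<in> L.Fun"
    have fd: "f \<odot>\<^bsub>L\<^esub> d = P k (f \<odot>\<^bsub>X k\<^esub> x)"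
      using x f by (simp add: P.module_homs_smult[OF Phom])
    have fx: "f \<odot>\<^bsub>X k\<^esub> x \<in> carrier (X k)" using x f by simp
    show "f \<odot>\<^bsub>L\<^esub> d \<in> D" unfolding fd using fx by (rule PD)
    show "R0 (f \<odot>\<^bsub>L\<^esub> d) = f \<odot>\<^bsub>Z\<^esub> R0 d"
      unfolding fd R0[OF fx] using x f by (simp add: R0 XZ.module_homs_smult[OF Rhom])
  next
    fix d e assume "d \<in> D" "e \<in> D"
    then obtain k x y where x: "x \<in> carrier (X k)" "y \<in> carrier (X k)" "d = P k x" "e = P k y"
      using DE2 by blast
    have de: "d \<oplus>\<^bsub>L\<^esub> e = P k (x \<oplus>\<^bsub>X k\<^esub> y)"
      using x by (simp add: P.module_homs_add[OF Phom])
    have xy: "x \<oplus>\<^bsub>X k\<^esub> y \<in> carrier (X k)" using x by simp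
    show "d \<oplus>\<^bsub>L\<^esub> e \<in> D" unfolding de using xy by (rule PD)
    show "R0 (d \<oplus>\<^bsub>L\<^esub> e) = R0 d \<oplus>\<^bsub>Z\<^esub> R0 e"
      unfolding de R0[OF xy] using x by (simp add: R0 XZ.module_homs_add[OF Rhom])
  qed
  have "(\<forall>d\<in>D. S d = R0 d) \<longleftrightarrow> (\<forall>k. \<forall>x\<in>carrier (X k). S (P k x) = R k x)" for S
    using R0 by (auto simp: D_def)
  then show "\<exists>!S. S \<in> extensional (carrier L) \<and> S \<in> bounded_module_homs B L Z \<and> op_norm B L Z S \<le> K \<and>
      (\<forall>k. \<forall>x\<in>carrier (X k). S (P k x) = R k x)"
    using E.unique_extension by simp
qed (use sys L P PT in auto)

section \<open>Fibre sums of local homeomorphisms\<close>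

text \<open>U is a sheet over its image. Openness of the images is recorded for all open subsets of
  U because sheets are later shrunk to become disjoint.\<close>

lemma local_homeomorphism_map_neighbourhood:
  assumes "local_homeomorphism_map X Y f" "x \<in> topspace X"
  obtains U where "openin X U" "x \<in> U" "inj_on f U" "continuous_map (subtopology X U) Y f"
    "\<And>V. \<lbrakk>openin X V; V \<subseteq> U\<rbrakk> \<Longrightarrow> openin Y (f ` V)"
proof -
  obtain U where U: "openin X U" "x \<in> U" "openin Y (f ` U)"
    and h: "homeomorphic_map (subtopology X U) (subtopology Y (f ` U)) f"
    using assms by (auto simp: local_homeomorphism_map_def)
  have "topspace (subtopology X U) = U"
    using openin_subset[OF U(1)] by auto
  then have inj: "inj_on f U"
    using homeomorphic_imp_injective_map[OF h] by simp
  have cont: "continuous_map (subtopology X U) Y f"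
    using homeomorphic_imp_continuous_map[OF h] by (simp add: continuous_map_in_subtopology)
  have "openin Y (f ` V)" if "openin X V" "V \<subseteq> U" for V
  proof -
    have "openin (subtopology X U) V"
      using that U(1) by (simp add: openin_open_subtopology)
    then have "openin (subtopology Y (f ` U)) (f ` V)"
      using homeomorphic_imp_open_map[OF h] by (auto simp: open_map_def)
    then show ?thesis using U(3) by (rule openin_trans_full)
  qed
  then show thesis using U inj cont that by blast
qed

lemma local_homeomorphism_imp_continuous_map:
  assumes lh: "local_homeomorphism_map X Y f"
  shows "continuous_map X Y f"
  unfolding continuous_map_def
proof (intro conjI allI impI)
  show "f \<in> topspace X \<rightarrow> topspace Y"
    using lh by (simp add: local_homeomorphism_map_def)
  fix V assume V: "openin Y V"
  show "openin X {x \<in> topspace X. f x \<in> V}"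
  proof (subst openin_subopen, intro ballI)
    fix x assume x: "x \<in> {x \<in> topspace X. f x \<in> V}"
    then have "x \<in> topspace X" by simp
    then obtain U where U: "openin X U" "x \<in> U" "continuous_map (subtopology X U) Y f"
      using local_homeomorphism_map_neighbourhood[OF lh] by metis
    have "openin (subtopology X U) {y \<in> topspace (subtopology X U). f y \<in> V}"
      using U(3) V by (rule openin_continuous_map_preimage)
    then have "openin X {y \<in> topspace (subtopology X U). f y \<in> V}"
      using U(1) by (rule openin_trans_full)
    then show "\<exists>T. openin X T \<and> x \<in> T \<and> T \<subseteq> {x \<in> topspace X. f x \<in> V}"
      using U x by (intro exI[of _ "{y \<in> topspace (subtopology X U). f y \<in> V}"]) auto
  qed
qed

lemma Hausdorff_space_finite_separation:
  assumes haus: "Hausdorff_space X" and F: "finite F" "F \<subseteq> topspace X"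
    and W: "\<And>d. d \<in> F \<Longrightarrow> openin X (W d) \<and> d \<in> W d"
  obtains N where "\<And>d. d \<in> F \<Longrightarrow> openin X (N d) \<and> d \<in> N d \<and> N d \<subseteq> W d"
    "\<And>d d'. \<lbrakk>d \<in> F; d' \<in> F; d \<noteq> d'\<rbrakk> \<Longrightarrow> N d \<inter> N d' = {}"
proof -
  have "\<forall>d d'. d \<in> F \<and> d' \<in> F \<and> d \<noteq> d' \<longrightarrow>
      (\<exists>U V. openin X U \<and> openin X V \<and> d \<in> U \<and> d' \<in> V \<and> disjnt U V)"
    using haus F(2) unfolding Hausdorff_space_def by blast
  then obtain U V where UV: "\<And>d d'. \<lbrakk>d \<in> F; d' \<in> F; d \<noteq> d'\<rbrakk> \<Longrightarrow>
      openin X (U d d') \<and> openin X (V d d') \<and> d \<in> U d d' \<and> d' \<in> V d d' \<and> disjnt (U d d') (V d d')"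
    by metis
  \<comment> \<open>The choices made for (d, d') and for (d', d) are unrelated, so
    \<open>N d\<close> is cut down by both; for each pair one of the two choices then separates
    \<open>N d\<close> from \<open>N d'\<close>.\<close>
  define N where "N d = \<Inter> (insert (W d) ((\<lambda>d'. U d d' \<inter> V d' d) ` (F - {d})))" for d
  show thesis
  proof (rule that[of N])
    fix d assume d: "d \<in> F"
    show "openin X (N d) \<and> d \<in> N d \<and> N d \<subseteq> W d"
      unfolding N_def using d F W UV by (intro conjI openin_Inter) auto
    fix d' assume d': "d' \<in> F" "d \<noteq> d'"
    have "N d \<subseteq> U d d'" "N d' \<subseteq> V d d'"
      using d d' by (auto simp: N_def)
    then show "N d \<inter> N d' = {}"
      using UV[OF d d'] by (auto simp: disjnt_def)
  qed
qed

section \<open>Finite fibres and continuity of sums over them\<close>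

locale finite_covering =
  fixes X :: "'a topology" and Y :: "'b topology" and f :: "'a \<Rightarrow> 'b"
  assumes compact_X: "compact_space X" and haus_X: "Hausdorff_space X" and haus_Y: "Hausdorff_space Y"
    and lh: "local_homeomorphism_map X Y f"
begin

lemma f_cont: "continuous_map X Y f"
  using lh by (rule local_homeomorphism_imp_continuous_map)

text \<open>The fibre is closed, hence compact, and each sheet meets it in at most one point. A
  finite subcover by sheets centred at fibre points therefore already contains every fibre point
  among its centres.\<close>

lemma finite_fibre: "finite {d \<in> topspace X. f d = c}"
proof (cases "c \<in> topspace Y")
  case True
  define F where "F = {d \<in> topspace X. f d = c}"
  have "closedin X {d \<in> topspace X. f d \<in> {c}}"
    using f_cont True haus_Y by (intro closedin_continuous_map_preimage) (auto simp: closedin_Hausdorff_sing_eq)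
  then have "closedin X F" by (simp add: F_def)
  then have cF: "compactin X F" by (rule closedin_compact_space[OF compact_X])
  have "\<exists>U. openin X U \<and> d \<in> U \<and> inj_on f U" if "d \<in> topspace X" for d
    using local_homeomorphism_map_neighbourhood[OF lh that] by metis
  then obtain U where U: "\<And>d. d \<in> topspace X \<Longrightarrow> openin X (U d) \<and> d \<in> U d \<and> inj_on f (U d)"
    by metis
  have FX: "F \<subseteq> topspace X" by (auto simp: F_def)
  have "\<forall>V\<in>U ` F. openin X V" "F \<subseteq> \<Union> (U ` F)" using U FX by blast+
  then obtain \<F> where "finite \<F>" "\<F> \<subseteq> U ` F" "F \<subseteq> \<Union> \<F>"
    using cF unfolding compactin_def by meson
  then obtain G where G: "finite G" "G \<subseteq> F" "F \<subseteq> \<Union> (U ` G)"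
    by (metis finite_subset_image)
  have "F \<subseteq> G"
  proof
    fix x assume x: "x \<in> F"
    then obtain d where d: "d \<in> G" "x \<in> U d" using G by blast
    then have "d \<in> F" using G by blast
    have "inj_on f (U d)" "d \<in> U d" using U FX \<open>d \<in> F\<close> by auto
    moreover have "f x = f d" using x \<open>d \<in> F\<close> by (simp add: F_def)
    ultimately show "x \<in> G" using d by (auto dest: inj_onD)
  qed
  then show ?thesis using G(1) finite_subset F_def by blast
next
  case False
  have "{d \<in> topspace X. f d = c} = {}"
    using False f_cont by (auto simp: continuous_map_def)
  then show ?thesis by (simp only: finite.emptyI)
qed

text \<open>
  Near a point \<open>c\<^sub>0\<close> the fibres consist of exactly one point in each member of a disjoint family of
  neighbourhoods of the points over \<open>c\<^sub>0\<close>; compactness excludes further points.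
\<close>

lemma continuous_map_fibre_sum:
  fixes g :: "'a \<Rightarrow> complex"
  assumes g: "continuous_map X euclidean g"
  shows "continuous_map Y euclidean (\<lambda>c. \<Sum>d | d \<in> topspace X \<and> f d = c. g d)" (is "continuous_map _ _ ?S")
proof -
  have "(?S \<longlongrightarrow> ?S c0) (atin Y c0)" if c0: "c0 \<in> topspace Y" for c0
  proof (rule tendstoI)
    fix e :: real assume e: "e > 0"
    define F where "F = {d \<in> topspace X. f d = c0}"
    have fin: "finite F" unfolding F_def by (rule finite_fibre)
    \<comment> \<open>The error will be at most \<open>card F\<close> times e'; the added 1 makes
      this strictly less than e and covers the empty fibre.\<close>
    define e' where "e' = e / (real (card F) + 1)"
    have e': "e' > 0" using e by (simp add: e'_def)
    have "\<exists>W. openin X W \<and> d \<in> W \<and> inj_on f W \<and> (\<forall>V. openin X V \<and> V \<subseteq> W \<longrightarrow> openin Y (f ` V))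
        \<and> (\<forall>x\<in>W. dist (g x) (g d) < e')" if d: "d \<in> F" for d
    proof -
      have dX: "d \<in> topspace X" using d by (simp add: F_def)
      obtain U where U: "openin X U" "d \<in> U" "inj_on f U"
        "\<And>V. \<lbrakk>openin X V; V \<subseteq> U\<rbrakk> \<Longrightarrow> openin Y (f ` V)"
        using local_homeomorphism_map_neighbourhood[OF lh dX] by metis
      have o: "openin X {x \<in> topspace X. g x \<in> ball (g d) e'}"
        using g by (rule openin_continuous_map_preimage) simp
      show ?thesis
      proof (intro exI[of _ "U \<inter> {x \<in> topspace X. g x \<in> ball (g d) e'}"] conjI allI impI ballI)
        show "openin X (U \<inter> {x \<in> topspace X. g x \<in> ball (g d) e'})" using U(1) o by (rule openin_Int)
        show "inj_on f (U \<inter> {x \<in> topspace X. g x \<in> ball (g d) e'})"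
          using U(3) by (rule inj_on_subset) auto
      qed (use U dX e' in \<open>auto simp: dist_commute\<close>)
    qed
    then obtain W where W: "\<And>d. d \<in> F \<Longrightarrow> openin X (W d) \<and> d \<in> W d \<and> inj_on f (W d) \<and>
        (\<forall>V. openin X V \<and> V \<subseteq> W d \<longrightarrow> openin Y (f ` V)) \<and> (\<forall>x\<in>W d. dist (g x) (g d) < e')"
      by metis
    have FX: "F \<subseteq> topspace X" by (auto simp: F_def)
    obtain N where N: "\<And>d. d \<in> F \<Longrightarrow> openin X (N d) \<and> d \<in> N d \<and> N d \<subseteq> W d"
      and disj: "\<And>d d'. \<lbrakk>d \<in> F; d' \<in> F; d \<noteq> d'\<rbrakk> \<Longrightarrow> N d \<inter> N d' = {}"
      using Hausdorff_space_finite_separation[OF haus_X fin FX, of W] W by metis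
    \<comment> \<open>The part of X outside the sheets. Its image is closed, as f is a closed map by
      compactness, and misses c0.\<close>
    define R where "R = topspace X - \<Union> (N ` F)"
    have "closedin X R"
      unfolding R_def using N by (intro closedin_diff openin_Union) auto
    then have fR: "closedin Y (f ` R)"
      using continuous_imp_closed_map[OF f_cont compact_X haus_Y] by (auto simp: closed_map_def)
    \<comment> \<open>Membership in each \<open>f\<close> N
      d\<open>provides a fibre point in every sheet, and avoiding\<close>f \<open>R\<close> excludes
      further ones. The inserted complement also keeps the intersection inside Y when the fibre is
      empty.\<close>
    define V where "V = \<Inter> (insert (topspace Y - f ` R) ((\<lambda>d. f ` N d) ` F))"
    have V: "openin Y V"
      unfolding V_def
    proof (rule openin_Inter)
      show "openin Y A" if "A \<in> insert (topspace Y - f ` R) ((\<lambda>d. f ` N d) ` F)" for A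
        using that fR N W by (auto intro!: openin_diff)
    qed (use fin in auto)
    have "c0 \<notin> f ` R"
      using N by (auto simp: R_def F_def)
    then have c0V: "c0 \<in> V"
      using c0 N by (auto simp: V_def F_def)
    have "dist (?S c) (?S c0) < e" if c: "c \<in> V" for c
    proof -
      have "\<exists>x. x \<in> N d \<and> f x = c" if "d \<in> F" for d
        using c that by (auto simp: V_def)
      then obtain s where s: "\<And>d. d \<in> F \<Longrightarrow> s d \<in> N d \<and> f (s d) = c" by metis
      have NX: "N d \<subseteq> topspace X" if "d \<in> F" for d
        using N[OF that] by (simp add: openin_subset)
      \<comment> \<open>Each sheet contains exactly one point over c, so the fibre over c is indexed
        by the fibre over c0 and the two sums are compared term by term.\<close>
      have "bij_betw s F {d \<in> topspace X. f d = c}"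
        unfolding bij_betw_def
      proof
        show "inj_on s F"
          using s disj by (intro inj_onI) (metis disjoint_iff)
        show "s ` F = {d \<in> topspace X. f d = c}"
        proof (intro equalityI subsetI)
          fix x assume "x \<in> s ` F"
          then show "x \<in> {d \<in> topspace X. f d = c}" using s NX by auto
        next
          fix x assume x: "x \<in> {d \<in> topspace X. f d = c}"
          have "c \<notin> f ` R" using c by (auto simp: V_def)
          then have "x \<notin> R" using x by auto
          then obtain d where d: "d \<in> F" "x \<in> N d" using x by (auto simp: R_def)
          have "x = s d"
            using W[OF d(1)] N[OF d(1)] s[OF d(1)] d x by (auto dest: inj_onD)
          then show "x \<in> s ` F" using d by simp
        qed
      qed
      then have "?S c = (\<Sum>d\<in>F. g (s d))"
        by (rule sum.reindex_bij_betw[symmetric])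
      moreover have "?S c0 = (\<Sum>d\<in>F. g d)" by (simp add: F_def)
      ultimately have "dist (?S c) (?S c0) = norm (\<Sum>d\<in>F. g (s d) - g d)"
        by (simp add: dist_norm sum_subtractf)
      also have "\<dots> \<le> (\<Sum>d\<in>F. e')"
      proof (rule sum_norm_le)
        fix d assume d: "d \<in> F"
        then have "s d \<in> W d" using s N by blast
        then show "norm (g (s d) - g d) \<le> e'" using W[OF d] by (auto simp: dist_norm less_imp_le)
      qed
      also have "\<dots> = real (card F) * e'" by simp
      also have "\<dots> < e" using e by (simp add: e'_def field_simps)
      finally show ?thesis .
    qed
    then show "eventually (\<lambda>c. dist (?S c) (?S c0) < e) (atin Y c0)"
      using V c0V by (auto simp: eventually_atin)
  qed
  then show ?thesis by (simp add: continuous_map_atin)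
qed

end

text \<open>Common form of both modules: the inner product at c is a positive functional I_c applied
  to conj x times y, namely a weighted fibre sum or an integral. The multiplicative assumption says
  that I_c lives on the fibre of p over c, where f o p is the constant f(c).\<close>

lemma pre_inner_product_module_of_functional:
  fixes M :: "('b \<Rightarrow> complex, 'a \<Rightarrow> complex) ip_module" and I :: "'b \<Rightarrow> ('a \<Rightarrow> complex) \<Rightarrow> complex"
  assumes p: "continuous_map Y B p"
    and M: "carrier M = carrier (cont_fun_ring Y)" "zero M = zero (cont_fun_ring Y)"
      "add M = add (cont_fun_ring Y)" "smult M = (\<lambda>f x. \<lambda>d\<in>topspace Y. x d * f (p d))"
      "ip M = (\<lambda>x y. \<lambda>c\<in>topspace B. I c (\<lambda>d. cnj (x d) * y d))"
    and I_cong: "\<And>c u v. \<lbrakk>c \<in> topspace B; \<And>d. d \<in> topspace Y \<Longrightarrow> u d = v d\<rbrakk> \<Longrightarrow> I c u = I c v"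
    and I_cont: "\<And>u. continuous_map Y euclidean u \<Longrightarrow> continuous_map B euclidean (\<lambda>c. I c u)"
    and I_add: "\<And>c u v. \<lbrakk>c \<in> topspace B; continuous_map Y euclidean u; continuous_map Y euclidean v\<rbrakk>
      \<Longrightarrow> I c (\<lambda>d. u d + v d) = I c u + I c v"
    and I_mult: "\<And>c u f. \<lbrakk>c \<in> topspace B; continuous_map Y euclidean u\<rbrakk>
      \<Longrightarrow> I c (\<lambda>d. u d * f (p d)) = I c u * f c"
    and I_cnj: "\<And>c u. c \<in> topspace B \<Longrightarrow> I c (\<lambda>d. cnj (u d)) = cnj (I c u)"
    and I_pos: "\<And>c u. \<lbrakk>c \<in> topspace B; continuous_map Y euclidean u; \<And>d. 0 \<le> u d\<rbrakk>
      \<Longrightarrow> I c (\<lambda>d. complex_of_real (u d)) \<in> \<real>\<^sub>\<ge>\<^sub>0"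
  shows "pre_inner_product_module B M"
  unfolding pre_inner_product_module_def
proof (intro conjI ballI)
  have pY: "d \<in> topspace Y \<Longrightarrow> p d \<in> topspace B" for d
    using p by (auto simp: continuous_map_def)
  note ring = cont_fun_ring_simps mem_cont_fun_ring
  interpret Y: cring "cont_fun_ring Y" by (rule cring_cont_fun_ring)
  show "Module.module (cont_fun_ring B) M"
  proof (rule moduleI)
    show "abelian_group M"
    proof (rule abelian_groupI)
      fix x assume x: "x \<in> carrier M"
      then show "\<exists>y\<in>carrier M. y \<oplus>\<^bsub>M\<^esub> x = \<zero>\<^bsub>M\<^esub>"
        by (intro bexI[of _ "\<ominus>\<^bsub>cont_fun_ring Y\<^esub> x"]) (simp_all only: M Y.l_neg Y.a_inv_closed)
    qed (simp_all only: M Y.a_closed Y.zero_closed Y.a_ac Y.l_zero Y.r_zero)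
    have sm: "continuous_map Y euclidean (\<lambda>d. x d * f (p d))"
      if "continuous_map Y euclidean x" "continuous_map B euclidean f" for x :: "'a \<Rightarrow> complex" and f :: "'b \<Rightarrow> complex"
      using that continuous_map_compose[OF p that(2)] by (intro continuous_map_complex_mult) (simp_all add: o_def)
    fix f x assume "f \<in> carrier (cont_fun_ring B)" "x \<in> carrier M"
    then show "f \<odot>\<^bsub>M\<^esub> x \<in> carrier M"
      by (simp add: M ring sm)
  qed (auto simp: M ring pY algebra_simps extensional_def intro!: cring_cont_fun_ring cong: restrict_cong)
  fix x assume x: "x \<in> carrier M"
  show "ip M x x c \<in> \<real>\<^sub>\<ge>\<^sub>0" if c: "c \<in> topspace B" for c
  proof -
    have "continuous_map Y euclidean (\<lambda>d. (cmod (x d))\<^sup>2)"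
      using x unfolding power2_eq_square by (intro continuous_map_real_mult continuous_map_norm) (auto simp: M ring)
    then have "I c (\<lambda>d. complex_of_real ((cmod (x d))\<^sup>2)) \<in> \<real>\<^sub>\<ge>\<^sub>0"
      using c by (intro I_pos) auto
    also have "(\<lambda>d. complex_of_real ((cmod (x d))\<^sup>2)) = (\<lambda>d. cnj (x d) * x d)"
      by (simp add: complex_norm_square mult.commute fun_eq_iff del: of_real_power)
    finally show ?thesis using c by (simp add: M)
  qed
  fix y assume y: "y \<in> carrier M"
  have xy: "continuous_map Y euclidean (\<lambda>d. cnj (x d) * y d)"
    using x y by (intro continuous_map_complex_mult continuous_map_cnj) (auto simp: M ring)
  show "ip M x y \<in> carrier (cont_fun_ring B)"
    using I_cont[OF xy] by (simp add: M ring)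
  show "ip M y x c = cnj (ip M x y c)" if c: "c \<in> topspace B" for c
    using c by (simp add: M I_cnj[symmetric] mult.commute)
  show "ip M x (f \<odot>\<^bsub>M\<^esub> y) = ip M x y \<otimes>\<^bsub>cont_fun_ring B\<^esub> f" for f
  proof -
    have "I c (\<lambda>d. cnj (x d) * (f \<odot>\<^bsub>M\<^esub> y) d) = I c (\<lambda>d. cnj (x d) * y d) * f c" if c: "c \<in> topspace B" for c
      unfolding I_mult[OF c xy, symmetric] using c by (intro I_cong) (auto simp: M)
    then show ?thesis by (simp add: M ring cong: restrict_cong)
  qed
  fix z assume z: "z \<in> carrier M"
  have xz: "continuous_map Y euclidean (\<lambda>d. cnj (x d) * z d)"
    using x z by (intro continuous_map_complex_mult continuous_map_cnj) (auto simp: M ring)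
  have "I c (\<lambda>d. cnj (x d) * (y \<oplus>\<^bsub>M\<^esub> z) d) = I c (\<lambda>d. cnj (x d) * y d) + I c (\<lambda>d. cnj (x d) * z d)"
    if c: "c \<in> topspace B" for c
    unfolding I_add[OF c xy xz, symmetric] using c by (intro I_cong) (auto simp: M ring algebra_simps)
  then show "ip M x (y \<oplus>\<^bsub>M\<^esub> z) = ip M x y \<oplus>\<^bsub>cont_fun_ring B\<^esub> ip M x z"
    by (simp add: M ring cong: restrict_cong)
qed

section \<open>Inverse limits\<close>

locale inverse_system =
  fixes C :: "nat \<Rightarrow> 'a topology" and r :: "nat \<Rightarrow> 'a \<Rightarrow> 'a"
  assumes compact_C: "\<And>k. compact_space (C k)"
    and haus_C: "\<And>k. Hausdorff_space (C k)"
    and lh_r: "\<And>k. local_homeomorphism_map (C (Suc k)) (C k) (r k)"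
begin

lemma cov: "finite_covering (C (Suc k)) (C k) (r k)"
  by (simp add: finite_covering_def compact_C haus_C lh_r)

lemma r_cont: "continuous_map (C (Suc k)) (C k) (r k)"
  by (rule finite_covering.f_cont[OF cov])

lemma r_closed: "d \<in> topspace (C (Suc k)) \<Longrightarrow> r k d \<in> topspace (C k)"
  using r_cont[of k] by (auto simp: continuous_map_def)

lemma down_cont: "continuous_map (C k) (C 0) (down r k)"
proof (induction k)
  case (Suc k)
  show ?case unfolding down.simps by (rule continuous_map_compose[OF r_cont Suc])
qed simp

lemma down_closed: "d \<in> topspace (C k) \<Longrightarrow> down r k d \<in> topspace (C 0)"
  using down_cont[of k] by (auto simp: continuous_map_def)

lemma fibre_0: "c \<in> topspace (C 0) \<Longrightarrow> fibre C r 0 c = {c}"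
  by (auto simp: fibre_def)

lemma fibre_Suc: "fibre C r (Suc k) c = (\<Union>e\<in>fibre C r k c. {d \<in> topspace (C (Suc k)). r k d = e})"
  by (auto simp: fibre_def r_closed)

lemma finite_fibre: "finite (fibre C r k c)"
proof (induction k)
  case 0
  have "fibre C r 0 c \<subseteq> {c}" by (auto simp: fibre_def)
  then show ?case by (rule finite_subset) simp
next
  case (Suc k)
  then show ?case
    unfolding fibre_Suc using finite_covering.finite_fibre[OF cov] by blast
qed

lemma sum_fibre_Suc:
  fixes g :: "'a \<Rightarrow> complex"
  shows "(\<Sum>d\<in>fibre C r (Suc k) c. g d) = (\<Sum>e\<in>fibre C r k c. \<Sum>d | d \<in> topspace (C (Suc k)) \<and> r k d = e. g d)"
  unfolding fibre_Suc
  by (rule sum.UNION_disjoint) (auto simp: finite_fibre finite_covering.finite_fibre[OF cov])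

text \<open>The fibre is summed one level at a time; \<open>g\<close> is generalised in the
  induction because the inner sum over r_k is the integrand at the next lower level.\<close>

lemma continuous_map_sum_fibre:
  fixes g :: "'a \<Rightarrow> complex"
  assumes "continuous_map (C k) euclidean g"
  shows "continuous_map (C 0) euclidean (\<lambda>c. \<Sum>d\<in>fibre C r k c. g d)"
  using assms
proof (induction k arbitrary: g)
  case 0
  then show ?case
    by (rule continuous_map_eq) (simp add: fibre_0)
next
  case (Suc k)
  show ?case
    unfolding sum_fibre_Suc
    by (rule Suc.IH, rule finite_covering.continuous_map_fibre_sum[OF cov Suc.prems])
qed

section \<open>The topology of the inverse limit\<close>

abbreviation Lim :: "(nat \<Rightarrow> 'a) topology" where "Lim \<equiv> inverse_limit C r"

lemma topspace_Lim: "topspace Lim = {d. (\<forall>k. d k \<in> topspace (C k)) \<and> (\<forall>k. r k (d (Suc k)) = d k)}"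
  by (auto simp: inverse_limit_def)

lemma Lim_mem: "d \<in> topspace Lim \<Longrightarrow> d k \<in> topspace (C k)"
  by (simp add: topspace_Lim)

lemma Lim_r: "d \<in> topspace Lim \<Longrightarrow> r k (d (Suc k)) = d k"
  by (simp add: topspace_Lim)

lemma proj_cont: "continuous_map Lim (C k) (\<lambda>d. d k)"
  unfolding inverse_limit_def
  by (intro continuous_map_from_subtopology continuous_map_product_projection) simp

text \<open>Each coherence condition is the equaliser of two continuous maps into a Hausdorff space,
  so the limit is a closed subspace of a compact product.\<close>

lemma compact_Lim: "compact_space Lim"
proof -
  let ?P = "product_topology C UNIV"
  have P: "compact_space ?P" by (simp add: compact_space_product_topology compact_C)
  have proj: "continuous_map ?P (C k) (\<lambda>d. d k)" for k
    by (rule continuous_map_product_projection) simp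
  have "closedin ?P {d \<in> topspace ?P. r k (d (Suc k)) = d k}" for k
    using closedin_continuous_maps_eq[OF haus_C continuous_map_compose[OF proj r_cont] proj]
    by (simp add: o_def)
  then have "closedin ?P (\<Inter>k. {d \<in> topspace ?P. r k (d (Suc k)) = d k})"
    by (intro closedin_INT) auto
  then have "compact_space (subtopology ?P (\<Inter>k. {d \<in> topspace ?P. r k (d (Suc k)) = d k}))"
    by (intro compact_space_subtopology closedin_compact_space P)
  moreover have "(\<Inter>k. {d \<in> topspace ?P. r k (d (Suc k)) = d k}) = topspace ?P \<inter> {d. \<forall>k. r k (d (Suc k)) = d k}"
    by auto
  ultimately show ?thesis
    by (simp only: subtopology_restrict inverse_limit_def)
qed

text \<open>The map is the composite of r_j, ..., r_(k-1). Only its continuity and its effect on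
  threads are needed, so it is left existential.\<close>

lemma transition:
  assumes "j \<le> k"
  shows "\<exists>\<rho>. continuous_map (C k) (C j) \<rho> \<and> (\<forall>d\<in>topspace Lim. \<rho> (d k) = d j)"
  using assms
proof (induction k rule: dec_induct)
  case base
  show ?case by (intro exI[of _ "\<lambda>x. x"]) simp
next
  case (step k)
  then obtain \<rho> where \<rho>: "continuous_map (C k) (C j) \<rho>" "\<And>d. d \<in> topspace Lim \<Longrightarrow> \<rho> (d k) = d j" by blast
  then show ?case
    using continuous_map_compose[OF r_cont \<rho>(1)]
    by (intro exI[of _ "\<rho> \<circ> r k"]) (auto simp: Lim_r o_def)
qed

text \<open>A basic open set of the product restricts finitely many coordinates. On threads all of
  them are determined by one coordinate of large index, so the restrictions pull back to a single
  open set there.\<close>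

lemma Lim_base:
  assumes U: "openin Lim U" and p: "p \<in> U"
  obtains k V where "openin (C k) V" "p k \<in> V" "\<And>d. \<lbrakk>d \<in> topspace Lim; d k \<in> V\<rbrakk> \<Longrightarrow> d \<in> U"
proof -
  let ?P = "product_topology C UNIV"
  have pL: "p \<in> topspace Lim" using openin_subset[OF U] p by blast
  obtain U' where U': "openin ?P U'" "U = U' \<inter> {d. \<forall>k. r k (d (Suc k)) = d k}"
    using U by (auto simp: inverse_limit_def openin_subtopology)
  obtain W where W: "finite {i. W i \<noteq> topspace (C i)}" "\<And>i. openin (C i) (W i)"
    "p \<in> Pi\<^sub>E UNIV W" "Pi\<^sub>E UNIV W \<subseteq> U'"
  proof -
    have "p \<in> U'" using p U'(2) by blast
    with U'(1) have "\<exists>W. finite {i \<in> UNIV. W i \<noteq> topspace (C i)} \<and> (\<forall>i\<in>UNIV. openin (C i) (W i)) \<and>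
        p \<in> Pi\<^sub>E UNIV W \<and> Pi\<^sub>E UNIV W \<subseteq> U'"
      unfolding openin_product_topology_alt by (rule bspec)
    then show ?thesis using that by auto
  qed
  define J where "J = {i. W i \<noteq> topspace (C i)}"
  have "\<exists>k. \<forall>j\<in>J. j \<le> k"
    using W(1) unfolding J_def by (simp only: finite_nat_set_iff_bounded_le)
  then obtain k where k: "\<And>j. j \<in> J \<Longrightarrow> j \<le> k" by blast
  obtain \<rho> where \<rho>: "\<And>j. j \<in> J \<Longrightarrow> continuous_map (C k) (C j) (\<rho> j) \<and> (\<forall>d\<in>topspace Lim. \<rho> j (d k) = d j)"
    using transition[OF k] by metis
  define V where "V = \<Inter> (insert (topspace (C k)) ((\<lambda>j. {e \<in> topspace (C k). \<rho> j e \<in> W j}) ` J))"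
  show thesis
  proof (rule that[of k V])
    show "openin (C k) V"
      unfolding V_def
    proof (rule openin_Inter)
      fix A assume "A \<in> insert (topspace (C k)) ((\<lambda>j. {e \<in> topspace (C k). \<rho> j e \<in> W j}) ` J)"
      then show "openin (C k) A"
        using \<rho> W(2) by (auto intro: openin_continuous_map_preimage)
    qed (use W(1) in \<open>auto simp: J_def\<close>)
    show "p k \<in> V"
      using \<rho> pL W(3) by (auto simp: V_def Lim_mem)
    fix d assume d: "d \<in> topspace Lim" "d k \<in> V"
    have "d i \<in> W i" for i
    proof (cases "i \<in> J")
      case True
      then show ?thesis using d \<rho> by (auto simp: V_def)
    next
      case False
      then show ?thesis using Lim_mem[OF d(1)] by (simp add: J_def)
    qed
    then have "d \<in> U'" using W(4) by auto
    then show "d \<in> U" using d(1) by (simp add: U'(2) topspace_Lim)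
  qed
qed

lemma Urysohn_point:
  assumes "openin (C k) V" "a \<in> V"
  obtains f :: "'a \<Rightarrow> real" where "continuous_map (C k) euclideanreal f" "f a = 1"
    "\<And>e. e \<in> topspace (C k) \<Longrightarrow> 0 \<le> f e" "\<And>e. \<lbrakk>e \<in> topspace (C k); e \<notin> V\<rbrakk> \<Longrightarrow> f e = 0"
proof -
  have aC: "a \<in> topspace (C k)" using openin_subset assms by blast
  have "normal_space (C k)"
    using compact_Hausdorff_or_regular_imp_normal_space compact_C haus_C by blast
  moreover have "closedin (C k) (topspace (C k) - V)" "closedin (C k) {a}"
    using assms aC haus_C by (auto simp: closedin_Hausdorff_sing_eq)
  moreover have "disjnt (topspace (C k) - V) {a}" using assms by (simp add: disjnt_def)
  ultimately obtain f :: "'a \<Rightarrow> real" where f: "continuous_map (C k) (top_of_set {0..1}) f"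
    "f ` (topspace (C k) - V) \<subseteq> {0}" "f ` {a} \<subseteq> {1}"
    using Urysohn_lemma[of "C k" "topspace (C k) - V" "{a}" 0 1] zero_le_one by blast
  then show thesis
    by (intro that[of f]) (auto simp: continuous_map_in_subtopology)
qed

text \<open>
  Stone-Weierstrass is replaced by a partition of unity on some \<open>C N\<close>.  Its denominator is truncated
  at \<open>1/2\<close> since it is only controlled on the image of the limit.
\<close>

lemma Lim_approx:
  fixes x :: "(nat \<Rightarrow> 'a) \<Rightarrow> complex"
  assumes x: "continuous_map Lim euclidean x" and e: "e > 0"
  obtains N y where "continuous_map (C N) euclidean y" "\<And>d. d \<in> topspace Lim \<Longrightarrow> cmod (x d - y (d N)) \<le> e"
proof -
  \<comment> \<open>A bump at p living on one level: on the limit it is nonzero only where x differs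
    from x(p) by less than e.\<close>
  have "\<exists>k f. continuous_map (C k) euclideanreal f \<and> f (p k) = 1 \<and>
      (\<forall>d\<in>topspace Lim. 0 \<le> f (d k) \<and> (f (d k) \<noteq> 0 \<longrightarrow> cmod (x d - x p) < e))"
    if p: "p \<in> topspace Lim" for p
  proof -
    define U where "U = {d \<in> topspace Lim. x d \<in> ball (x p) e}"
    have oU: "openin Lim U"
      unfolding U_def using x by (rule openin_continuous_map_preimage) simp
    have pU: "p \<in> U" using p e by (simp add: U_def)
    have "\<exists>k V. openin (C k) V \<and> p k \<in> V \<and> (\<forall>d\<in>topspace Lim. d k \<in> V \<longrightarrow> d \<in> U)"
      by (rule Lim_base[OF oU pU]) blast
    then obtain k V where V: "openin (C k) V" "p k \<in> V"
      "\<And>d. \<lbrakk>d \<in> topspace Lim; d k \<in> V\<rbrakk> \<Longrightarrow> d \<in> U"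
      by blast
    have "\<exists>f. continuous_map (C k) euclideanreal f \<and> f (p k) = 1 \<and>
        (\<forall>a\<in>topspace (C k). 0 \<le> f a \<and> (a \<notin> V \<longrightarrow> f a = 0))"
      by (rule Urysohn_point[OF V(1,2)]) blast
    then obtain f where f: "continuous_map (C k) euclideanreal f" "f (p k) = 1"
      "\<And>a. a \<in> topspace (C k) \<Longrightarrow> 0 \<le> f a" "\<And>a. \<lbrakk>a \<in> topspace (C k); a \<notin> V\<rbrakk> \<Longrightarrow> f a = 0"
      by blast
    have "cmod (x d - x p) < e" if "d \<in> topspace Lim" "f (d k) \<noteq> 0" for d
      using V(3)[OF that(1)] f(4)[of "d k"] that Lim_mem by (auto simp: U_def dist_norm norm_minus_commute)
    then show ?thesis
      using f by (intro exI[of _ k] exI[of _ f]) (auto simp: Lim_mem)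
  qed
  then obtain \<kappa> \<phi> where \<phi>: "\<And>p. p \<in> topspace Lim \<Longrightarrow> continuous_map (C (\<kappa> p)) euclideanreal (\<phi> p) \<and> \<phi> p (p (\<kappa> p)) = 1 \<and>
      (\<forall>d\<in>topspace Lim. 0 \<le> \<phi> p (d (\<kappa> p)) \<and> (\<phi> p (d (\<kappa> p)) \<noteq> 0 \<longrightarrow> cmod (x d - x p) < e))"
    by metis
  \<comment> \<open>The threshold 1/2 is the one at which the denominator \<open>S\<close> is
    truncated; a finite cover by these sets ensures that truncation is inactive on the
    limit.\<close>
  define W where "W p = {d \<in> topspace Lim. \<phi> p (d (\<kappa> p)) \<in> {1/2<..}}" for p
  have oW: "openin Lim (W p)" if "p \<in> topspace Lim" for p
    unfolding W_def
    using continuous_map_compose[OF proj_cont[of "\<kappa> p"], of euclideanreal "\<phi> p"] \<phi>[OF that]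
    by (intro openin_continuous_map_preimage[where Y = euclideanreal]) (auto simp: o_def)
  have "p \<in> W p" if "p \<in> topspace Lim" for p
    using \<phi>[OF that] that by (simp add: W_def)
  then have "topspace Lim \<subseteq> \<Union> (W ` topspace Lim)" by blast
  moreover have "\<forall>U\<in>W ` topspace Lim. openin Lim U" using oW by blast
  ultimately obtain \<F> where "finite \<F>" "\<F> \<subseteq> W ` topspace Lim" "topspace Lim \<subseteq> \<Union> \<F>"
    using compact_Lim unfolding compact_space_alt by meson
  then obtain Q where Q: "finite Q" "Q \<subseteq> topspace Lim" "topspace Lim \<subseteq> \<Union> (W ` Q)"
    by (metis finite_subset_image)
  have "finite (\<kappa> ` Q)" using Q(1) by simp
  then have "\<exists>N. \<forall>j\<in>\<kappa> ` Q. j \<le> N"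
    by (simp only: finite_nat_set_iff_bounded_le)
  then obtain N where N: "\<And>p. p \<in> Q \<Longrightarrow> \<kappa> p \<le> N" by blast
  have "\<exists>\<rho>. continuous_map (C N) (C (\<kappa> p)) \<rho> \<and> (\<forall>d\<in>topspace Lim. \<rho> (d N) = d (\<kappa> p))" if "p \<in> Q" for p
    using transition[OF N[OF that]] .
  then obtain \<rho> where \<rho>: "\<And>p. p \<in> Q \<Longrightarrow> continuous_map (C N) (C (\<kappa> p)) (\<rho> p) \<and> (\<forall>d\<in>topspace Lim. \<rho> p (d N) = d (\<kappa> p))"
    by metis
  \<comment> \<open>The maps \<open>\<rho> p\<close> bring all bumps to the common level N.\<close>
  define G where "G p a = \<phi> p (\<rho> p a)" for p a
  define S where "S a = max (1/2) (\<Sum>p\<in>Q. G p a)" for a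
  define y where "y a = (\<Sum>p\<in>Q. x p * complex_of_real (G p a / S a))" for a
  have Gc: "continuous_map (C N) euclideanreal (G p)" if "p \<in> Q" for p
    unfolding G_def
    using continuous_map_compose[of "C N" "C (\<kappa> p)" "\<rho> p" euclideanreal "\<phi> p"] \<rho>[OF that] \<phi> Q that
    by (auto simp: o_def)
  have Sc: "continuous_map (C N) euclideanreal S"
    unfolding S_def using Q(1) Gc
    by (intro continuous_map_real_max continuous_map_sum) auto
  have S0: "S a \<noteq> 0" for a by (simp add: S_def max_def)
  have "continuous_map (C N) euclidean y"
    unfolding y_def
    using Q(1) Gc Sc S0
    by (intro continuous_map_sum continuous_map_complex_mult continuous_map_complex_of_real continuous_map_real_divide) auto
  moreover have "cmod (x d - y (d N)) \<le> e" if d: "d \<in> topspace Lim" for d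
  proof -
    have G: "0 \<le> G p (d N)" "G p (d N) \<noteq> 0 \<Longrightarrow> cmod (x d - x p) < e" if "p \<in> Q" for p
      using \<phi>[of p] \<rho>[OF that] Q(2) d that by (auto simp: G_def)
    obtain q where q: "q \<in> Q" "d \<in> W q" using Q(3) d by blast
    have "1/2 < G q (d N)" using q \<rho>[OF q(1)] d by (simp add: W_def G_def)
    also have "\<dots> \<le> (\<Sum>p\<in>Q. G p (d N))"
      using Q(1) q(1) G(1) by (intro member_le_sum) auto
    finally have S: "S (d N) = (\<Sum>p\<in>Q. G p (d N))" "S (d N) > 0" by (auto simp: S_def)
    define \<theta> where "\<theta> p = G p (d N) / S (d N)" for p
    have \<theta>1: "(\<Sum>p\<in>Q. \<theta> p) = 1"
      using S by (simp add: \<theta>_def sum_divide_distrib[symmetric])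
    \<comment> \<open>The weights \<open>\<theta> p\<close> are nonnegative and sum to 1, so the
      error is a convex combination of x(d) - x(p), and only terms with small difference have
      nonzero weight.\<close>
    have "x d - y (d N) = (\<Sum>p\<in>Q. (x d - x p) * complex_of_real (\<theta> p))"
    proof -
      have "(\<Sum>p\<in>Q. x d * complex_of_real (\<theta> p)) = x d"
        unfolding sum_distrib_left[symmetric] of_real_sum[symmetric] \<theta>1 by simp
      moreover have "y (d N) = (\<Sum>p\<in>Q. x p * complex_of_real (\<theta> p))"
        by (simp only: y_def \<theta>_def)
      ultimately show ?thesis
        by (simp add: left_diff_distrib sum_subtractf)
    qed
    also have "cmod \<dots> \<le> (\<Sum>p\<in>Q. e * \<theta> p)"
    proof (rule sum_norm_le)
      fix p assume p: "p \<in> Q"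
      have "0 \<le> \<theta> p" using G(1)[OF p] S(2) by (simp add: \<theta>_def)
      moreover have "cmod (x d - x p) \<le> e" if "\<theta> p \<noteq> 0"
        using G(2)[OF p] that by (auto simp: \<theta>_def)
      ultimately show "cmod ((x d - x p) * complex_of_real (\<theta> p)) \<le> e * \<theta> p"
        by (cases "\<theta> p = 0") (auto simp: norm_mult intro!: mult_right_mono)
    qed
    also have "\<dots> = e" by (simp add: sum_distrib_left[symmetric] \<theta>1)
    finally show ?thesis .
  qed
  ultimately show thesis by (rule that)
qed

end

section \<open>The modules of a weighted inverse system\<close>

lemma pullback_apply: "d \<in> topspace Y \<Longrightarrow> pullback Y p x d = x (p d)"
  by (simp add: pullback_def)

lemma pullback_carrier:
  assumes "continuous_map Y X p" "x \<in> carrier (cont_fun_ring X)"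
  shows "pullback Y p x \<in> carrier (cont_fun_ring Y)"
  using assms continuous_map_compose[OF assms(1), of euclidean x]
  by (simp add: pullback_def mem_cont_fun_ring o_def)

locale weighted_inverse_system = inverse_system C r
  for C :: "nat \<Rightarrow> 'a topology" and r :: "nat \<Rightarrow> 'a \<Rightarrow> 'a" +
  fixes w :: "nat \<Rightarrow> 'a \<Rightarrow> complex" and \<mu> :: "'a \<Rightarrow> (nat \<Rightarrow> 'a) measure"
  assumes w_cont: "\<And>k. continuous_map (C k) euclidean (w k)"
    and w_sum: "\<And>k c. c \<in> topspace (C k) \<Longrightarrow>
      (\<Sum>d | d \<in> topspace (C (Suc k)) \<and> r k d = c. (cmod (w (Suc k) d))\<^sup>2) = (cmod (w k c))\<^sup>2"
    and fibre_measure: "\<And>c. c \<in> topspace (C 0) \<Longrightarrow> is_fibre_measure C r w c (\<mu> c)"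
begin

lemma pre_level_module: "pre_inner_product_module (C 0) (level_module C r w k)"
proof (rule pre_inner_product_module_of_functional[where Y = "C k" and p = "down r k" and
      I = "\<lambda>c u. \<Sum>d\<in>fibre C r k c. u d * complex_of_real ((cmod (w k d))\<^sup>2)"])
  show "continuous_map (C k) (C 0) (down r k)" by (rule down_cont)
  fix u v :: "'a \<Rightarrow> complex" and c
  show "(\<Sum>d\<in>fibre C r k c. u d * complex_of_real ((cmod (w k d))\<^sup>2)) =
      (\<Sum>d\<in>fibre C r k c. v d * complex_of_real ((cmod (w k d))\<^sup>2))"
    if "\<And>d. d \<in> topspace (C k) \<Longrightarrow> u d = v d"
    using that by (intro sum.cong) (auto simp: fibre_def)
  show "(\<Sum>d\<in>fibre C r k c. u d * f (down r k d) * complex_of_real ((cmod (w k d))\<^sup>2)) =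
      (\<Sum>d\<in>fibre C r k c. u d * complex_of_real ((cmod (w k d))\<^sup>2)) * f c" for f
    unfolding sum_distrib_right by (intro sum.cong) (auto simp: fibre_def)
next
  fix u :: "'a \<Rightarrow> complex" assume u: "continuous_map (C k) euclidean u"
  have "continuous_map (C k) euclidean (\<lambda>d. (cmod (w k d))\<^sup>2)"
    unfolding power2_eq_square by (intro continuous_map_real_mult continuous_map_norm w_cont)
  then show "continuous_map (C 0) euclidean
      (\<lambda>c. \<Sum>d\<in>fibre C r k c. u d * complex_of_real ((cmod (w k d))\<^sup>2))"
    by (intro continuous_map_sum_fibre continuous_map_complex_mult u continuous_map_complex_of_real)
next
  fix u :: "'a \<Rightarrow> real" and c assume u: "\<And>d. 0 \<le> u d"
  have "(\<Sum>d\<in>fibre C r k c. complex_of_real (u d) * complex_of_real ((cmod (w k d))\<^sup>2)) =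
      complex_of_real (\<Sum>d\<in>fibre C r k c. u d * (cmod (w k d))\<^sup>2)"
    by simp
  also have "\<dots> \<in> \<real>\<^sub>\<ge>\<^sub>0"
    unfolding nonneg_Reals_of_real_iff using u by (intro sum_nonneg) auto
  finally show "(\<Sum>d\<in>fibre C r k c. complex_of_real (u d) * complex_of_real ((cmod (w k d))\<^sup>2)) \<in> \<real>\<^sub>\<ge>\<^sub>0" .
qed (simp_all add: level_module_def distrib_right sum.distrib)

section \<open>Integration against the fibre measures\<close>

lemma topspace_limit_fibre: "topspace (limit_fibre C r c) = {d \<in> topspace Lim. d 0 = c}"
  by (auto simp: limit_fibre_def)

context
  fixes c assumes c: "c \<in> topspace (C 0)"
begin

lemma prob_mu: "prob_space (\<mu> c)"
  using fibre_measure[OF c] by (simp add: is_fibre_measure_def)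

lemma sets_mu: "sets (\<mu> c) = sets (sigma (topspace (limit_fibre C r c)) {U. openin (limit_fibre C r c) U})"
  using fibre_measure[OF c] by (simp add: is_fibre_measure_def)

lemma space_mu: "space (\<mu> c) = {d \<in> topspace Lim. d 0 = c}"
proof -
  have "{U. openin (limit_fibre C r c) U} \<subseteq> Pow (topspace (limit_fibre C r c))"
    using openin_subset by blast
  then show ?thesis
    using sets_eq_imp_space_eq[OF sets_mu] by (simp add: space_measure_of topspace_limit_fibre)
qed

lemma measurable_mu:
  fixes x :: "(nat \<Rightarrow> 'a) \<Rightarrow> 'b::topological_space"
  assumes x: "continuous_map Lim euclidean x"
  shows "x \<in> borel_measurable (\<mu> c)"
proof (rule borel_measurableI)
  fix S :: "'b set" assume S: "open S"
  have sub: "{U. openin (limit_fibre C r c) U} \<subseteq> Pow (topspace (limit_fibre C r c))"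
    using openin_subset by blast
  have "continuous_map (limit_fibre C r c) euclidean x"
    unfolding limit_fibre_def using x by (rule continuous_map_from_subtopology)
  then have "openin (limit_fibre C r c) {d \<in> topspace (limit_fibre C r c). x d \<in> S}"
    using S by (intro openin_continuous_map_preimage) auto
  moreover have "{d \<in> topspace (limit_fibre C r c). x d \<in> S} = x -` S \<inter> space (\<mu> c)"
    by (auto simp: space_mu topspace_limit_fibre)
  ultimately show "x -` S \<inter> space (\<mu> c) \<in> sets (\<mu> c)"
    using sub by (simp add: sets_mu)
qed

lemma integrable_mu:
  fixes x :: "(nat \<Rightarrow> 'a) \<Rightarrow> complex"
  assumes x: "continuous_map Lim euclidean x"
  shows "integrable (\<mu> c) x"
proof -
  interpret prob_space "\<mu> c" by (rule prob_mu)
  obtain K where "\<And>d. d \<in> topspace Lim \<Longrightarrow> cmod (x d) \<le> K"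
    using compact_space_norm_bounded[OF compact_Lim x] by blast
  then show ?thesis
    by (intro integrable_const_bound[where B = K] AE_I2 measurable_mu x) (simp add: space_mu)
qed

lemma integral_bound:
  fixes x :: "(nat \<Rightarrow> 'a) \<Rightarrow> complex"
  assumes x: "continuous_map Lim euclidean x" and le: "\<And>d. d \<in> topspace Lim \<Longrightarrow> cmod (x d) \<le> e"
  shows "cmod (integral\<^sup>L (\<mu> c) x) \<le> e"
proof -
  interpret prob_space "\<mu> c" by (rule prob_mu)
  have "cmod (integral\<^sup>L (\<mu> c) x) \<le> (\<integral>d. cmod (x d) \<partial>\<mu> c)"
    by (rule integral_norm_bound)
  also have "\<dots> \<le> e"
    using integrable_mu[OF x] le by (intro integral_le_const integrable_norm AE_I2) (simp_all add: space_mu)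
  finally show ?thesis .
qed

lemma integral_proj:
  fixes y :: "'a \<Rightarrow> complex"
  assumes y: "continuous_map (C k) euclidean y"
  shows "(\<integral>d. y (d k) \<partial>\<mu> c) = (\<Sum>d\<in>fibre C r k c. y d * complex_of_real ((cmod (w k d))\<^sup>2))"
proof -
  \<comment> \<open>The measure is characterised on extensional functions only; restricting y
    changes neither the integral nor the sum.\<close>
  let ?y = "\<lambda>a\<in>topspace (C k). y a"
  have "(\<integral>d. y (d k) \<partial>\<mu> c) = (\<integral>d. ?y (d k) \<partial>\<mu> c)"
    by (intro Bochner_Integration.integral_cong) (auto simp: space_mu Lim_mem)
  also have "\<dots> = (\<Sum>d\<in>fibre C r k c. ?y d * complex_of_real ((cmod (w k d))\<^sup>2))"
  proof -
    have "?y \<in> carrier (cont_fun_ring (C k))" using y by (simp add: mem_cont_fun_ring)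
    with fibre_measure[OF c] show ?thesis unfolding is_fibre_measure_def by blast
  qed
  also have "\<dots> = (\<Sum>d\<in>fibre C r k c. y d * complex_of_real ((cmod (w k d))\<^sup>2))"
    by (intro sum.cong) (auto simp: fibre_def)
  finally show ?thesis .
qed

end

lemma continuous_map_proj:
  "continuous_map (C k) X y \<Longrightarrow> continuous_map Lim X (\<lambda>d. y (d k))"
  using continuous_map_compose[OF proj_cont] by (auto simp: o_def)

lemma continuous_map_fibre_integral:
  fixes x :: "(nat \<Rightarrow> 'a) \<Rightarrow> complex"
  assumes x: "continuous_map Lim euclidean x"
  shows "continuous_map (C 0) euclidean (\<lambda>c. integral\<^sup>L (\<mu> c) x)"
proof (rule continuous_map_uniform_approx)
  fix e :: real assume e: "e > 0"
  obtain N y where y: "continuous_map (C N) euclidean y"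
    and le: "\<And>d. d \<in> topspace Lim \<Longrightarrow> cmod (x d - y (d N)) \<le> e"
    using Lim_approx[OF x e] by blast
  let ?g = "\<lambda>c. \<Sum>d\<in>fibre C r N c. y d * complex_of_real ((cmod (w N d))\<^sup>2)"
  have yL: "continuous_map Lim euclidean (\<lambda>d. y (d N))" using y by (rule continuous_map_proj)
  have "continuous_map (C N) euclidean (\<lambda>d. (cmod (w N d))\<^sup>2)"
    unfolding power2_eq_square by (intro continuous_map_real_mult continuous_map_norm w_cont)
  then have "continuous_map (C 0) euclidean ?g"
    by (intro continuous_map_sum_fibre continuous_map_complex_mult y continuous_map_complex_of_real)
  \<comment> \<open>The estimate has the same e for every c because each measure has total mass
    1.\<close>
  moreover have "cmod (integral\<^sup>L (\<mu> c) x - ?g c) \<le> e" if c: "c \<in> topspace (C 0)" for c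
  proof -
    have "integral\<^sup>L (\<mu> c) x - ?g c = (\<integral>d. x d - y (d N) \<partial>\<mu> c)"
      using integrable_mu[OF c x] integrable_mu[OF c yL] by (simp add: integral_proj[OF c y])
    also have "cmod \<dots> \<le> e"
      using le by (intro integral_bound[OF c] continuous_map_diff x yL)
    finally show ?thesis .
  qed
  ultimately show "\<exists>g. continuous_map (C 0) euclidean g \<and>
      (\<forall>c\<in>topspace (C 0). cmod (integral\<^sup>L (\<mu> c) x - g c) \<le> e)"
    by (intro exI[of _ ?g]) blast
qed

lemma pre_limit_module: "pre_inner_product_module (C 0) (limit_module C r \<mu>)"
proof (rule pre_inner_product_module_of_functional[where Y = Lim and p = "\<lambda>d. d 0" and
      I = "\<lambda>c u. integral\<^sup>L (\<mu> c) u"])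
  show "continuous_map Lim (C 0) (\<lambda>d. d 0)" by (rule proj_cont)
  fix u v :: "(nat \<Rightarrow> 'a) \<Rightarrow> complex" and c assume c: "c \<in> topspace (C 0)"
  show "integral\<^sup>L (\<mu> c) u = integral\<^sup>L (\<mu> c) v" if "\<And>d. d \<in> topspace Lim \<Longrightarrow> u d = v d"
    using that by (intro Bochner_Integration.integral_cong) (auto simp: space_mu[OF c])
  show "(\<integral>d. cnj (u d) \<partial>\<mu> c) = cnj (integral\<^sup>L (\<mu> c) u)" by (rule Bochner_Integration.integral_cnj)
  assume u: "continuous_map Lim euclidean u"
  show "(\<integral>d. u d * f (d 0) \<partial>\<mu> c) = integral\<^sup>L (\<mu> c) u * f c" for f
  proof -
    have "(\<integral>d. u d * f (d 0) \<partial>\<mu> c) = (\<integral>d. u d * f c \<partial>\<mu> c)"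
      by (intro Bochner_Integration.integral_cong) (auto simp: space_mu[OF c])
    then show ?thesis by simp
  qed
  show "(\<integral>d. u d + v d \<partial>\<mu> c) = integral\<^sup>L (\<mu> c) u + integral\<^sup>L (\<mu> c) v"
    if "continuous_map Lim euclidean v"
    using integrable_mu[OF c u] integrable_mu[OF c that] by simp
next
  fix u :: "(nat \<Rightarrow> 'a) \<Rightarrow> real" and c assume "\<And>d. 0 \<le> u d"
  then show "(\<integral>d. complex_of_real (u d) \<partial>\<mu> c) \<in> \<real>\<^sub>\<ge>\<^sub>0"
    by (simp add: integral_complex_of_real)
qed (simp_all add: limit_module_def continuous_map_fibre_integral)

text \<open>Group the fibre on level k + 1 over its points e on level k: the pulled-back product is
  constant on each group, and the weights in the group add up to |w_k(e)|^2.\<close>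

lemma pullback_level_preserving:
  "ip_preserving (level_module C r w k) (level_module C r w (Suc k)) (pullback (C (Suc k)) (r k))"
  unfolding ip_preserving_def
proof (intro conjI funcsetI ballI)
  fix x assume x: "x \<in> carrier (level_module C r w k)"
  then show "pullback (C (Suc k)) (r k) x \<in> carrier (level_module C r w (Suc k))"
    using pullback_carrier[OF r_cont] by (simp add: level_module_def)
  fix y assume y: "y \<in> carrier (level_module C r w k)"
  let ?P = "pullback (C (Suc k)) (r k)"
  have "(\<Sum>d | d \<in> topspace (C (Suc k)) \<and> r k d = e. cnj (?P x d) * ?P y d * complex_of_real ((cmod (w (Suc k) d))\<^sup>2))
      = cnj (x e) * y e * complex_of_real ((cmod (w k e))\<^sup>2)" if e: "e \<in> topspace (C k)" for e
    unfolding w_sum[OF e, symmetric] of_real_sum sum_distrib_left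
    by (intro sum.cong) (auto simp: pullback_apply)
  then have "(\<Sum>d\<in>fibre C r (Suc k) c. cnj (?P x d) * ?P y d * complex_of_real ((cmod (w (Suc k) d))\<^sup>2))
      = (\<Sum>e\<in>fibre C r k c. cnj (x e) * y e * complex_of_real ((cmod (w k e))\<^sup>2))" for c
    unfolding sum_fibre_Suc by (intro sum.cong) (auto simp: fibre_def)
  then show "ip (level_module C r w (Suc k)) (?P x) (?P y) = ip (level_module C r w k) x y"
    by (simp add: level_module_def)
qed

text \<open>This is the defining property of mu^c applied to the product conj x times y on level
  k.\<close>

lemma pullback_limit_preserving:
  "ip_preserving (level_module C r w k) (limit_module C r \<mu>) (pullback Lim (\<lambda>d. d k))"
  unfolding ip_preserving_def
proof (intro conjI funcsetI ballI)
  fix x assume x: "x \<in> carrier (level_module C r w k)"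
  then show "pullback Lim (\<lambda>d. d k) x \<in> carrier (limit_module C r \<mu>)"
    using pullback_carrier[OF proj_cont] by (simp add: level_module_def limit_module_def)
  fix y assume y: "y \<in> carrier (level_module C r w k)"
  have xy: "continuous_map (C k) euclidean (\<lambda>e. cnj (x e) * y e)"
    using x y by (intro continuous_map_complex_mult continuous_map_cnj)
      (auto simp: level_module_def mem_cont_fun_ring)
  have "(\<integral>d. cnj (pullback Lim (\<lambda>d. d k) x d) * pullback Lim (\<lambda>d. d k) y d \<partial>\<mu> c) =
      (\<Sum>d\<in>fibre C r k c. cnj (x d) * y d * complex_of_real ((cmod (w k d))\<^sup>2))"
    if c: "c \<in> topspace (C 0)" for c
    unfolding integral_proj[OF c xy, symmetric]
    by (intro Bochner_Integration.integral_cong) (auto simp: space_mu[OF c] pullback_apply)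
  then show "ip (limit_module C r \<mu>) (pullback Lim (\<lambda>d. d k) x) (pullback Lim (\<lambda>d. d k) y) =
      ip (level_module C r w k) x y"
    by (simp add: limit_module_def level_module_def cong: restrict_cong)
qed

text \<open>If x(p) is nonzero, then |x| exceeds some delta on all threads whose k-th coordinate
  lies in an open V around p_k. Density puts a point of nonzero weight into V, so a fibre measure
  charges this set, against the vanishing integral of |x|^2.\<close>

lemma limit_module_definite:
  assumes dense: "\<And>k. C k closure_of {c \<in> topspace (C k). w k c \<noteq> 0} = topspace (C k)"
    and x: "x \<in> carrier (limit_module C r \<mu>)"
    and 0: "ip (limit_module C r \<mu>) x x = \<zero>\<^bsub>cont_fun_ring (C 0)\<^esub>"
  shows "x = \<zero>\<^bsub>limit_module C r \<mu>\<^esub>"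
proof -
  have xc: "continuous_map Lim euclidean x" and xe: "x \<in> extensional (topspace Lim)"
    using x by (auto simp: limit_module_def mem_cont_fun_ring)
  have int0: "(\<integral>d. cnj (x d) * x d \<partial>\<mu> c) = 0" if c: "c \<in> topspace (C 0)" for c
    using fun_cong[OF 0, of c] c by (simp add: limit_module_def cont_fun_ring_simps)
  have "x p = 0" if p: "p \<in> topspace Lim" for p
  proof (rule ccontr)
    assume "x p \<noteq> 0"
    define \<delta> where "\<delta> = cmod (x p) / 2"
    have \<delta>: "\<delta> > 0" using \<open>x p \<noteq> 0\<close> by (simp add: \<delta>_def)
    define U where "U = {d \<in> topspace Lim. cmod (x d) \<in> {\<delta><..}}"
    have oU: "openin Lim U"
      unfolding U_def using continuous_map_norm[OF xc]
      by (intro openin_continuous_map_preimage[where Y = euclideanreal]) auto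
    have pU: "p \<in> U" using p \<open>x p \<noteq> 0\<close> by (simp add: U_def \<delta>_def)
    have "\<exists>k V. openin (C k) V \<and> p k \<in> V \<and> (\<forall>d\<in>topspace Lim. d k \<in> V \<longrightarrow> d \<in> U)"
      by (rule Lim_base[OF oU pU]) blast
    then obtain k V where V: "openin (C k) V" "p k \<in> V"
      "\<And>d. \<lbrakk>d \<in> topspace Lim; d k \<in> V\<rbrakk> \<Longrightarrow> d \<in> U" by blast
    have "p k \<in> C k closure_of {c \<in> topspace (C k). w k c \<noteq> 0}"
      using dense p by (simp add: Lim_mem)
    then obtain a where a: "a \<in> topspace (C k)" "w k a \<noteq> 0" "a \<in> V"
      using V(1,2) by (auto simp: in_closure_of)
    have "\<exists>f. continuous_map (C k) euclideanreal f \<and> f a = 1 \<and>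
        (\<forall>b\<in>topspace (C k). 0 \<le> f b \<and> (b \<notin> V \<longrightarrow> f b = 0))"
      by (rule Urysohn_point[OF V(1) a(3)]) blast
    then obtain f :: "'a \<Rightarrow> real" where f: "continuous_map (C k) euclideanreal f" "f a = 1"
      "\<And>b. b \<in> topspace (C k) \<Longrightarrow> 0 \<le> f b" "\<And>b. \<lbrakk>b \<in> topspace (C k); b \<notin> V\<rbrakk> \<Longrightarrow> f b = 0"
      by blast
    obtain K where K: "K \<ge> 0" "\<And>b. b \<in> topspace (C k) \<Longrightarrow> f b \<le> K"
      using compact_space_norm_bounded[OF compact_C continuous_map_complex_of_real[OF f(1)]] by fastforce
    \<comment> \<open>The contradiction is sought over the point below a, which need not be the
      point below p.\<close>
    define c where "c = down r k a"
    have c: "c \<in> topspace (C 0)" using a by (simp add: c_def down_closed)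
    interpret prob_space "\<mu> c" by (rule prob_mu[OF c])
    have fc: "continuous_map (C k) euclidean (\<lambda>b. complex_of_real (f b))"
      using f(1) by (rule continuous_map_complex_of_real)
    have int1: "integrable (\<mu> c) (\<lambda>d. complex_of_real (f (d k)))"
      by (rule integrable_mu[OF c continuous_map_proj[OF fc]])
    have xx: "continuous_map Lim euclidean (\<lambda>d. cnj (x d) * x d)"
      by (intro continuous_map_complex_mult continuous_map_cnj xc)
    have sq: "(\<lambda>d. cnj (x d) * x d) = (\<lambda>d. complex_of_real ((cmod (x d))\<^sup>2))"
      by (simp add: complex_norm_square mult.commute fun_eq_iff del: of_real_power)
    have "complex_of_real (\<integral>d. (cmod (x d))\<^sup>2 \<partial>\<mu> c) = 0"
      using int0[OF c] unfolding sq integral_complex_of_real .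
    then have i0: "(\<integral>d. (cmod (x d))\<^sup>2 \<partial>\<mu> c) = 0" by simp
    have i2: "integrable (\<mu> c) (\<lambda>d. (cmod (x d))\<^sup>2)"
      using integrable_mu[OF c xx] unfolding sq by (rule complex_of_real_integrable_eq[THEN iffD1])
    have i1: "integrable (\<mu> c) (\<lambda>d. f (d k))"
      using int1 by (rule complex_of_real_integrable_eq[THEN iffD1])
    \<comment> \<open>A bump f carried by V stands in for its indicator; K bounds f, since
      \<open>Urysohn_point\<close> retains only the lower bound 0.\<close>
    have "(\<integral>d. \<delta>\<^sup>2 * f (d k) \<partial>\<mu> c) \<le> (\<integral>d. K * (cmod (x d))\<^sup>2 \<partial>\<mu> c)"
    proof (rule integral_mono)
      fix d assume "d \<in> space (\<mu> c)"
      then have d: "d \<in> topspace Lim" by (simp add: space_mu[OF c])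
      show "\<delta>\<^sup>2 * f (d k) \<le> K * (cmod (x d))\<^sup>2"
      proof (cases "d k \<in> V")
        case True
        then have "\<delta> \<le> cmod (x d)" using V(3)[OF d] by (simp add: U_def)
        then have "\<delta>\<^sup>2 * f (d k) \<le> (cmod (x d))\<^sup>2 * K"
          using \<delta> K f(3) Lim_mem[OF d] by (intro mult_mono power_mono) auto
        then show ?thesis by (simp add: mult.commute)
      next
        case False
        then show ?thesis using f(4) Lim_mem[OF d] K by simp
      qed
    qed (use i1 i2 in auto)
    then have "\<delta>\<^sup>2 * (\<integral>d. f (d k) \<partial>\<mu> c) \<le> 0" using i0 by simp
    then have le0: "(\<integral>d. f (d k) \<partial>\<mu> c) \<le> 0"
      using \<delta> by (simp add: mult_le_0_iff)
    \<comment> \<open>The integral of the bump is a weighted fibre sum of nonnegative terms, one of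
      which is |w_k(a)|^2 > 0.\<close>
    have "complex_of_real (\<integral>d. f (d k) \<partial>\<mu> c) = complex_of_real (\<Sum>d\<in>fibre C r k c. f d * (cmod (w k d))\<^sup>2)"
      using integral_proj[OF c fc] unfolding integral_complex_of_real by simp
    then have "(\<integral>d. f (d k) \<partial>\<mu> c) = (\<Sum>d\<in>fibre C r k c. f d * (cmod (w k d))\<^sup>2)"
      by (simp only: of_real_eq_iff)
    moreover have "f a * (cmod (w k a))\<^sup>2 \<le> (\<Sum>d\<in>fibre C r k c. f d * (cmod (w k d))\<^sup>2)"
      using a f(3) by (intro member_le_sum finite_fibre) (auto simp: fibre_def c_def)
    moreover have "0 < f a * (cmod (w k a))\<^sup>2" using a f(2) by simp
    ultimately show False using le0 by linarith
  qed
  then have "x = (\<lambda>d\<in>topspace Lim. 0)"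
    using xe by (intro extensionalityI[where A = "topspace Lim"]) auto
  then show ?thesis by (simp add: limit_module_def cont_fun_ring_simps)
qed

section \<open>The completed modules and density of the levels\<close>

sublocale L0: pre_ip "C 0" "limit_module C r \<mu>"
  by unfold_locales (rule compact_C pre_limit_module)+

sublocale X0: pre_ip "C 0" "level_module C r w k" for k
  by unfold_locales (rule compact_C pre_level_module)+

text \<open>Subtraction goes through an additive inverse given by description, so its pointwise
  value is recovered by adding y back.\<close>

lemma limit_minus_apply:
  assumes x: "x \<in> carrier (limit_module C r \<mu>)" and y: "y \<in> carrier (limit_module C r \<mu>)"
    and d: "d \<in> topspace Lim"
  shows "(x \<ominus>\<^bsub>limit_module C r \<mu>\<^esub> y) d = x d - y d"
proof -
  have "x = (x \<ominus>\<^bsub>limit_module C r \<mu>\<^esub> y) \<oplus>\<^bsub>limit_module C r \<mu>\<^esub> y"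
    using x y by (simp add: a_minus_def L0.a_assoc L0.l_neg)
  then have "x d = ((x \<ominus>\<^bsub>limit_module C r \<mu>\<^esub> y) \<oplus>\<^bsub>limit_module C r \<mu>\<^esub> y) d" by simp
  also have "\<dots> = (x \<ominus>\<^bsub>limit_module C r \<mu>\<^esub> y) d + y d"
    using d by (simp add: limit_module_def cont_fun_ring_simps)
  finally show ?thesis by simp
qed

text \<open>Supremum-norm approximation controls the module norm because the fibre measures have
  mass 1.\<close>

lemma limit_nrm_le:
  assumes x: "x \<in> carrier (limit_module C r \<mu>)" and e: "0 \<le> e"
    and le: "\<And>d. d \<in> topspace Lim \<Longrightarrow> cmod (x d) \<le> e"
  shows "L0.nrm x \<le> e"
proof (rule L0.nrm_least[OF e])
  fix c assume c: "c \<in> topspace (C 0)"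
  have xc: "continuous_map Lim euclidean x"
    using x by (simp add: limit_module_def mem_cont_fun_ring)
  have "cmod (\<integral>d. cnj (x d) * x d \<partial>\<mu> c) \<le> e\<^sup>2"
    using le e
    by (intro integral_bound[OF c] continuous_map_complex_mult continuous_map_cnj xc)
      (auto simp: norm_mult power2_eq_square intro!: mult_mono)
  then show "L0.pnorm c x \<le> e"
    using c e unfolding L0.pnorm_def by (intro real_le_lsqrt) (simp_all add: limit_module_def)
qed

sublocale lev: ip_preserving_map "C 0" "level_module C r w k" "level_module C r w (Suc k)"
  "pullback (C (Suc k)) (r k)" for k
  by unfold_locales (rule pullback_level_preserving)

sublocale lim: ip_preserving_map "C 0" "level_module C r w k" "limit_module C r \<mu>"
  "pullback Lim (\<lambda>d. d k)" for k
  by unfold_locales (rule pullback_limit_preserving)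

text \<open>The identity already holds for the pullbacks themselves, since r_k(d_(k+1)) = d_k on
  threads, and is carried over term by term to Cauchy sequences.\<close>

lemma compl_pullbacks_compatible:
  assumes "\<xi> \<in> carrier (X0.Mh k)"
  shows "compl_map (C 0) (limit_module C r \<mu>) (pullback Lim (\<lambda>d. d (Suc k)))
      (compl_map (C 0) (level_module C r w (Suc k)) (pullback (C (Suc k)) (r k)) \<xi>) =
    compl_map (C 0) (limit_module C r \<mu>) (pullback Lim (\<lambda>d. d k)) \<xi>"
proof -
  obtain s where s: "s \<in> X0.CS k" "\<xi> = X0.cls k s" using assms by (auto simp: X0.compl_carrier)
  have "pullback Lim (\<lambda>d. d (Suc k)) (pullback (C (Suc k)) (r k) x) = pullback Lim (\<lambda>d. d k) x" for x
    by (auto simp: pullback_def fun_eq_iff Lim_mem Lim_r)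
  then show ?thesis
    using s by (simp add: lev.compl_map_cls lim.compl_map_cls lev.T_CS)
qed

text \<open>Half of e is spent on replacing a class by a continuous function on the limit, the other
  half on replacing that function by one from a finite level.\<close>

lemma level_images_dense:
  assumes \<xi>: "\<xi> \<in> carrier L0.Mh" and e: "e > 0"
  shows "\<exists>k. \<exists>\<eta>\<in>carrier (X0.Mh k). mod_norm (C 0) L0.Mh
    (\<xi> \<ominus>\<^bsub>L0.Mh\<^esub> compl_map (C 0) (limit_module C r \<mu>) (pullback Lim (\<lambda>d. d k)) \<eta>) \<le> e"
proof -
  interpret h: pre_ip "C 0" L0.Mh by (rule L0.pre_ip_completion)
  have e2: "e/2 > 0" using e by simp
  obtain x where x: "x \<in> carrier (limit_module C r \<mu>)"
    and 1: "h.nrm (\<xi> \<ominus>\<^bsub>L0.Mh\<^esub> compl_embed (C 0) (limit_module C r \<mu>) x) \<le> e/2"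
    using L0.embed_dense[OF \<xi> e2] by blast
  have xc: "continuous_map Lim euclidean x"
    using x by (simp add: limit_module_def mem_cont_fun_ring)
  obtain N y where y: "continuous_map (C N) euclidean y"
    and le: "\<And>d. d \<in> topspace Lim \<Longrightarrow> cmod (x d - y (d N)) \<le> e/2"
    using Lim_approx[OF xc e2] by blast
  define y' where "y' = (\<lambda>a\<in>topspace (C N). y a)"
  have y': "y' \<in> carrier (level_module C r w N)"
    using y by (simp add: y'_def level_module_def mem_cont_fun_ring)
  let ?p = "pullback Lim (\<lambda>d. d N) y'"
  have p: "?p \<in> carrier (limit_module C r \<mu>)" by (rule lim.T_closed[OF y'])
  have "L0.nrm (x \<ominus>\<^bsub>limit_module C r \<mu>\<^esub> ?p) \<le> e/2"
  proof (rule limit_nrm_le)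
    fix d assume d: "d \<in> topspace Lim"
    show "cmod ((x \<ominus>\<^bsub>limit_module C r \<mu>\<^esub> ?p) d) \<le> e/2"
      unfolding limit_minus_apply[OF x p d] pullback_apply[OF d]
      using le[OF d] by (simp add: y'_def Lim_mem[OF d])
  qed (use x p e in auto)
  then have 2: "h.nrm (compl_embed (C 0) (limit_module C r \<mu>) x \<ominus>\<^bsub>L0.Mh\<^esub> compl_embed (C 0) (limit_module C r \<mu>) ?p) \<le> e/2"
    using x p by (simp add: L0.embed_minus L0.nrm_embed)
  have "h.nrm (\<xi> \<ominus>\<^bsub>L0.Mh\<^esub> compl_embed (C 0) (limit_module C r \<mu>) ?p) \<le> e"
    using h.nrm_triangle[OF \<xi> L0.embed_in[OF x] L0.embed_in[OF p]] 1 2 by linarith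
  then show ?thesis
    using X0.embed_in[OF y'] lim.compl_map_embed[OF y'] by metis
qed

end

text \<open>Definiteness of C(C_infinity) carries a density condition because weights vanishing on
  an open set can create nonzero vectors of length zero; the completion divides them out. The
  equation with \<open>compl_embed\<close> expresses that \<open>P k\<close> extends pi_k^*.\<close>

theorem proposition6p2:
  fixes C :: "nat \<Rightarrow> 'a topology"
    and r :: "nat \<Rightarrow> 'a \<Rightarrow> 'a"
    and w :: "nat \<Rightarrow> 'a \<Rightarrow> complex"
    and \<mu> :: "'a \<Rightarrow> (nat \<Rightarrow> 'a) measure"
  defines "X0 \<equiv> level_module C r w"
    and "X \<equiv> (\<lambda>k. mod_completion (C 0) (level_module C r w k))"
    and "T \<equiv> (\<lambda>k. compl_map (C 0) (level_module C r w (Suc k)) (pullback (C (Suc k)) (r k)))"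
    and "L0 \<equiv> limit_module C r \<mu>"
    and "L \<equiv> mod_completion (C 0) (limit_module C r \<mu>)"
    and "P \<equiv> (\<lambda>k. compl_map (C 0) (limit_module C r \<mu>) (pullback (inverse_limit C r) (\<lambda>d. d k)))"
  assumes "\<And>k. compact_space (C k)"
    and "\<And>k. Hausdorff_space (C k)"
    and "\<And>k. local_homeomorphism_map (C (Suc k)) (C k) (r k)"
    and "\<And>k. r k ` topspace (C (Suc k)) = topspace (C k)"
    and "\<And>k. continuous_map (C k) euclidean (w k)"
    and "\<And>c. c \<in> topspace (C 0) \<Longrightarrow> w 0 c = 1"
    and "\<And>k c. c \<in> topspace (C k) \<Longrightarrow>
           (\<Sum>d | d \<in> topspace (C (Suc k)) \<and> r k d = c. (cmod (w (Suc k) d))\<^sup>2) = (cmod (w k c))\<^sup>2"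
    and "\<And>c. c \<in> topspace (C 0) \<Longrightarrow> is_fibre_measure C r w c (\<mu> c)"
  shows "pre_inner_product_module (C 0) L0 \<and>
    ((\<forall>k. C k closure_of {c \<in> topspace (C k). w k c \<noteq> 0} = topspace (C k)) \<longrightarrow>
       inner_product_module (C 0) L0) \<and>
    (\<forall>k. P k \<in> module_homs (C 0) (X k) L \<and>
         ip_preserving (X k) L (P k) \<and>
         (\<forall>x\<in>carrier (X0 k).
            P k (compl_embed (C 0) (X0 k) x) =
              compl_embed (C 0) L0 (pullback (inverse_limit C r) (\<lambda>d. d k) x))) \<and>
    is_direct_limit TYPE('z) (C 0) X T L P"
proof -
  interpret S: weighted_inverse_system C r w \<mu>
    by unfold_locales (fact assms)+
  have hX: "hilbert_module (C 0) (X k)" for k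
    unfolding X_def by (rule S.X0.hilbert_module_completion)
  have hL: "hilbert_module (C 0) L"
    unfolding L_def by (rule S.L0.hilbert_module_completion)
  have ipP: "ip_preserving (X k) L (P k)" for k
    unfolding X_def L_def P_def by (rule S.lim.ip_preserving_compl_map)
  have ipT: "ip_preserving (X k) (X (Suc k)) (T k)" for k
    unfolding X_def T_def by (rule S.lev.ip_preserving_compl_map)
  \<comment> \<open>\<open>module_hom\<close> asks for a definite target. The completion
    \<open>L\<close> is definite even when \<open>L0\<close> is not.\<close>
  have homP: "P k \<in> module_homs (C 0) (X k) L" for k
  proof -
    interpret ip_preserving_map "C 0" "X k" L "P k"
      using hX hL ipP S.compact_C
      by (simp add: ip_preserving_map_def ip_preserving_map_axioms_def pre_ip_pair_def hilbert_module_pre_ip)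
    show ?thesis using hL by (intro module_hom) (simp add: hilbert_module_def)
  qed
  have "pre_inner_product_module (C 0) L0"
    unfolding L0_def by (rule S.pre_limit_module)
  moreover have "inner_product_module (C 0) L0"
    if "\<forall>k. C k closure_of {c \<in> topspace (C k). w k c \<noteq> 0} = topspace (C k)"
    unfolding L0_def inner_product_module_def
    using that S.pre_limit_module S.limit_module_definite by blast
  moreover have "P k (compl_embed (C 0) (X0 k) x) =
      compl_embed (C 0) L0 (pullback (inverse_limit C r) (\<lambda>d. d k) x)" if "x \<in> carrier (X0 k)" for k x
    using that unfolding P_def X0_def L0_def by (rule S.lim.compl_map_embed)
  moreover have "is_direct_limit TYPE('z) (C 0) X T L P"
  proof (rule is_direct_limitI)
    show "direct_system (C 0) X T"
      using hX ipT by (simp add: direct_system_def)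
    show "P (Suc k) (T k \<xi>) = P k \<xi>" if "\<xi> \<in> carrier (X k)" for k \<xi>
      using that unfolding P_def T_def X_def by (rule S.compl_pullbacks_compatible)
    show "\<exists>k. \<exists>\<eta>\<in>carrier (X k). mod_norm (C 0) L (\<xi> \<ominus>\<^bsub>L\<^esub> P k \<eta>) \<le> e" if "\<xi> \<in> carrier L" "e > 0" for \<xi> e
      using that unfolding P_def X_def L_def by (rule S.level_images_dense)
  qed (rule S.compact_C hL ipP)+
  ultimately show ?thesis using homP ipP by blast
qed

end
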